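(* Let $n\ge 1$, and let $T=S^1\times S^1$ be the torus, regarded as a topological abelian group with identity element $e$. Let $C_n^e(T)=\{\{x_1,\dots,x_n\}\in C_n(T): \prod_{i=1}^n x_i=e\}$. Then, as subgroups of $B_n(T)=\pi_1(C_n(T))$, the group $\pi_1(C_n^e(T))$ is the normal closure of $B_n(D)$ in $B_n(T)$, i.e. the smallest normal subgroup of $B_n(T)$ containing $B_n(D)$.
   Context: For a surface $S$, $C'_n(S)=\{(x_1,\dots,x_n)\in S^n : x_i\ne x_j \text{ for } i\neq j\}$ is the ordered configuration space and $C_n(S)=C'_n(S)/S_n$ is the unordered configuration space, i.e. the space of subsets of $S$ of cardinality $n$ with the quotient topology. The braid group is $B_n(S)=\pi_1(C_n(S))$. Base points and identifications: $D\subset T$ is an embedded closed 2-dimensional disk, and a common base point $x^0=\{x_1^0,\dots,x_n^0\}$ is fixed, consisting of $n$ distinct points in the interior of $D$ with $\prod_{i=1}^n x_i^0=e$ (so $D$ is assumed to be such that this is possible, e.g. $e$ lies in the interior of $D$). All fundamental groups are taken at $x^0$. The group $B_n(D)=\pi_1(C_n(D),x^0)$ is identified with its image in $B_n(T)=\pi_1(C_n(T),x^0)$ under the homomorphism induced by the inclusion $C_n(D)\hookrightarrow C_n(T)$, and $\pi_1(C_n^e(T))=\pi_1(C_n^e(T),x^0)$ is identified with its image in $B_n(T)$ under the homomorphism induced by the inclusion $C_n^e(T)\hookrightarrow C_n(T)$; both homomorphisms are injective. *)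

theory Defs
  imports "HOL-Analysis.Analysis" "HOL-Algebra.Coset" "HOL-Algebra.FiniteProduct"
begin

section \<open>Configuration spaces\<close>

definition quotient_topology :: "'a topology \<Rightarrow> ('a \<Rightarrow> 'b) \<Rightarrow> 'b topology" where
  "quotient_topology X f =
     topology (\<lambda>U. U \<subseteq> f ` topspace X \<and> openin X {x \<in> topspace X. f x \<in> U})"

lemma openin_quotient_topology:
  fixes f :: "'a \<Rightarrow> 'b"
  shows "openin (quotient_topology X f) U \<longleftrightarrow>
     U \<subseteq> f ` topspace X \<and> openin X {x \<in> topspace X. f x \<in> U}"
proof -
  have "istopology (\<lambda>U. U \<subseteq> f ` topspace X \<and> openin X {x \<in> topspace X. f x \<in> U})"
    unfolding istopology_def
  proof (intro conjI allI impI)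
    fix S T
    assume S: "S \<subseteq> f ` topspace X \<and> openin X {x \<in> topspace X. f x \<in> S}"
      and T: "T \<subseteq> f ` topspace X \<and> openin X {x \<in> topspace X. f x \<in> T}"
    show "S \<inter> T \<subseteq> f ` topspace X" using S by blast
    have "{x \<in> topspace X. f x \<in> S \<inter> T} = {x \<in> topspace X. f x \<in> S} \<inter> {x \<in> topspace X. f x \<in> T}"
      by blast
    then show "openin X {x \<in> topspace X. f x \<in> S \<inter> T}" using S T by auto
  next
    fix K :: "'b set set"
    assume K: "\<forall>U\<in>K. U \<subseteq> f ` topspace X \<and> openin X {x \<in> topspace X. f x \<in> U}"
    show "\<Union>K \<subseteq> f ` topspace X" using K by blast
    have "{x \<in> topspace X. f x \<in> \<Union>K} = (\<Union>U\<in>K. {x \<in> topspace X. f x \<in> U})" by blast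
    then show "openin X {x \<in> topspace X. f x \<in> \<Union>K}" using K by auto
  qed
  then show ?thesis by (simp add: quotient_topology_def)
qed

lemma topspace_quotient_topology: "topspace (quotient_topology X f) = f ` topspace X"
proof
  show "topspace (quotient_topology X f) \<subseteq> f ` topspace X"
    using openin_quotient_topology[of X f "topspace (quotient_topology X f)"] by simp
  have "{x \<in> topspace X. f x \<in> f ` topspace X} = topspace X" by blast
  then have "openin (quotient_topology X f) (f ` topspace X)"
    by (simp add: openin_quotient_topology)
  then show "f ` topspace X \<subseteq> topspace (quotient_topology X f)"
    by (rule openin_subset)
qed

lemma quotient_map_quotient_topology: "quotient_map X (quotient_topology X f) f"
  by (auto simp: quotient_map_def topspace_quotient_topology openin_quotient_topology)

definition ordered_conf :: "nat \<Rightarrow> 'a topology \<Rightarrow> (nat \<Rightarrow> 'a) topology" where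
  "ordered_conf n X =
     subtopology (product_topology (\<lambda>_. X) {1..n}) {x. inj_on x {1..n}}"

text \<open>The fibres of \<open>x \<mapsto> x ` {1..n}\<close> on the ordered configuration space are exactly the
  orbits of the symmetric group permuting the coordinates.\<close>

definition conf :: "nat \<Rightarrow> 'a topology \<Rightarrow> 'a set topology" where
  "conf n X = quotient_topology (ordered_conf n X) (\<lambda>x. x ` {1..n})"

lemma topspace_conf: "topspace (conf n X) = {A. A \<subseteq> topspace X \<and> finite A \<and> card A = n}"
proof -
  have "(\<lambda>x. x ` {1..n}) ` {x \<in> {1..n} \<rightarrow>\<^sub>E topspace X. inj_on x {1..n}}
      = {A. A \<subseteq> topspace X \<and> finite A \<and> card A = n}" (is "?L = ?R")
  proof
    show "?L \<subseteq> ?R" by (auto simp: card_image)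
    show "?R \<subseteq> ?L"
    proof
      fix A assume A: "A \<in> ?R"
      then obtain h where h: "bij_betw h {1..n} A"
        using ex_bij_betw_nat_finite_1[of A] by auto
      let ?x = "restrict h {1..n}"
      have im: "h ` {1..n} = A" and inj: "inj_on h {1..n}"
        using h by (simp_all add: bij_betw_def)
      have "?x ` {1..n} = A" using im by simp
      moreover have "inj_on ?x {1..n}" using inj by simp
      moreover have "\<forall>i\<in>{1..n}. h i \<in> topspace X" using im A by blast
      then have "?x \<in> {1..n} \<rightarrow>\<^sub>E topspace X" by (simp only: restrict_PiE_iff)
      ultimately show "A \<in> ?L" by (intro image_eqI[of _ _ ?x]) simp_all
    qed
  qed
  moreover have "topspace (ordered_conf n X) = {x \<in> {1..n} \<rightarrow>\<^sub>E topspace X. inj_on x {1..n}}"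
    by (auto simp: ordered_conf_def)
  ultimately show ?thesis by (simp add: conf_def topspace_quotient_topology)
qed

section \<open>Fundamental groups\<close>

definition loops :: "'a topology \<Rightarrow> 'a \<Rightarrow> (real \<Rightarrow> 'a) set" where
  "loops X a = {p. pathin X p \<and> p 0 = a \<and> p 1 = a}"

text \<open>As for \<^const>\<open>pathin\<close>, only the restriction of a loop to the unit interval matters:
  loops agreeing there lie in the same class.\<close>

definition loop_class :: "'a topology \<Rightarrow> 'a \<Rightarrow> (real \<Rightarrow> 'a) \<Rightarrow> (real \<Rightarrow> 'a) set" where
  "loop_class X a p =
     {q \<in> loops X a. homotopic_with (\<lambda>r. r 0 = a \<and> r 1 = a) (top_of_set {0..1}) X p q}"

text \<open>Concatenation as in \<^const>\<open>joinpaths\<close>, which is not available here because it requires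
  the values to lie in a type of class \<^class>\<open>topological_space\<close>.\<close>

definition loop_join :: "(real \<Rightarrow> 'a) \<Rightarrow> (real \<Rightarrow> 'a) \<Rightarrow> real \<Rightarrow> 'a" where
  "loop_join p q = (\<lambda>t. if t \<le> 1/2 then p (2 * t) else q (2 * t - 1))"

definition fundamental_group :: "'a topology \<Rightarrow> 'a \<Rightarrow> (real \<Rightarrow> 'a) set monoid" where
  "fundamental_group X a =
     \<lparr>carrier = loop_class X a ` loops X a,
      mult = (\<lambda>A B. \<Union>p\<in>A. \<Union>q\<in>B. loop_class X a (loop_join p q)),
      one = loop_class X a (\<lambda>_. a)\<rparr>"

text \<open>The homomorphism into \<open>fundamental_group Y (f a)\<close> induced by a continuous map \<open>f\<close> whose
  domain is based at \<open>a\<close>.\<close>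

definition induced_hom :: "'b topology \<Rightarrow> 'a \<Rightarrow> ('a \<Rightarrow> 'b) \<Rightarrow> (real \<Rightarrow> 'a) set \<Rightarrow> (real \<Rightarrow> 'b) set"
  where "induced_hom Y a f A = (\<Union>p\<in>A. loop_class Y (f a) (f \<circ> p))"

text \<open>Image of the fundamental group of a space \<open>X\<close>, all of whose points are points of \<open>Y\<close>,
  under the homomorphism induced by the inclusion.\<close>

definition inclusion_image :: "'a topology \<Rightarrow> 'a topology \<Rightarrow> 'a \<Rightarrow> (real \<Rightarrow> 'a) set set" where
  "inclusion_image X Y a = induced_hom Y a (\<lambda>x. x) ` carrier (fundamental_group X a)"

definition normal_closure :: "('a, 'm) monoid_scheme \<Rightarrow> 'a set \<Rightarrow> 'a set" where
  "normal_closure G S = \<Inter>{N. N \<lhd> G \<and> S \<subseteq> N}"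

section \<open>The torus\<close>

definition circle_group :: "complex monoid" where
  "circle_group = \<lparr>carrier = sphere 0 1, mult = (*), one = 1\<rparr>"

definition torus_group :: "(complex \<times> complex) monoid" where
  "torus_group = circle_group \<times>\<times> circle_group"

definition torus :: "(complex \<times> complex) topology" where
  "torus = prod_topology (top_of_set (sphere 0 1)) (top_of_set (sphere 0 1))"

lemma comm_group_circle_group: "comm_group circle_group"
proof (rule comm_groupI)
  fix x assume "x \<in> carrier circle_group"
  then have "x \<noteq> 0" and "norm x = 1" by (auto simp: circle_group_def)
  then have "inverse x \<in> carrier circle_group \<and> inverse x \<otimes>\<^bsub>circle_group\<^esub> x = \<one>\<^bsub>circle_group\<^esub>"
    by (simp add: circle_group_def norm_inverse)
  then show "\<exists>y\<in>carrier circle_group. y \<otimes>\<^bsub>circle_group\<^esub> x = \<one>\<^bsub>circle_group\<^esub>" by blast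
qed (auto simp: circle_group_def norm_mult)

lemma comm_group_torus_group: "comm_group torus_group"
proof (rule group.group_comm_groupI)
  interpret comm_group circle_group by (rule comm_group_circle_group)
  show "group torus_group"
    unfolding torus_group_def by (intro DirProd_group is_group)
  show "x \<otimes>\<^bsub>torus_group\<^esub> y = y \<otimes>\<^bsub>torus_group\<^esub> x" for x y
    by (auto simp: torus_group_def DirProd_def circle_group_def mult.commute split: prod.splits)
qed

lemma topspace_torus: "topspace torus = carrier torus_group"
  by (simp add: torus_def torus_group_def circle_group_def DirProd_def)

definition conf_e :: "nat \<Rightarrow> (complex \<times> complex) set topology" where
  "conf_e n = subtopology (conf n torus) {A. finprod torus_group (\<lambda>x. x) A = \<one>\<^bsub>torus_group\<^esub>}"

end

theory Submission
  imports Defs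
begin

text \<open>Loops in \<open>conf_e n\<close> are, up to homotopy, exactly the loops in \<open>conf n torus\<close> along which the path
  of products is null-homotopic in the torus: lift the points to the plane and subtract from each an
  equal share of the displacement of their sum. This describes the left-hand side as a normal subgroup,
  and it contains the loops in the disc because a disc lifts to the plane.

  For the converse fix a normal subgroup \<open>N\<close> containing the braids of the disc, and regard the
  fundamental group modulo \<open>N\<close> as an invariant of paths of configurations. Paths lift to paths of
  \<open>n\<close>-tuples in the plane avoiding the collisions \<open>y i - y j \<in> gauss_lattice\<close>. Near any
  tuple, collisions included, every loop of configurations can be dragged into the disc and so is
  invisible modulo \<open>N\<close>. Hence the invariant ignores collisions altogether and, as the space of all
  tuples is simply connected, only depends on the end points of the lift. The deck transformations that
  fix a collision are then killed; they include the transpositions combined with opposite translations,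
  and these generate all permutations combined with translations of total displacement zero.\<close>

section \<open>Paths up to homotopy\<close>

definition path_homotopic :: "'a topology \<Rightarrow> (real \<Rightarrow> 'a) \<Rightarrow> (real \<Rightarrow> 'a) \<Rightarrow> bool" where
  "path_homotopic X p q \<longleftrightarrow>
     homotopic_with (\<lambda>r. r 0 = p 0 \<and> r 1 = p 1) (top_of_set {0..1}) X p q"

lemma path_homotopic_iff:
  "path_homotopic X p q \<longleftrightarrow>
     (\<exists>h. continuous_map (top_of_set ({0..1::real} \<times> {0..1::real})) X h \<and>
          (\<forall>t\<in>{0..1}. h (0, t) = p t \<and> h (1, t) = q t) \<and>
          (\<forall>s\<in>{0..1}. h (s, 0) = p 0 \<and> h (s, 1) = p 1))"
  unfolding path_homotopic_def by (subst homotopic_with) (simp_all add: ball_conj_distrib conj_assoc)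

lemma path_homotopic_imp:
  assumes "path_homotopic X p q"
  shows "pathin X p" "pathin X q" "q 0 = p 0" "q 1 = p 1"
  using homotopic_with_imp_continuous_maps[OF assms[unfolded path_homotopic_def]]
    homotopic_with_imp_property[OF assms[unfolded path_homotopic_def]]
  by (auto simp: pathin_def)

lemma path_homotopic_refl: "pathin X p \<Longrightarrow> path_homotopic X p p"
  by (simp add: path_homotopic_def pathin_def)

lemma path_homotopic_sym: "path_homotopic X p q \<Longrightarrow> path_homotopic X q p"
  using path_homotopic_imp(3,4)[of X p q]
  by (simp add: path_homotopic_def homotopic_with_sym)

lemma path_homotopic_trans:
  "path_homotopic X p q \<Longrightarrow> path_homotopic X q r \<Longrightarrow> path_homotopic X p r"
  using path_homotopic_imp(3,4)[of X p q]
  by (simp add: path_homotopic_def) (rule homotopic_with_trans)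

lemma path_homotopic_eqI:
  assumes "pathin X p" "\<And>t. t \<in> {0..1} \<Longrightarrow> q t = p t"
  shows "path_homotopic X p q"
  unfolding path_homotopic_iff
proof (intro exI conjI)
  have "continuous_map (top_of_set ({0..1} \<times> {0..1})) (top_of_set {0..1::real}) snd"
    by (auto simp: continuous_map_in_subtopology intro!: continuous_intros)
  then show "continuous_map (top_of_set ({0..1} \<times> {0..1})) X (p \<circ> snd)"
    using assms(1) unfolding pathin_def by (rule continuous_map_compose)
qed (use assms in auto)

lemma path_homotopic_convex_image:
  fixes S :: "'b::real_normed_vector set"
  assumes S: "convex S" and K: "continuous_map (top_of_set S) X K"
    and f: "continuous_on {0..1} f" "f \<in> {0..1} \<rightarrow> S"
    and g: "continuous_on {0..1} g" "g \<in> {0..1} \<rightarrow> S"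
    and eq: "f 0 = g 0" "f 1 = g 1"
  shows "path_homotopic X (K \<circ> f) (K \<circ> g)"
  unfolding path_homotopic_iff
proof (intro exI conjI)
  let ?h = "\<lambda>z::real\<times>real. (1 - fst z) *\<^sub>R f (snd z) + fst z *\<^sub>R g (snd z)"
  have *: "continuous_on ({0..1} \<times> {0..1}) (\<lambda>z::real\<times>real. f (snd z))"
    "continuous_on ({0..1} \<times> {0..1}) (\<lambda>z::real\<times>real. g (snd z))"
    by (rule continuous_on_compose2[OF f(1)], auto intro!: continuous_intros)
       (rule continuous_on_compose2[OF g(1)], auto intro!: continuous_intros)
  have "continuous_on ({0..1} \<times> {0..1}) ?h"
    by (intro continuous_intros *)
  moreover have "?h \<in> {0..1} \<times> {0..1} \<rightarrow> S"
    using f(2) g(2) by (auto intro!: convexD[OF S])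
  ultimately have "continuous_map (top_of_set ({0..1} \<times> {0..1})) (top_of_set S) ?h"
    by (auto simp: continuous_map_in_subtopology)
  then show "continuous_map (top_of_set ({0..1} \<times> {0..1})) X (K \<circ> ?h)"
    using K by (rule continuous_map_compose)
qed (auto simp: eq algebra_simps simp flip: scaleR_add_left)

lemma pathin_compose_interval:
  assumes "pathin X p" "continuous_on {0..1} f" "f \<in> {0..1} \<rightarrow> {0..1}"
  shows "pathin X (p \<circ> f)"
  using assms unfolding pathin_def
  by (intro continuous_map_compose[of _ "top_of_set {0..1}"]) (auto simp: continuous_map_in_subtopology)

lemma path_homotopic_reparam:
  assumes "pathin X p" "continuous_on {0..1} f" "f \<in> {0..1} \<rightarrow> {0..1}"
    "continuous_on {0..1} g" "g \<in> {0..1} \<rightarrow> {0..1}" "f 0 = g 0" "f 1 = g 1"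
  shows "path_homotopic X (p \<circ> f) (p \<circ> g)"
  using assms unfolding pathin_def by (intro path_homotopic_convex_image[of "{0..1}"]) auto

lemma loop_join_simps [simp]: "loop_join p q 0 = p 0" "loop_join p q 1 = q 1"
  by (auto simp: loop_join_def)

lemma continuous_map_loop_join:
  fixes S :: "'b::topological_space set"
  assumes p: "continuous_map (top_of_set (S \<times> {0..1})) X (\<lambda>z. p (fst z) (snd z))"
    and q: "continuous_map (top_of_set (S \<times> {0..1})) X (\<lambda>z. q (fst z) (snd z))"
    and eq: "\<And>y. y \<in> S \<Longrightarrow> p y 1 = q y 0"
  shows "continuous_map (top_of_set (S \<times> {0..1::real})) X
           (\<lambda>z. loop_join (p (fst z)) (q (fst z)) (snd z))"
  unfolding loop_join_def
proof (rule continuous_map_cases_le)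
  let ?Z = "S \<times> {0..1::real}"
  show "continuous_map (top_of_set ?Z) euclideanreal snd" by (simp add: continuous_intros)
  show "continuous_map (top_of_set ?Z) euclideanreal (\<lambda>z. 1 / 2)" by simp
  have "continuous_map (top_of_set {z \<in> ?Z. snd z \<le> 1 / 2}) (top_of_set ?Z) (\<lambda>z. (fst z, 2 * snd z))"
    by (auto simp: continuous_map_in_subtopology intro!: continuous_intros)
  from continuous_map_compose[OF this p]
  show "continuous_map (subtopology (top_of_set ?Z) {z \<in> topspace (top_of_set ?Z). snd z \<le> 1 / 2}) X
          (\<lambda>z. p (fst z) (2 * snd z))"
    by (simp add: o_def subtopology_subtopology inf.absorb2 Collect_restrict)
  have "continuous_map (top_of_set {z \<in> ?Z. 1 / 2 \<le> snd z}) (top_of_set ?Z) (\<lambda>z. (fst z, 2 * snd z - 1))"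
    by (auto simp: continuous_map_in_subtopology intro!: continuous_intros)
  from continuous_map_compose[OF this q]
  show "continuous_map (subtopology (top_of_set ?Z) {z \<in> topspace (top_of_set ?Z). 1 / 2 \<le> snd z}) X
          (\<lambda>z. q (fst z) (2 * snd z - 1))"
    by (simp add: o_def subtopology_subtopology inf.absorb2 Collect_restrict)
  show "p (fst z) (2 * snd z) = q (fst z) (2 * snd z - 1)"
    if "z \<in> topspace (top_of_set ?Z)" "snd z = 1 / 2" for z
  proof -
    have "2 * snd z = 1" using that(2) by simp
    then show ?thesis using that(1) eq[of "fst z"] by auto
  qed
qed

lemma pathin_loop_join:
  assumes "pathin X p" "pathin X q" "p 1 = q 0"
  shows "pathin X (loop_join p q)"
proof -
  let ?I = "{0..1::real}"
  have snd: "continuous_map (top_of_set (?I \<times> ?I)) (top_of_set ?I) snd"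
    by (auto simp: continuous_map_in_subtopology intro!: continuous_intros)
  have 1: "continuous_map (top_of_set (?I \<times> ?I)) X (\<lambda>z. loop_join ((\<lambda>_. p) (fst z)) ((\<lambda>_. q) (fst z)) (snd z))"
    using assms continuous_map_compose[OF snd] unfolding pathin_def
    by (intro continuous_map_loop_join) (auto simp: o_def)
  have 2: "continuous_map (top_of_set ?I) (top_of_set (?I \<times> ?I)) (\<lambda>t. (0, t))"
    by (auto simp: continuous_map_in_subtopology intro!: continuous_intros)
  show ?thesis
    using continuous_map_compose[OF 2 1] by (simp add: pathin_def o_def)
qed

lemma path_homotopic_join:
  assumes "path_homotopic X p p'" "path_homotopic X q q'" "p 1 = q 0"
  shows "path_homotopic X (loop_join p q) (loop_join p' q')"
proof -
  let ?I = "{0..1::real}"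
  obtain h where h: "continuous_map (top_of_set (?I \<times> ?I)) X h"
      "\<And>t. t\<in>?I \<Longrightarrow> h (0, t) = p t \<and> h (1, t) = p' t" "\<And>s. s\<in>?I \<Longrightarrow> h (s, 0) = p 0 \<and> h (s, 1) = p 1"
    using assms(1) unfolding path_homotopic_iff by blast
  obtain k where k: "continuous_map (top_of_set (?I \<times> ?I)) X k"
      "\<And>t. t\<in>?I \<Longrightarrow> k (0, t) = q t \<and> k (1, t) = q' t" "\<And>s. s\<in>?I \<Longrightarrow> k (s, 0) = q 0 \<and> k (s, 1) = q 1"
    using assms(2) unfolding path_homotopic_iff by blast
  let ?h = "\<lambda>z. loop_join (\<lambda>t. h (fst z, t)) (\<lambda>t. k (fst z, t)) (snd z)"
  have "continuous_map (top_of_set (?I \<times> ?I)) X (\<lambda>z. loop_join ((\<lambda>s t. h (s,t)) (fst z)) ((\<lambda>s t. k (s, t)) (fst z)) (snd z))"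
    by (rule continuous_map_loop_join) (use h k assms(3) in auto)
  then have 1: "continuous_map (top_of_set (?I \<times> ?I)) X ?h" by simp
  show ?thesis
    unfolding path_homotopic_iff
    by (intro exI[of _ ?h] conjI 1) (use h k in \<open>auto simp: loop_join_def\<close>)
qed

definition path_rev :: "(real \<Rightarrow> 'a) \<Rightarrow> real \<Rightarrow> 'a" where
  "path_rev p = (\<lambda>t. p (1 - t))"

lemma path_rev_simps [simp]: "path_rev p 0 = p 1" "path_rev p 1 = p 0"
  by (auto simp: path_rev_def)

lemma pathin_path_rev: "pathin X p \<Longrightarrow> pathin X (path_rev p)"
  unfolding path_rev_def using pathin_compose_interval[of X p "\<lambda>t. 1 - t"]
  by (simp add: o_def continuous_on_diff)

lemma path_homotopic_rev_join:
  assumes "pathin X p"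
  shows "path_homotopic X (loop_join p (path_rev p)) (\<lambda>_. p 0)"
proof -
  let ?f = "\<lambda>t::real. if t \<le> 1/2 then 2 * t else 2 - 2 * t"
  have "continuous_on {0..1} ?f"
    by (rule continuous_on_cases_1) (auto intro!: continuous_intros)
  then have "path_homotopic X (p \<circ> ?f) (p \<circ> (\<lambda>_. 0))"
    by (intro path_homotopic_reparam[OF assms]) auto
  moreover have "loop_join p (path_rev p) = p \<circ> ?f"
    by (auto simp: loop_join_def path_rev_def fun_eq_iff)
  ultimately show ?thesis by (simp add: o_def)
qed

lemma path_homotopic_join_rev:
  assumes "pathin X p"
  shows "path_homotopic X (loop_join (path_rev p) p) (\<lambda>_. p 1)"
  using path_homotopic_rev_join[OF pathin_path_rev[OF assms]]
  by (simp add: path_rev_def)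

lemma path_homotopic_const_join:
  assumes "pathin X p"
  shows "path_homotopic X (loop_join (\<lambda>_. p 0) p) p"
proof -
  have "path_homotopic X (p \<circ> (\<lambda>t. max 0 (2 * t - 1))) (p \<circ> (\<lambda>t. t))"
    by (intro path_homotopic_reparam[OF assms]) (auto intro!: continuous_intros)
  moreover have h: "2 * t = 1" if "1 \<le> 2 * t" "t * 2 \<le> 1" for t :: real
    using that by simp
  have "loop_join (\<lambda>_. p 0) p = p \<circ> (\<lambda>t. max 0 (2 * t - 1))"
    by (auto simp: loop_join_def fun_eq_iff max_def h)
  ultimately show ?thesis by (simp add: o_def)
qed

lemma path_homotopic_join_const:
  assumes "pathin X p"
  shows "path_homotopic X (loop_join p (\<lambda>_. p 1)) p"
proof -
  have "path_homotopic X (p \<circ> (\<lambda>t. min 1 (2 * t))) (p \<circ> (\<lambda>t. t))"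
    by (intro path_homotopic_reparam[OF assms]) (auto intro!: continuous_intros)
  moreover have h: "2 * t = 1" if "1 \<le> 2 * t" "t * 2 \<le> 1" for t :: real
    using that by simp
  have "loop_join p (\<lambda>_. p 1) = p \<circ> (\<lambda>t. min 1 (2 * t))"
    by (auto simp: loop_join_def fun_eq_iff min_def h)
  ultimately show ?thesis by (simp add: o_def)
qed

lemma path_homotopic_assoc:
  assumes "pathin X p" "pathin X q" "pathin X r" "p 1 = q 0" "q 1 = r 0"
  shows "path_homotopic X (loop_join p (loop_join q r)) (loop_join (loop_join p q) r)"
proof -
  let ?f = "\<lambda>t::real. if t \<le> 1/2 then t / 2 else if t \<le> 3/4 then t - 1/4 else 2 * t - 1"
  let ?J = "loop_join (loop_join p q) r"
  have "?f = (\<lambda>t::real. max (max (t / 2) (t - 1/4)) (2 * t - 1))"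
    by (auto simp: fun_eq_iff max_def field_simps)
  then have "continuous_on {0..1} ?f" by (simp only:) (intro continuous_intros, simp_all)
  moreover have "pathin X ?J" using assms by (simp add: pathin_loop_join)
  ultimately have "path_homotopic X (?J \<circ> ?f) (?J \<circ> (\<lambda>t. t))"
    by (intro path_homotopic_reparam) auto
  moreover have "loop_join p (loop_join q r) t = (?J \<circ> ?f) t" for t
  proof -
    consider "t \<le> 1/2" | "t > 1/2" "t \<le> 3/4" | "t > 3/4" by linarith
    then show ?thesis
    proof cases
      case 2
      then have "2 * (2 * (t - 1/4)) - 1 = 2 * (2 * t - 1)" by simp
      with 2 show ?thesis by (simp add: loop_join_def)
    qed (simp_all add: loop_join_def)
  qed
  then have "loop_join p (loop_join q r) = ?J \<circ> ?f" by (rule ext)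
  ultimately show ?thesis by (simp add: o_def)
qed

section \<open>The fundamental group\<close>

lemma loops_iff: "p \<in> loops X a \<longleftrightarrow> pathin X p \<and> p 0 = a \<and> p 1 = a"
  by (simp add: loops_def)

lemma in_loop_class_iff:
  assumes "p \<in> loops X a"
  shows "q \<in> loop_class X a p \<longleftrightarrow> path_homotopic X p q"
  using assms path_homotopic_imp[of X p q]
  by (auto simp: loop_class_def path_homotopic_def loops_def)

lemma loop_class_refl: "p \<in> loops X a \<Longrightarrow> p \<in> loop_class X a p"
  by (simp add: in_loop_class_iff path_homotopic_refl loops_def)

lemma loop_class_eq_iff:
  assumes "p \<in> loops X a" "q \<in> loops X a"
  shows "loop_class X a p = loop_class X a q \<longleftrightarrow> path_homotopic X p q"
proof
  assume "loop_class X a p = loop_class X a q"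
  then show "path_homotopic X p q"
    using in_loop_class_iff[OF assms(1), of q] loop_class_refl[OF assms(2)] by simp
next
  assume "path_homotopic X p q"
  then show "loop_class X a p = loop_class X a q"
    using in_loop_class_iff[OF assms(1)] in_loop_class_iff[OF assms(2)]
      path_homotopic_trans path_homotopic_sym by blast
qed

lemma loop_join_loops: "p \<in> loops X a \<Longrightarrow> q \<in> loops X a \<Longrightarrow> loop_join p q \<in> loops X a"
  by (simp add: loops_iff pathin_loop_join)

lemma carrier_fundamental_group: "carrier (fundamental_group X a) = loop_class X a ` loops X a"
  by (simp add: fundamental_group_def)

lemma mult_fundamental_group:
  assumes "p \<in> loops X a" "q \<in> loops X a"
  shows "loop_class X a p \<otimes>\<^bsub>fundamental_group X a\<^esub> loop_class X a q = loop_class X a (loop_join p q)"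
proof -
  have eq: "loop_class X a (loop_join p' q') = loop_class X a (loop_join p q)"
    if "p' \<in> loop_class X a p" "q' \<in> loop_class X a q" for p' q'
  proof -
    have *: "path_homotopic X p p'" "path_homotopic X q q'"
      using that assms by (auto simp: in_loop_class_iff)
    moreover have "p' \<in> loops X a" "q' \<in> loops X a"
      using that by (auto simp: loop_class_def)
    ultimately show ?thesis
      using assms by (subst eq_commute, subst loop_class_eq_iff)
        (auto simp: loops_iff intro!: path_homotopic_join pathin_loop_join)
  qed
  have "loop_class X a p \<noteq> {}" "loop_class X a q \<noteq> {}"
    using assms[THEN loop_class_refl] by blast+
  then have "(\<Union>p'\<in>loop_class X a p. \<Union>q'\<in>loop_class X a q. loop_class X a (loop_join p' q'))
      = loop_class X a (loop_join p q)"
    by (intro SUP_eq_const eq)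
  then show ?thesis by (simp add: fundamental_group_def)
qed

lemma one_fundamental_group: "\<one>\<^bsub>fundamental_group X a\<^esub> = loop_class X a (\<lambda>_. a)"
  by (simp add: fundamental_group_def)

lemma group_fundamental_group:
  assumes "a \<in> topspace X"
  shows "group (fundamental_group X a)"
proof (rule groupI)
  let ?G = "fundamental_group X a"
  have c: "(\<lambda>_. a) \<in> loops X a" using assms by (simp add: loops_def)
  show "x \<otimes>\<^bsub>?G\<^esub> y \<in> carrier ?G" if "x \<in> carrier ?G" "y \<in> carrier ?G" for x y
    using that by (auto simp: carrier_fundamental_group mult_fundamental_group loop_join_loops)
  show "\<one>\<^bsub>?G\<^esub> \<in> carrier ?G"
    using c by (simp add: carrier_fundamental_group one_fundamental_group)
  show "x \<otimes>\<^bsub>?G\<^esub> y \<otimes>\<^bsub>?G\<^esub> z = x \<otimes>\<^bsub>?G\<^esub> (y \<otimes>\<^bsub>?G\<^esub> z)"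
    if xyz: "x \<in> carrier ?G" "y \<in> carrier ?G" "z \<in> carrier ?G" for x y z
  proof -
    obtain p q r where p: "p \<in> loops X a" "q \<in> loops X a" "r \<in> loops X a"
      and [simp]: "x = loop_class X a p" "y = loop_class X a q" "z = loop_class X a r"
      using xyz by (auto simp: carrier_fundamental_group)
    then show ?thesis
      by (simp add: mult_fundamental_group loop_join_loops loop_class_eq_iff)
         (intro path_homotopic_sym[OF path_homotopic_assoc], auto simp: loops_iff)
  qed
  show "\<one>\<^bsub>?G\<^esub> \<otimes>\<^bsub>?G\<^esub> x = x" if x: "x \<in> carrier ?G" for x
  proof -
    obtain p where p: "p \<in> loops X a" and [simp]: "x = loop_class X a p"
      using x by (auto simp: carrier_fundamental_group)
    have "path_homotopic X (loop_join (\<lambda>_. a) p) p"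
      using path_homotopic_const_join[of X p] p by (simp add: loops_iff)
    then have "loop_class X a (loop_join (\<lambda>_. a) p) = loop_class X a p"
      by (subst loop_class_eq_iff) (auto intro: loop_join_loops c p)
    then show ?thesis
      using p c by (simp add: one_fundamental_group mult_fundamental_group)
  qed
  show "\<exists>y\<in>carrier ?G. y \<otimes>\<^bsub>?G\<^esub> x = \<one>\<^bsub>?G\<^esub>" if x: "x \<in> carrier ?G" for x
  proof -
    obtain p where p: "p \<in> loops X a" and [simp]: "x = loop_class X a p"
      using x by (auto simp: carrier_fundamental_group)
    then have r: "path_rev p \<in> loops X a" by (simp add: loops_iff pathin_path_rev)
    have "path_homotopic X (loop_join (path_rev p) p) (\<lambda>_. a)"
      using p path_homotopic_join_rev[of X p] by (simp add: loops_iff)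
    then have "loop_class X a (loop_join (path_rev p) p) = loop_class X a (\<lambda>_. a)"
      by (subst loop_class_eq_iff) (auto intro: loop_join_loops c p r)
    then have "loop_class X a (path_rev p) \<otimes>\<^bsub>?G\<^esub> x = \<one>\<^bsub>?G\<^esub>"
      using p r by (simp add: mult_fundamental_group one_fundamental_group)
    then show ?thesis using r by (auto simp: carrier_fundamental_group)
  qed
qed

lemma inv_fundamental_group:
  assumes "p \<in> loops X a"
  shows "inv\<^bsub>fundamental_group X a\<^esub> loop_class X a p = loop_class X a (path_rev p)"
proof -
  have a: "a \<in> topspace X"
    using assms by (auto simp: loops_iff dest: path_start_in_topspace)
  interpret group "fundamental_group X a" by (rule group_fundamental_group[OF a])
  have r: "path_rev p \<in> loops X a" using assms by (simp add: loops_iff pathin_path_rev)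
  have c: "(\<lambda>_. a) \<in> loops X a" using a by (simp add: loops_def)
  show ?thesis
  proof (rule inv_equality)
    have "path_homotopic X (loop_join (path_rev p) p) (\<lambda>_. a)"
      using assms path_homotopic_join_rev[of X p] by (simp add: loops_iff)
    then have "loop_class X a (loop_join (path_rev p) p) = loop_class X a (\<lambda>_. a)"
      by (subst loop_class_eq_iff) (auto intro: loop_join_loops c assms r)
    then show "loop_class X a (path_rev p) \<otimes>\<^bsub>fundamental_group X a\<^esub> loop_class X a p = \<one>\<^bsub>fundamental_group X a\<^esub>"
      using assms r by (simp add: mult_fundamental_group one_fundamental_group)
  qed (use assms r in \<open>auto simp: carrier_fundamental_group\<close>)
qed

lemma path_homotopic_compose:
  assumes "path_homotopic X p q" "continuous_map X Y f"
  shows "path_homotopic Y (f \<circ> p) (f \<circ> q)"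
proof -
  obtain h where h: "continuous_map (top_of_set ({0..1::real} \<times> {0..1::real})) X h"
    "(\<forall>t\<in>{0..1}. h (0, t) = p t \<and> h (1, t) = q t) \<and> (\<forall>s\<in>{0..1}. h (s, 0) = p 0 \<and> h (s, 1) = p 1)"
    using assms(1) unfolding path_homotopic_iff by blast
  show ?thesis
    unfolding path_homotopic_iff
    by (rule exI[of _ "f \<circ> h"], rule conjI[OF continuous_map_compose[OF h(1) assms(2)]])
       (use h(2) in simp)
qed

lemma inclusion_image_eq:
  assumes "continuous_map X Y (\<lambda>x. x)"
  shows "inclusion_image X Y a = loop_class Y a ` loops X a"
proof -
  have loops: "q \<in> loops Y a" if "q \<in> loops X a" for q
    using that continuous_map_compose[of _ X q, OF _ assms] unfolding loops_iff pathin_def o_def by simp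
  have eq: "loop_class Y a q = loop_class Y a p" if p: "p \<in> loops X a" and q: "q \<in> loop_class X a p" for p q
  proof -
    have "q \<in> loops X a" "path_homotopic X p q"
      using q in_loop_class_iff[OF p, of q] by (simp_all add: loop_class_def)
    then show ?thesis
      using path_homotopic_compose[OF _ assms, of p q] loops[OF p] loops[of q] loop_class_eq_iff[of p Y a q]
      unfolding o_def by metis
  qed
  have "induced_hom Y a (\<lambda>x. x) (loop_class X a p) = loop_class Y a p" if p: "p \<in> loops X a" for p
  proof -
    have "p \<in> loop_class X a p"
      using p by (rule loop_class_refl)
    then have "loop_class X a p \<noteq> {}" by blast
    then show ?thesis
      unfolding induced_hom_def o_def by (rule SUP_eq_const) (rule eq[OF p])
  qed
  then show ?thesis
    unfolding inclusion_image_def carrier_fundamental_group by (auto simp: image_def)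
qed

section \<open>Path invariants\<close>

text \<open>A group-valued functor on the fundamental groupoid.\<close>

locale path_character = group Q for Q (structure) +
  fixes X :: "'a topology" and c :: "(real \<Rightarrow> 'a) \<Rightarrow> 'q"
  assumes c_closed [simp]: "pathin X p \<Longrightarrow> c p \<in> carrier Q"
    and c_join: "pathin X p \<Longrightarrow> pathin X q \<Longrightarrow> p 1 = q 0 \<Longrightarrow> c (loop_join p q) = c p \<otimes> c q"
    and c_homotopic: "path_homotopic X p q \<Longrightarrow> c p = c q"
begin

lemma c_const:
  assumes "a \<in> topspace X"
  shows "c (\<lambda>_. a) = \<one>"
proof -
  have p: "pathin X (\<lambda>_. a)" using assms by simp
  have "c (\<lambda>_. a) \<otimes> c (\<lambda>_. a) = c (\<lambda>_. a)"
    using c_join[OF p p] c_homotopic[OF path_homotopic_const_join[OF p]] by simp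
  then show ?thesis using p c_closed l_cancel_one by blast
qed

lemma c_rev:
  assumes "pathin X p"
  shows "c (path_rev p) = inv (c p)"
proof -
  have "c (path_rev p) \<otimes> c p = c (loop_join (path_rev p) p)"
    using c_join[OF pathin_path_rev[OF assms] assms] by simp
  also have "\<dots> = c (\<lambda>_. p 1)"
    by (rule c_homotopic[OF path_homotopic_join_rev[OF assms]])
  also have "\<dots> = \<one>"
    by (rule c_const[OF path_finish_in_topspace[OF assms]])
  finally show ?thesis
    using inv_equality c_closed[OF assms] c_closed[OF pathin_path_rev[OF assms]] by metis
qed

lemma c_eqI:
  assumes "pathin X p" "\<And>t. t \<in> {0..1} \<Longrightarrow> q t = p t"
  shows "c q = c p"
  using c_homotopic[OF path_homotopic_eqI[OF assms]] by simp

lemma c_convex_image: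
  fixes S :: "'e::real_normed_vector set"
  assumes "convex S" "continuous_map (top_of_set S) X K"
    and "continuous_on {0..1} f" "f \<in> {0..1} \<rightarrow> S" "continuous_on {0..1} g" "g \<in> {0..1} \<rightarrow> S"
    and "f 0 = g 0" "f 1 = g 1"
  shows "c (K \<circ> f) = c (K \<circ> g)"
  using assms by (intro c_homotopic path_homotopic_convex_image)

lemma c_subdivide:
  assumes p: "pathin X p" and m: "0 \<le> a" "a \<le> b" "b \<le> 1"
  shows "c (\<lambda>t. p (b * t)) = c (\<lambda>t. p (a * t)) \<otimes> c (\<lambda>t. p (a + (b - a) * t))"
proof -
  have e: "b * t \<in> {0..1}" "a * t \<in> {0..1}" "a + (b - a) * t \<in> {0..1}" if "t \<in> {0..1}" for t
  proof -
    have t: "0 \<le> t" "t \<le> 1" using that by auto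
    show "b * t \<in> {0..1}" "a * t \<in> {0..1}"
      using t m mult_mono[of b 1 t 1] mult_mono[of a 1 t 1] by auto
    have "a + (b - a) * t \<le> a + (b - a) * 1"
      using t m by (intro add_left_mono mult_left_mono) auto
    then show "a + (b - a) * t \<in> {0..1}" using t m by auto
  qed
  let ?f = "loop_join (\<lambda>t. a * t) (\<lambda>t. a + (b - a) * t)"
  have 1: "pathin X (p \<circ> (\<lambda>t. a * t))" "pathin X (p \<circ> (\<lambda>t. a + (b - a) * t))"
    by (intro pathin_compose_interval[OF p]; use e in \<open>auto intro!: continuous_intros\<close>)+
  have "pathin (top_of_set {0..1}) ?f"
    using e by (intro pathin_loop_join)
      (auto simp: pathin_def continuous_map_in_subtopology intro!: continuous_intros)
  then have "continuous_on {0..1} ?f" "?f \<in> {0..1} \<rightarrow> {0..1}"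
    by (auto simp: pathin_def continuous_map_in_subtopology)
  then have "c (p \<circ> (\<lambda>t. b * t)) = c (p \<circ> ?f)"
    using e p unfolding pathin_def
    by (intro c_convex_image[of "{0..1}"]) (auto intro!: continuous_intros)
  also have "p \<circ> ?f = loop_join (p \<circ> (\<lambda>t. a * t)) (p \<circ> (\<lambda>t. a + (b - a) * t))"
    by (auto simp: loop_join_def)
  also have "c \<dots> = c (p \<circ> (\<lambda>t. a * t)) \<otimes> c (p \<circ> (\<lambda>t. a + (b - a) * t))"
    using 1 by (intro c_join) auto
  finally show ?thesis by (simp add: o_def)
qed

lemma c_free_homotopic:
  assumes K: "continuous_map (top_of_set ({0..1::real} \<times> {0..1::real})) X (\<lambda>z. K (fst z) (snd z))"
    and closed: "\<And>u. u \<in> {0..1} \<Longrightarrow> K u 0 = K u 1"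
    and triv: "c (K 1) = \<one>"
  shows "c (K 0) = \<one>"
proof -
  let ?S = "{0..1::real} \<times> {0..1::real}"
  let ?K = "\<lambda>z. K (fst z) (snd z)"
  have I: "pathin (top_of_set ?S) (\<lambda>t. (0, t))" "pathin (top_of_set ?S) (\<lambda>t. (1, t))"
    "pathin (top_of_set ?S) (\<lambda>u. (u, 0))" "pathin (top_of_set ?S) (\<lambda>u. (u, 1))"
    by (auto simp: pathin_def continuous_map_in_subtopology intro!: continuous_intros)
  have KI: "pathin X (?K \<circ> f)" if "pathin (top_of_set ?S) f" for f
    using that unfolding pathin_def by (rule continuous_map_compose[OF _ K])
  let ?f = "loop_join (\<lambda>t. (0, t)) (\<lambda>u. (u, 1))" and ?g = "loop_join (\<lambda>u. (u, 0)) (\<lambda>t. (1, t))"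
  have "pathin (top_of_set ?S) ?f" "pathin (top_of_set ?S) ?g"
    using I by (auto intro!: pathin_loop_join)
  then have "c (?K \<circ> ?f) = c (?K \<circ> ?g)"
    by (intro c_convex_image[OF _ K])
       (auto simp: pathin_def continuous_map_in_subtopology convex_Times)
  moreover have "?K \<circ> ?f = loop_join (K 0) (\<lambda>u. K u 1)" "?K \<circ> ?g = loop_join (\<lambda>u. K u 0) (K 1)"
    by (auto simp: loop_join_def)
  ultimately have eq: "c (loop_join (K 0) (\<lambda>u. K u 1)) = c (loop_join (\<lambda>u. K u 0) (K 1))"
    by (simp only:)
  have p: "pathin X (K 0)" "pathin X (K 1)" "pathin X (\<lambda>u. K u 0)" "pathin X (\<lambda>u. K u 1)"
    using I[THEN KI] by (simp_all add: o_def)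
  have "c (K 0) \<otimes> c (\<lambda>u. K u 1) = c (loop_join (K 0) (\<lambda>u. K u 1))"
    by (rule c_join[symmetric, OF p(1,4)]) (rule refl)
  also have "\<dots> = c (\<lambda>u. K u 0) \<otimes> c (K 1)"
    unfolding eq by (rule c_join[OF p(3,2)]) (rule refl)
  also have "\<dots> = c (\<lambda>u. K u 0)" using p(3) by (simp add: triv)
  also have "\<dots> = c (\<lambda>u. K u 1)" by (rule c_eqI[OF p(4)]) (rule closed)
  finally show ?thesis
    using r_cancel_one[OF c_closed[OF p(4)] c_closed[OF p(1)]] by blast
qed

lemma c_conjugate_trivial:
  assumes g: "pathin X g" and l: "pathin X l" and ends: "l 0 = g 1" "l 1 = g 1"
    and triv: "c (loop_join g (loop_join l (path_rev g))) = \<one>"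
  shows "c l = \<one>"
proof -
  note r = pathin_path_rev[OF g]
  have lr: "pathin X (loop_join l (path_rev g))"
    by (rule pathin_loop_join[OF l r]) (simp add: ends)
  have "c (loop_join g (loop_join l (path_rev g))) = c g \<otimes> c (loop_join l (path_rev g))"
    by (rule c_join[OF g lr]) (simp add: ends)
  also have "c (loop_join l (path_rev g)) = c l \<otimes> c (path_rev g)"
    by (rule c_join[OF l r]) (simp add: ends)
  also have "c (path_rev g) = inv (c g)" by (rule c_rev[OF g])
  finally have "(c g \<otimes> c l) \<otimes> inv (c g) = \<one>"
    using g l triv by (simp add: m_assoc)
  then have "inv (inv (c g)) = c g \<otimes> c l"
    using g l by (intro inv_equality) auto
  then have "c g \<otimes> c l = c g" using g by simp
  then show ?thesis using l_cancel_one[of "c g" "c l"] g l by simp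
qed

end

lemma path_character_exists:
  fixes X :: "'a topology" and a :: 'a
  defines "G \<equiv> fundamental_group X a"
  assumes N: "N \<lhd> G"
    and a: "a \<in> topspace X"
    and conn: "\<And>x. x \<in> topspace X \<Longrightarrow> \<exists>d. pathin X d \<and> d 0 = a \<and> d 1 = x"
  obtains c where "path_character (G Mod N) X c"
    "\<And>p. p \<in> loops X a \<Longrightarrow> c p = \<one>\<^bsub>G Mod N\<^esub> \<longleftrightarrow> loop_class X a p \<in> N"
proof -
  interpret N: normal N G by (rule N)
  have "\<exists>d. pathin X d \<and> d 0 = a \<and> d 1 = x \<and> (x = a \<longrightarrow> d = (\<lambda>_. a))" if "x \<in> topspace X" for x
    using conn[OF that] a by (cases "x = a") auto
  then obtain d where d: "\<And>x. x \<in> topspace X \<Longrightarrow> pathin X (d x)" "\<And>x. x \<in> topspace X \<Longrightarrow> d x 0 = a"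
    "\<And>x. x \<in> topspace X \<Longrightarrow> d x 1 = x" "d a = (\<lambda>_. a)"
    using a by metis
  define l where "l p = loop_join (d (p 0)) (loop_join p (path_rev (d (p 1))))" for p
  note PJ = pathin_loop_join pathin_path_rev
  have st: "p 0 \<in> topspace X" "p 1 \<in> topspace X" if "pathin X p" for p
    using that path_start_in_topspace path_finish_in_topspace by blast+
  have l: "l p \<in> loops X a" if "pathin X p" for p
    using that st[OF that] d unfolding l_def loops_iff by (auto intro!: PJ)
  have l_join: "path_homotopic X (loop_join (l p) (l q)) (l (loop_join p q))"
    if p: "pathin X p" and q: "pathin X q" and pq: "p 1 = q 0" for p q
  proof -
    have dd: "pathin X (d (p 0))" "pathin X (d (q 0))" "pathin X (d (q 1))"
      "d (p 0) 1 = p 0" "d (q 0) 1 = q 0" "d (q 1) 1 = q 1"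
      "d (p 0) 0 = a" "d (q 0) 0 = a" "d (q 1) 0 = a"
      using d st p q by auto
    let ?e1 = "path_rev (d (q 0))" and ?e2 = "path_rev (d (q 1))"
    let ?x = "loop_join q ?e2"
    have x: "pathin X ?x" using q dd by (auto intro!: PJ)
    have e1: "pathin X ?e1" using dd by (auto intro!: PJ)
    have "path_homotopic X (loop_join ?e1 (loop_join (d (q 0)) ?x)) (loop_join (loop_join ?e1 (d (q 0))) ?x)"
      using x e1 dd by (intro path_homotopic_assoc) auto
    moreover have "path_homotopic X (loop_join (loop_join ?e1 (d (q 0))) ?x) (loop_join (\<lambda>_. q 0) ?x)"
      using x e1 dd path_homotopic_join_rev[OF dd(2)]
      by (intro path_homotopic_join path_homotopic_refl) auto
    moreover have "path_homotopic X (loop_join (\<lambda>_. q 0) ?x) ?x"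
      using path_homotopic_const_join[OF x] by simp
    ultimately have 1: "path_homotopic X (loop_join ?e1 (loop_join (d (q 0)) ?x)) ?x"
      using path_homotopic_trans by blast
    have 2: "path_homotopic X (loop_join (loop_join p ?e1) (loop_join (d (q 0)) ?x))
        (loop_join p (loop_join ?e1 (loop_join (d (q 0)) ?x)))"
      using x e1 dd p q pq by (intro path_homotopic_sym[OF path_homotopic_assoc] PJ) auto
    have 3: "path_homotopic X (loop_join p (loop_join ?e1 (loop_join (d (q 0)) ?x))) (loop_join p ?x)"
      by (rule path_homotopic_join[OF path_homotopic_refl[OF p] 1]) (use pq dd in simp)
    have 4: "path_homotopic X (loop_join p ?x) (loop_join (loop_join p q) ?e2)"
      using p q pq dd by (intro path_homotopic_assoc PJ) auto
    have 5: "path_homotopic X (loop_join (loop_join p ?e1) (loop_join (d (q 0)) ?x)) (loop_join (loop_join p q) ?e2)"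
      using 2 3 4 path_homotopic_trans by blast
    have "path_homotopic X (loop_join (l p) (l q))
        (loop_join (d (p 0)) (loop_join (loop_join p ?e1) (loop_join (d (q 0)) ?x)))"
      unfolding l_def pq using x e1 dd p q pq by (intro path_homotopic_sym[OF path_homotopic_assoc] PJ) auto
    moreover have "path_homotopic X (loop_join (d (p 0)) (loop_join (loop_join p ?e1) (loop_join (d (q 0)) ?x)))
       (l (loop_join p q))"
      unfolding l_def loop_join_simps
      by (rule path_homotopic_join[OF path_homotopic_refl[OF dd(1)] 5]) (use dd in simp)
    ultimately show ?thesis using path_homotopic_trans by blast
  qed
  define g where "g p = loop_class X a (l p)" for p
  have g: "g p \<in> carrier G" if "pathin X p" for p
    using l[OF that] by (auto simp: g_def G_def carrier_fundamental_group)
  have g_join: "g (loop_join p q) = g p \<otimes>\<^bsub>G\<^esub> g q"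
    if p: "pathin X p" and q: "pathin X q" and pq: "p 1 = q 0" for p q
    unfolding g_def G_def using l_join[OF p q pq] l p q pq
    by (simp add: mult_fundamental_group)
       (subst loop_class_eq_iff; auto intro: l loop_join_loops PJ path_homotopic_sym)
  have g_hom: "g p = g q" if pq: "path_homotopic X p q" for p q
  proof -
    note h = path_homotopic_imp[OF pq]
    have dd: "pathin X (d (p 0))" "pathin X (path_rev (d (p 1)))" "d (p 0) 1 = p 0" "d (p 1) 1 = p 1"
      using d st[OF h(1)] by (auto intro: PJ)
    have "path_homotopic X (loop_join p (path_rev (d (p 1)))) (loop_join q (path_rev (d (p 1))))"
      by (rule path_homotopic_join[OF pq path_homotopic_refl[OF dd(2)]]) (use dd in simp)
    then have "path_homotopic X (l p) (l q)"
      unfolding l_def h(3,4)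
      by (rule path_homotopic_join[OF path_homotopic_refl[OF dd(1)]]) (use dd in simp)
    then show ?thesis unfolding g_def
      using h by (subst loop_class_eq_iff) (auto intro: l)
  qed
  have g_loop: "g p = loop_class X a p" if p: "p \<in> loops X a" for p
  proof -
    have pp: "pathin X p" "p 0 = a" "p 1 = a" using p by (auto simp: loops_iff)
    have "path_homotopic X (loop_join p (\<lambda>_. a)) p"
      using path_homotopic_join_const[OF pp(1)] pp by simp
    moreover have "path_homotopic X (loop_join (\<lambda>_. a) (loop_join p (\<lambda>_. a))) (loop_join p (\<lambda>_. a))"
      using path_homotopic_const_join[of X "loop_join p (\<lambda>_. a)"] pp a by (simp add: pathin_loop_join)
    ultimately have "path_homotopic X (l p) p"
      unfolding l_def using pp d(4) path_homotopic_trans by (simp add: path_rev_def) blast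
    then show ?thesis unfolding g_def using l pp p by (subst loop_class_eq_iff) auto
  qed
  show thesis
  proof
    show "path_character (G Mod N) X (\<lambda>p. N #>\<^bsub>G\<^esub> g p)"
    proof (intro path_character.intro path_character_axioms.intro)
      show "group (G Mod N)" by (rule N.factorgroup_is_group)
      show "N #>\<^bsub>G\<^esub> g p \<in> carrier (G Mod N)" if "pathin X p" for p
        using g[OF that] by (auto simp: FactGroup_def RCOSETS_def)
      show "N #>\<^bsub>G\<^esub> g (loop_join p q) = (N #>\<^bsub>G\<^esub> g p) \<otimes>\<^bsub>G Mod N\<^esub> (N #>\<^bsub>G\<^esub> g q)"
        if "pathin X p" "pathin X q" "p 1 = q 0" for p q
        using that g by (simp add: g_join N.rcos_sum)
      show "N #>\<^bsub>G\<^esub> g p = N #>\<^bsub>G\<^esub> g q" if "path_homotopic X p q" for p q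
        using g_hom[OF that] by simp
    qed
    show "N #>\<^bsub>G\<^esub> g p = \<one>\<^bsub>G Mod N\<^esub> \<longleftrightarrow> loop_class X a p \<in> N" if p: "p \<in> loops X a" for p
    proof -
      have "g p \<in> carrier G" using g p by (auto simp: loops_iff)
      then show ?thesis
        using g_loop[OF p] N.coset_join1[OF _ _ N.subgroup_axioms] N.coset_join2[OF _ N.subgroup_axioms]
        by (auto simp: FactGroup_def)
    qed
  qed
qed

section \<open>The covering of the torus by the plane\<close>

definition gauss_lattice :: "complex set" where
  "gauss_lattice = {z. Re z \<in> \<int> \<and> Im z \<in> \<int>}"

definition cov :: "complex \<Rightarrow> complex \<times> complex" where
  "cov z = (cis (2 * pi * Re z), cis (2 * pi * Im z))"

lemma lattice_intros [simp]:
  "0 \<in> gauss_lattice" "z \<in> gauss_lattice \<Longrightarrow> w \<in> gauss_lattice \<Longrightarrow> z + w \<in> gauss_lattice"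
  "z \<in> gauss_lattice \<Longrightarrow> w \<in> gauss_lattice \<Longrightarrow> z - w \<in> gauss_lattice" "z \<in> gauss_lattice \<Longrightarrow> - z \<in> gauss_lattice"
  by (auto simp: gauss_lattice_def)

lemma lattice_diff_commute: "z - w \<in> gauss_lattice \<longleftrightarrow> w - z \<in> gauss_lattice"
  using lattice_intros(4)[of "z - w"] lattice_intros(4)[of "w - z"] by auto

lemma lattice_add_iff: "w \<in> gauss_lattice \<Longrightarrow> z + w \<in> gauss_lattice \<longleftrightarrow> z \<in> gauss_lattice"
  using lattice_intros(2)[of z w] lattice_intros(3)[of "z + w" w] by auto

lemma lattice_small:
  assumes "w \<in> gauss_lattice" "norm w < 1" shows "w = 0"
proof -
  have "\<bar>Re w\<bar> < 1" "\<bar>Im w\<bar> < 1"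
    using assms(2) abs_Re_le_cmod[of w] abs_Im_le_cmod[of w] by linarith+
  then show ?thesis
    using assms(1) by (auto simp: gauss_lattice_def complex_eq_iff Ints_def)
qed

lemma countable_gauss_lattice: "countable gauss_lattice"
proof -
  have "gauss_lattice \<subseteq> (\<lambda>(a, b). Complex (of_int a) (of_int b)) ` UNIV"
  proof
    fix z assume "z \<in> gauss_lattice"
    then obtain a b where "Re z = of_int a" "Im z = of_int b"
      unfolding gauss_lattice_def Ints_def by blast
    then have "z = (\<lambda>(a, b). Complex (of_int a) (of_int b)) (a, b)" by (simp add: complex_eq_iff)
    then show "z \<in> range (\<lambda>(a, b). Complex (of_int a) (of_int b))" by (rule range_eqI)
  qed
  then show ?thesis by (rule countable_subset) (intro countable_image countableI_type)
qed

lemma closed_gauss_lattice: "closed gauss_lattice"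
proof -
  have "gauss_lattice = Re -` \<int> \<inter> Im -` \<int>" by (auto simp: gauss_lattice_def)
  moreover have "closed (Re -` \<int> \<inter> Im -` \<int>)"
    by (intro closed_Int continuous_closed_vimage closed_Ints continuous_intros)
  ultimately show ?thesis by simp
qed

lemma lattice_separation:
  assumes "finite Z" "Z \<inter> gauss_lattice = {}"
  obtains \<eta> where "0 < \<eta>" "\<eta> \<le> 1" "\<And>z w. z \<in> Z \<Longrightarrow> w \<in> gauss_lattice \<Longrightarrow> \<eta> \<le> norm (z - w)"
proof (cases "Z = {}")
  case False
  have l: "gauss_lattice \<noteq> {}" using lattice_intros(1) by blast
  obtain d where "d > 0" "\<And>z w. z \<in> Z \<Longrightarrow> w \<in> gauss_lattice \<Longrightarrow> d \<le> dist z w"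
    using separate_compact_closed[OF finite_imp_compact[OF assms(1)] closed_gauss_lattice assms(2)] by blast
  then show ?thesis
    by (intro that[of "min d 1"]) (auto simp: dist_norm intro: order.trans[OF min.cobounded1])
qed (auto intro: that[of 1])

lemma cov_eq_iff: "cov z = cov w \<longleftrightarrow> z - w \<in> gauss_lattice"
proof -
  have *: "cis (2 * pi * a) = cis (2 * pi * b) \<longleftrightarrow> a - b \<in> \<int>" for a b :: real
  proof -
    have "cis (2 * pi * a) = cis (2 * pi * b) \<longleftrightarrow> (\<exists>n::int. 2 * pi * a = 2 * pi * b + 2 * pi * n)"
      using sin_cos_eq_iff[of "2 * pi * a" "2 * pi * b"] by (auto simp: complex_eq_iff)
    also have "\<dots> \<longleftrightarrow> (\<exists>n::int. 2 * pi * a = 2 * pi * (b + n))"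
      by (simp add: ring_distribs)
    also have "\<dots> \<longleftrightarrow> (\<exists>n::int. a = b + n)"
      by simp
    also have "\<dots> \<longleftrightarrow> a - b \<in> \<int>"
      by (auto simp: Ints_def algebra_simps)
    finally show ?thesis .
  qed
  show ?thesis by (auto simp: cov_def gauss_lattice_def *)
qed

lemma torus_eq: "torus = top_of_set (sphere 0 1 \<times> sphere 0 1)"
  by (simp add: torus_def)

lemma cov_in_torus [simp]: "cov z \<in> topspace torus"
  by (simp add: torus_eq cov_def)

lemma continuous_cov: "continuous_map euclidean torus cov"
  by (auto simp: torus_eq continuous_map_in_subtopology cov_def intro!: continuous_intros)

lemma cov_surj:
  assumes "x \<in> topspace torus" obtains z where "cov z = x"
proof
  have "fst x \<noteq> 0" "snd x \<noteq> 0" "norm (fst x) = 1" "norm (snd x) = 1"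
    using assms by (auto simp: torus_eq)
  then show "cov (Complex (Arg (fst x) / (2 * pi)) (Arg (snd x) / (2 * pi))) = x"
    by (auto simp: cov_def cis_Arg sgn_eq prod_eq_iff)
qed

lemma open_cov:
  assumes "open U" shows "openin torus (cov ` U)"
proof (subst openin_subopen, intro ballI)
  fix x assume "x \<in> cov ` U"
  then obtain z where z: "z \<in> U" and x: "x = cov z" by auto
  define \<phi> where "\<phi> y = Complex (Re z + Arg (fst y * cnj (cis (2 * pi * Re z))) / (2 * pi))
      (Im z + Arg (snd y * cnj (cis (2 * pi * Im z))) / (2 * pi))" for y
  have cz: "cis t * cnj (cis t) = 1" for t
    by (simp add: cis_cnj cis_mult)
  have one: "fst x * cnj (cis (2 * pi * Re z)) = 1" "snd x * cnj (cis (2 * pi * Im z)) = 1"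
    by (simp_all only: x cov_def fst_conv snd_conv cz)
  have \<phi>x: "\<phi> x = z" unfolding \<phi>_def one Arg_1 by simp
  have "isCont (\<lambda>y. Arg (fst y * cnj (cis (2 * pi * Re z)))) x"
    by (rule isCont_o2[where g = Arg], intro continuous_intros) (simp only: one, rule continuous_at_Arg, simp)
  moreover have "isCont (\<lambda>y. Arg (snd y * cnj (cis (2 * pi * Im z)))) x"
    by (rule isCont_o2[where g = Arg], intro continuous_intros) (simp only: one, rule continuous_at_Arg, simp)
  ultimately have "isCont \<phi> x"
    unfolding \<phi>_def Complex_eq by (intro continuous_intros) auto
  then obtain W where W: "open W" "x \<in> W" "\<And>y. y \<in> W \<Longrightarrow> \<phi> y \<in> U"
    using \<open>open U\<close> z \<phi>x unfolding continuous_at_open by metis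
  have cov_\<phi>: "cov (\<phi> y) = y" if "y \<in> topspace torus" for y
  proof -
    have *: "cis (2 * pi * (a + Arg (u * cnj (cis (2 * pi * a))) / (2 * pi))) = u" if "norm u = 1" for u a
    proof -
      have n: "norm (u * cnj (cis (2 * pi * a))) = 1" using that by (simp add: norm_mult)
      have "cis (2 * pi * (a + Arg (u * cnj (cis (2 * pi * a))) / (2 * pi)))
          = cis (2 * pi * a) * cis (Arg (u * cnj (cis (2 * pi * a))))"
        by (simp add: ring_distribs cis_mult)
      also have "cis (Arg (u * cnj (cis (2 * pi * a)))) = u * cnj (cis (2 * pi * a))"
        using n by (subst cis_Arg) (auto simp: sgn_eq)
      also have "cis (2 * pi * a) * \<dots> = u * (cis (2 * pi * a) * cnj (cis (2 * pi * a)))"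
        by (simp add: mult_ac)
      finally show ?thesis by (simp add: cz)
    qed
    show ?thesis using that by (auto simp: torus_eq cov_def \<phi>_def *)
  qed
  show "\<exists>T. openin torus T \<and> x \<in> T \<and> T \<subseteq> cov ` U"
  proof (intro exI conjI)
    show "openin torus (topspace torus \<inter> W)" unfolding torus_eq using W(1) by (simp add: openin_open_Int)
    show "x \<in> topspace torus \<inter> W" using W by (simp add: x)
    show "topspace torus \<inter> W \<subseteq> cov ` U" using W(3) cov_\<phi> by (metis IntD1 IntD2 image_eqI subsetI)
  qed
qed

lemma lift_unique:
  assumes "continuous_on {0..1} f" "continuous_on {0..1} g"
    and "\<And>t. t \<in> {0..1} \<Longrightarrow> cov (f t) = cov (g t)" and t: "t \<in> {0..1::real}"
  shows "f t - f 0 = g t - g 0"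
proof -
  have l: "f t - g t \<in> gauss_lattice" if "t \<in> {0..1}" for t
    using assms(3)[OF that] by (simp add: cov_eq_iff)
  have "(\<lambda>t. f t - g t) constant_on {0..1}"
  proof (rule continuous_discrete_range_constant)
    show "continuous_on {0..1} (\<lambda>t. f t - g t)" by (intro continuous_intros assms)
    show "\<exists>e>0. \<forall>y. y \<in> {0..1} \<and> f y - g y \<noteq> f x - g x \<longrightarrow> e \<le> norm (f y - g y - (f x - g x))"
      if x: "x \<in> {0..1}" for x
    proof (intro exI[of _ 1] conjI allI impI)
      fix y assume y: "y \<in> {0..1} \<and> f y - g y \<noteq> f x - g x"
      show "1 \<le> norm (f y - g y - (f x - g x))"
        using lattice_small[OF lattice_intros(3)[OF l[of y] l[of x]]] y x by force
    qed simp
  qed auto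
  then have "f t - g t = f 0 - g 0" using t unfolding constant_on_def by fastforce
  then show ?thesis by (simp add: algebra_simps)
qed

lemma cov_0: "cov 0 = \<one>\<^bsub>torus_group\<^esub>"
  by (simp add: cov_def torus_group_def circle_group_def DirProd_def)

lemma cov_add: "cov (z + w) = cov z \<otimes>\<^bsub>torus_group\<^esub> cov w"
  by (simp add: cov_def torus_group_def circle_group_def DirProd_def ring_distribs cis_mult)

lemma finprod_cov:
  assumes "inj_on (\<lambda>i. cov (y i)) I"
  shows "finprod torus_group (\<lambda>x. x) ((\<lambda>i. cov (y i)) ` I) = cov (\<Sum>i\<in>I. y i)"
proof -
  interpret comm_group torus_group by (rule comm_group_torus_group)
  have c: "cov z \<in> carrier torus_group" for z
    using cov_in_torus topspace_torus by metis
  have "finprod torus_group (\<lambda>x. x) ((\<lambda>i. cov (y i)) ` I) = finprod torus_group (\<lambda>i. cov (y i)) I"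
    using assms by (intro finprod_reindex) (auto simp: c)
  also have "\<dots> = cov (\<Sum>i\<in>I. y i)"
    by (induction I rule: infinite_finite_induct) (auto simp: c cov_0 cov_add)
  finally show ?thesis .
qed

section \<open>Configurations of the torus and their lifts\<close>

definition cfg :: "nat \<Rightarrow> (nat \<Rightarrow> complex) \<Rightarrow> (complex \<times> complex) set" where
  "cfg n y = (\<lambda>i. cov (y i)) ` {1..n}"

definition free :: "nat \<Rightarrow> (nat \<Rightarrow> complex) \<Rightarrow> bool" where
  "free n y \<longleftrightarrow> (\<forall>i\<in>{1..n}. \<forall>j\<in>{1..n}. i \<noteq> j \<longrightarrow> y i - y j \<notin> gauss_lattice)"

lemma freeD: "free n y \<Longrightarrow> i \<in> {1..n} \<Longrightarrow> j \<in> {1..n} \<Longrightarrow> i \<noteq> j \<Longrightarrow> y i - y j \<notin> gauss_lattice"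
  by (simp add: free_def)

lemma free_iff_inj: "free n y \<longleftrightarrow> inj_on (\<lambda>i. cov (y i)) {1..n}"
  unfolding free_def inj_on_def cov_eq_iff by blast

lemma free_iff_card: "free n y \<longleftrightarrow> card (cfg n y) = n"
  unfolding free_iff_inj cfg_def using inj_on_iff_eq_card[of "{1..n}" "\<lambda>i. cov (y i)"] by simp

lemma cfg_cong: "(\<And>i. i \<in> {1..n} \<Longrightarrow> y i - z i \<in> gauss_lattice) \<Longrightarrow> cfg n y = cfg n z"
  unfolding cfg_def by (intro image_cong refl) (simp add: cov_eq_iff)

lemma cfg_permute:
  assumes "\<sigma> ` {1..n} = {1..n}" "\<And>i. i \<in> {1..n} \<Longrightarrow> y i - z (\<sigma> i) \<in> gauss_lattice"
  shows "cfg n y = cfg n z"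
proof -
  have "cfg n y = (\<lambda>i. cov (z (\<sigma> i))) ` {1..n}"
    unfolding cfg_def using assms(2) by (intro image_cong refl) (simp add: cov_eq_iff)
  also have "\<dots> = (\<lambda>i. cov (z i)) ` \<sigma> ` {1..n}" by (simp add: image_image)
  finally show ?thesis unfolding assms(1) cfg_def .
qed

lemma cfg_eq_obtain:
  assumes "cfg n y = cfg n z" "free n y"
  obtains \<sigma> where "bij_betw \<sigma> {1..n} {1..n}" "\<And>i. i \<in> {1..n} \<Longrightarrow> y i - z (\<sigma> i) \<in> gauss_lattice"
proof -
  have "\<exists>j\<in>{1..n}. cov (y i) = cov (z j)" if "i \<in> {1..n}" for i
    using assms(1) that unfolding cfg_def by (metis (no_types, lifting) image_iff)
  then obtain \<sigma> where \<sigma>: "\<And>i. i \<in> {1..n} \<Longrightarrow> \<sigma> i \<in> {1..n} \<and> cov (y i) = cov (z (\<sigma> i))"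
    by metis
  have "inj_on \<sigma> {1..n}"
    using assms(2) \<sigma> unfolding free_iff_inj inj_on_def by metis
  then have "bij_betw \<sigma> {1..n} {1..n}"
    using \<sigma> by (intro bij_betw_imageI endo_inj_surj) auto
  then show ?thesis using that \<sigma> cov_eq_iff by blast
qed

lemma cfg_in_conf: "free n y \<Longrightarrow> cfg n y \<in> topspace (conf n torus)"
  unfolding topspace_conf by (auto simp: free_iff_card) (auto simp: cfg_def)

lemma conf_obtain_lift:
  assumes "A \<in> topspace (conf n torus)"
  obtains y where "cfg n y = A" "free n y"
proof -
  have A: "A \<subseteq> topspace torus" "finite A" "card A = n" using assms by (auto simp: topspace_conf)
  then obtain h where h: "bij_betw h {1..n} A"
    using ex_bij_betw_nat_finite_1[of A] by auto
  have "\<exists>z. cov z = h i" if "i \<in> {1..n}" for i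
    using cov_surj[of "h i"] h that A(1) by (metis bij_betwE subsetD)
  then obtain y where "\<And>i. i \<in> {1..n} \<Longrightarrow> cov (y i) = h i" by metis
  then have "cfg n y = A" using h by (auto simp: cfg_def bij_betw_def image_def)
  then show ?thesis using that A(3) free_iff_card by blast
qed

lemma continuous_map_conf:
  assumes "\<And>i. i \<in> {1..n} \<Longrightarrow> continuous_map X Y (\<lambda>x. f x i)"
    and "\<And>x. x \<in> topspace X \<Longrightarrow> inj_on (f x) {1..n}"
  shows "continuous_map X (conf n Y) (\<lambda>x. f x ` {1..n})"
proof -
  have "continuous_map X (ordered_conf n Y) (\<lambda>x. restrict (f x) {1..n})"
    unfolding ordered_conf_def using assms
    by (auto simp: continuous_map_in_subtopology continuous_map_componentwise)
  moreover have "continuous_map (ordered_conf n Y) (conf n Y) (\<lambda>x. x ` {1..n})"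
    unfolding conf_def by (rule quotient_imp_continuous_map[OF quotient_map_quotient_topology])
  ultimately have "continuous_map X (conf n Y) ((\<lambda>x. x ` {1..n}) \<circ> (\<lambda>x. restrict (f x) {1..n}))"
    by (rule continuous_map_compose)
  then show ?thesis by (simp add: o_def)
qed

lemma continuous_map_cfg:
  assumes "\<And>i. i \<in> {1..n} \<Longrightarrow> continuous_on S (\<lambda>x. f x i)"
    and "\<And>x. x \<in> S \<Longrightarrow> free n (f x)"
  shows "continuous_map (top_of_set S) (conf n torus) (\<lambda>x. cfg n (f x))"
proof -
  have "continuous_map (top_of_set S) torus (\<lambda>x. cov (f x i))" if "i \<in> {1..n}" for i
    using continuous_map_compose[OF _ continuous_cov, of "top_of_set S" "\<lambda>x. f x i"] assms(1)[OF that]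
    by (simp add: o_def)
  then show ?thesis
    unfolding cfg_def using assms(2) by (intro continuous_map_conf) (auto simp: free_iff_inj)
qed

lemma continuous_map_conf_subtopology:
  "continuous_map (conf n (subtopology Y D)) (conf n Y) (\<lambda>A. A)"
proof -
  have "continuous_map (ordered_conf n (subtopology Y D)) (conf n Y) (\<lambda>x. x ` {1..n})"
  proof (rule continuous_map_conf)
    fix i assume "i \<in> {1..n}"
    then have "continuous_map (product_topology (\<lambda>_. subtopology Y D) {1..n}) (subtopology Y D) (\<lambda>x. x i)"
      by (rule continuous_map_product_projection)
    then show "continuous_map (ordered_conf n (subtopology Y D)) Y (\<lambda>x. x i)"
      unfolding ordered_conf_def using continuous_map_from_subtopology continuous_map_into_fulltopology by blast
  qed (auto simp: ordered_conf_def)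
  then have "continuous_map (ordered_conf n (subtopology Y D)) (conf n Y) ((\<lambda>A. A) \<circ> (\<lambda>x. x ` {1..n}))"
    by (simp add: o_def)
  then show ?thesis
    unfolding conf_def[of n "subtopology Y D"]
    by (rule continuous_compose_quotient_map[OF quotient_map_quotient_topology])
qed

lemma openin_conf_meets:
  assumes "openin Y W"
  shows "openin (conf n Y) {A \<in> topspace (conf n Y). A \<inter> W \<noteq> {}}"
proof -
  let ?O = "ordered_conf n Y"
  let ?U = "{A \<in> topspace (conf n Y). A \<inter> W \<noteq> {}}"
  have proj: "continuous_map ?O Y (\<lambda>x. x i)" if "i \<in> {1..n}" for i
    unfolding ordered_conf_def
    by (rule continuous_map_from_subtopology[OF continuous_map_product_projection[OF that]])
  then have "openin ?O (\<Union>i\<in>{1..n}. {x \<in> topspace ?O. x i \<in> W})"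
    by (intro openin_Union ballI) (use openin_continuous_map_preimage[OF proj assms] in blast)
  also have "(\<Union>i\<in>{1..n}. {x \<in> topspace ?O. x i \<in> W}) = {x \<in> topspace ?O. x ` {1..n} \<in> ?U}"
    by (auto simp: conf_def topspace_quotient_topology)
  finally show ?thesis
    unfolding conf_def openin_quotient_topology by (auto simp: topspace_quotient_topology)
qed

lemma openin_path_meets:
  assumes "pathin (conf n Y) q" "openin Y W"
  shows "openin (top_of_set {0..1}) {t \<in> {0..1}. q t \<inter> W \<noteq> {}}"
proof -
  have "q t \<in> topspace (conf n Y)" if "t \<in> {0..1}" for t
    using assms(1) that unfolding pathin_def by (auto simp: continuous_map_def)
  then have "{t \<in> {0..1}. q t \<inter> W \<noteq> {}} = {t \<in> topspace (top_of_set {0..1}). q t \<in> {A \<in> topspace (conf n Y). A \<inter> W \<noteq> {}}}"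
    by auto
  then show ?thesis
    using openin_continuous_map_preimage[OF assms(1)[unfolded pathin_def] openin_conf_meets[OF assms(2)]]
    by simp
qed

lemma free_separation:
  assumes "free n y"
  obtains \<eta> where "0 < \<eta>" "\<eta> \<le> 1"
    "\<And>i j w. i \<in> {1..n} \<Longrightarrow> j \<in> {1..n} \<Longrightarrow> i \<noteq> j \<Longrightarrow> w \<in> gauss_lattice \<Longrightarrow> \<eta> \<le> norm (y i - y j - w)"
proof -
  let ?Z = "(\<lambda>(i, j). y i - y j) ` {(i, j) \<in> {1..n} \<times> {1..n}. i \<noteq> j}"
  have "finite {(i, j) \<in> {1..n} \<times> {1..n}. i \<noteq> j}"
    by (rule finite_subset[of _ "{1..n} \<times> {1..n}"]) auto
  then have "finite ?Z" by (rule finite_imageI)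
  moreover have "?Z \<inter> gauss_lattice = {}" using assms by (auto simp: free_def)
  ultimately obtain \<eta> where \<eta>: "0 < \<eta>" "\<eta> \<le> 1" "\<And>z w. z \<in> ?Z \<Longrightarrow> w \<in> gauss_lattice \<Longrightarrow> \<eta> \<le> norm (z - w)"
    by (rule lattice_separation) blast
  show ?thesis by (rule that[OF \<eta>(1,2)], rule \<eta>(3)) auto
qed

lemma local_lift:
  assumes q: "pathin (conf n torus) q" and t0: "t0 \<in> {0..1}"
  obtains U p where "openin (top_of_set {0..1}) U" "t0 \<in> U" "\<And>t. t \<in> U \<Longrightarrow> cfg n (p t) = q t"
    "\<And>i. i \<in> {1..n} \<Longrightarrow> continuous_on U (\<lambda>t. p t i)"
proof -
  have qt: "q t \<in> topspace (conf n torus)" if "t \<in> {0..1}" for t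
    using q that unfolding pathin_def by (auto simp: continuous_map_def)
  obtain y where y: "cfg n y = q t0" "free n y" using conf_obtain_lift[OF qt[OF t0]] .
  obtain \<eta> where \<eta>: "0 < \<eta>" "\<eta> \<le> 1"
    "\<And>i j w. i \<in> {1..n} \<Longrightarrow> j \<in> {1..n} \<Longrightarrow> i \<noteq> j \<Longrightarrow> w \<in> gauss_lattice \<Longrightarrow> \<eta> \<le> norm (y i - y j - w)"
    by (rule free_separation[OF y(2)]) blast
  define r where "r = \<eta> / 2"
  have r: "r > 0" using \<eta> by (simp add: r_def)
  have sep: "i = j \<and> z = z'"
    if "i \<in> {1..n}" "j \<in> {1..n}" "z \<in> ball (y i) r" "z' \<in> ball (y j) r" "cov z = cov z'" for i j z z'
  proof -
    have l: "z - z' \<in> gauss_lattice" using that(5) by (simp add: cov_eq_iff)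
    have "norm (y i - z) < r" "norm (z' - y j) < r"
      using that(3,4) by (auto simp: dist_norm norm_minus_commute)
    then have small: "norm (y i - y j - (z - z')) < \<eta>"
      using norm_triangle_ineq[of "y i - z" "z' - y j"] by (simp add: r_def algebra_simps)
    then have "i = j" using \<eta>(3)[OF that(1,2) _ l] by force
    then have "norm (z - z') < 1" using small \<eta>(2) by (simp add: norm_minus_commute)
    then show ?thesis using lattice_small[OF l] \<open>i = j\<close> by simp
  qed
  define U where "U = {t \<in> {0..1}. \<forall>i\<in>{1..n}. q t \<inter> cov ` ball (y i) r \<noteq> {}}"
  define p where "p t i = (SOME z. z \<in> ball (y i) r \<and> cov z \<in> q t)" for t i
  have p: "p t i \<in> ball (y i) r \<and> cov (p t i) \<in> q t" if "t \<in> U" "i \<in> {1..n}" for t i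
  proof -
    have "\<exists>z. z \<in> ball (y i) r \<and> cov z \<in> q t" using that unfolding U_def by blast
    then show ?thesis unfolding p_def by (rule someI_ex)
  qed
  have cfgp: "cfg n (p t) = q t" if t: "t \<in> U" for t
  proof -
    have "inj_on (\<lambda>i. cov (p t i)) {1..n}"
      using p[OF t] sep by (meson inj_onI)
    then have "card (cfg n (p t)) = n" using free_iff_card free_iff_inj by blast
    moreover have "cfg n (p t) \<subseteq> q t" using p[OF t] by (auto simp: cfg_def)
    moreover have "finite (q t)" "card (q t) = n"
      using qt[of t] t by (auto simp: U_def topspace_conf)
    ultimately show ?thesis by (metis card_subset_eq)
  qed
  have unique: "p t i = z" if "t \<in> U" "i \<in> {1..n}" "z \<in> ball (y i) r" "cov z \<in> q t" for t i z
  proof -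
    have "cov z \<in> cfg n (p t)" using that(1,4) cfgp by simp
    then obtain j where "j \<in> {1..n}" "cov z = cov (p t j)" by (auto simp: cfg_def)
    then show ?thesis using sep[of i j z "p t j"] that p by metis
  qed
  have "openin (top_of_set {0..1}) U"
  proof (cases "n = 0")
    case False
    have "openin (top_of_set {0..1}) (\<Inter>i\<in>{1..n}. {t \<in> {0..1}. q t \<inter> cov ` ball (y i) r \<noteq> {}})"
      using False by (intro openin_INT2 openin_path_meets[OF q open_cov]) auto
    also have "(\<Inter>i\<in>{1..n}. {t \<in> {0..1}. q t \<inter> cov ` ball (y i) r \<noteq> {}}) = U"
    proof
      show "(\<Inter>i\<in>{1..n}. {t \<in> {0..1}. q t \<inter> cov ` ball (y i) r \<noteq> {}}) \<subseteq> U"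
        using False by (auto simp: U_def) force+
    qed (auto simp: U_def)
    finally show ?thesis .
  next
    case True
    then have "U = {0..1}" by (auto simp: U_def)
    then show ?thesis by simp
  qed
  then have openU: "openin (top_of_set {0..1}) U" .
  have "cov (y i) \<in> q t0 \<inter> cov ` ball (y i) r" if "i \<in> {1..n}" for i
    using that r by (auto simp: cfg_def simp flip: y(1))
  then have "t0 \<in> U"
    using t0 unfolding U_def by blast
  moreover have "continuous_on U (\<lambda>t. p t i)" if i: "i \<in> {1..n}" for i
    unfolding continuous_on_topological
  proof (intro ballI allI impI)
    fix t B assume t: "t \<in> U" and B: "open B" "p t i \<in> B"
    let ?B = "B \<inter> ball (y i) r"
    have "openin (top_of_set {0..1}) {s \<in> {0..1}. q s \<inter> cov ` ?B \<noteq> {}}"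
      using B by (intro openin_path_meets[OF q open_cov]) auto
    then obtain A where A: "open A" "{s \<in> {0..1}. q s \<inter> cov ` ?B \<noteq> {}} = {0..1} \<inter> A"
      by (auto simp: openin_open)
    have "t \<in> {s \<in> {0..1}. q s \<inter> cov ` ?B \<noteq> {}}"
      using t p[OF t i] B by (auto simp: U_def)
    then have "t \<in> A" using A(2) by blast
    moreover have "p s i \<in> B" if s: "s \<in> U" "s \<in> A" for s
    proof -
      have "s \<in> {s \<in> {0..1}. q s \<inter> cov ` ?B \<noteq> {}}" unfolding A(2) using s by (auto simp: U_def)
      then obtain z where "z \<in> ?B" "cov z \<in> q s" by blast
      then show ?thesis using unique[OF s(1) i, of z] by simp
    qed
    ultimately show "\<exists>A. open A \<and> t \<in> A \<and> (\<forall>y\<in>U. y \<in> A \<longrightarrow> p y i \<in> B)"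
      using A(1) by blast
  qed
  ultimately show ?thesis using that openU cfgp by blast
qed

lemma path_lift:
  assumes q: "pathin (conf n torus) q" and y: "cfg n y = q 0"
  obtains p where "\<And>i. i \<in> {1..n} \<Longrightarrow> continuous_on {0..1} (\<lambda>t. p t i)"
    "\<And>t. t \<in> {0..1} \<Longrightarrow> cfg n (p t) = q t" "\<And>i. i \<in> {1..n} \<Longrightarrow> p 0 i = y i"
proof -
  have qt: "q t \<in> topspace (conf n torus)" if "t \<in> {0..1}" for t
    using q that unfolding pathin_def by (auto simp: continuous_map_def)
  define L where "L a b \<longleftrightarrow> (0 \<le> a \<and> a \<le> b \<and> b \<le> 1 \<longrightarrow> (\<forall>y. cfg n y = q a \<longrightarrow>
      (\<exists>p. (\<forall>i\<in>{1..n}. p a i = y i \<and> continuous_on {a..b} (\<lambda>t. p t i)) \<and>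
           (\<forall>t\<in>{a..b}. cfg n (p t) = q t))))" for a b :: real
  have "L 0 1"
  proof (rule Bolzano[where P = L])
    fix a b c :: real assume L: "L a b" "L b c" and abc: "a \<le> b" "b \<le> c"
    show "L a c" unfolding L_def
    proof (intro impI allI)
      fix y assume ac: "0 \<le> a \<and> a \<le> c \<and> c \<le> 1" and y: "cfg n y = q a"
      have ab: "0 \<le> a \<and> a \<le> b \<and> b \<le> 1" and bc: "0 \<le> b \<and> b \<le> c \<and> c \<le> 1"
        using abc ac by auto
      obtain p1 where p1: "\<And>i. i \<in> {1..n} \<Longrightarrow> p1 a i = y i"
        "\<And>i. i \<in> {1..n} \<Longrightarrow> continuous_on {a..b} (\<lambda>t. p1 t i)" "\<And>t. t\<in>{a..b} \<Longrightarrow> cfg n (p1 t) = q t"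
        using L(1)[unfolded L_def, THEN mp, THEN spec, THEN mp, OF ab y] by blast
      then have pb: "cfg n (p1 b) = q b" using abc by auto
      obtain p2 where p2: "\<And>i. i \<in> {1..n} \<Longrightarrow> p2 b i = p1 b i"
        "\<And>i. i \<in> {1..n} \<Longrightarrow> continuous_on {b..c} (\<lambda>t. p2 t i)" "\<And>t. t\<in>{b..c} \<Longrightarrow> cfg n (p2 t) = q t"
        using L(2)[unfolded L_def, THEN mp, THEN spec, THEN mp, OF bc pb] by blast
      define p where "p t = (if t \<le> b then p1 t else p2 t)" for t
      have "continuous_on {a..c} (\<lambda>t. p t i)" if i: "i \<in> {1..n}" for i
      proof -
        have "continuous_on ({a..b} \<union> {b..c}) (\<lambda>t. if t \<le> b then p1 t i else p2 t i)"
          using p1(2)[OF i] p2(2)[OF i] p2(1)[OF i] abc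
          by (intro continuous_on_cases) auto
        moreover have "{a..b} \<union> {b..c} = {a..c}" using abc by auto
        moreover have "(\<lambda>t. p t i) = (\<lambda>t. if t \<le> b then p1 t i else p2 t i)"
          by (auto simp: p_def)
        ultimately show ?thesis by (simp only:)
      qed
      then show "\<exists>p. (\<forall>i\<in>{1..n}. p a i = y i \<and> continuous_on {a..c} (\<lambda>t. p t i)) \<and>
           (\<forall>t\<in>{a..c}. cfg n (p t) = q t)"
        using p1 p2 abc by (intro exI[of _ p]) (auto simp: p_def)
    qed
  next
    fix x :: real assume x: "0 \<le> x" "x \<le> 1"
    obtain U p where U: "openin (top_of_set {0..1}) U" "x \<in> U" "\<And>t. t \<in> U \<Longrightarrow> cfg n (p t) = q t"
      "\<And>i. i \<in> {1..n} \<Longrightarrow> continuous_on U (\<lambda>t. p t i)"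
      using local_lift[OF q, of x] x by auto
    then obtain d where d: "d > 0" "\<And>t. t \<in> {0..1} \<Longrightarrow> dist t x < d \<Longrightarrow> t \<in> U"
      unfolding openin_euclidean_subtopology_iff by meson
    have "L a b" if ab: "a \<le> x" "x \<le> b" "b - a < d" for a b
      unfolding L_def
    proof (intro impI allI)
      fix y assume ac: "0 \<le> a \<and> a \<le> b \<and> b \<le> 1" and y: "cfg n y = q a"
      have sub: "{a..b} \<subseteq> U"
      proof
        fix t assume "t \<in> {a..b}"
        then show "t \<in> U" using ab ac by (intro d(2)) (auto simp: dist_real_def)
      qed
      have aU: "a \<in> U" using sub ac by auto
      have fy: "free n y"
        using qt[of a] ac y by (simp add: free_iff_card topspace_conf)
      have "cfg n y = cfg n (p a)" using U(3)[OF aU] y by simp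
      then obtain \<sigma> where \<sigma>: "bij_betw \<sigma> {1..n} {1..n}" "\<And>i. i \<in> {1..n} \<Longrightarrow> y i - p a (\<sigma> i) \<in> gauss_lattice"
        using cfg_eq_obtain fy by blast
      define p' where "p' t i = p t (\<sigma> i) + (y i - p a (\<sigma> i))" for t i
      have "cfg n (p' t) = q t" if "t \<in> {a..b}" for t
      proof -
        have "cfg n (p' t) = cfg n (p t)"
          using \<sigma> by (intro cfg_permute[of \<sigma>]) (auto simp: p'_def bij_betw_def)
        then show ?thesis using U(3) sub that by auto
      qed
      moreover have "continuous_on {a..b} (\<lambda>t. p' t i)" if "i \<in> {1..n}" for i
      proof -
        have "\<sigma> i \<in> {1..n}" using \<sigma>(1) that bij_betwE by blast
        then show ?thesis
          unfolding p'_def using sub by (intro continuous_intros continuous_on_subset[OF U(4)])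
      qed
      ultimately show "\<exists>p. (\<forall>i\<in>{1..n}. p a i = y i \<and> continuous_on {a..b} (\<lambda>t. p t i)) \<and>
           (\<forall>t\<in>{a..b}. cfg n (p t) = q t)"
        by (intro exI[of _ p']) (auto simp: p'_def)
    qed
    then show "\<exists>d>0. \<forall>a b. a \<le> x \<and> x \<le> b \<and> b - a < d \<longrightarrow> L a b"
      using d(1) by blast
  qed simp
  from this[unfolded L_def, THEN mp, THEN spec, THEN mp, OF _ y]
  have "\<exists>p. (\<forall>i\<in>{1..n}. p 0 i = y i \<and> continuous_on {0..1} (\<lambda>t. p t i)) \<and> (\<forall>t\<in>{0..1}. cfg n (p t) = q t)"
    by simp
  then show ?thesis using that by blast
qed

lemma continuous_map_conf_section:
  assumes q: "pathin (conf n torus) q" and sub: "\<And>t. t \<in> {0..1} \<Longrightarrow> q t \<subseteq> D"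
    and h: "continuous_map (subtopology torus D) euclidean h"
  shows "continuous_on {0..1} (\<lambda>t. \<Sum>x\<in>q t. (h x :: complex))"
proof -
  have "q 0 \<in> topspace (conf n torus)"
    using q path_start_in_topspace by blast
  then obtain y where "cfg n y = q 0" by (rule conf_obtain_lift)
  then obtain p where p: "\<And>i. i \<in> {1..n} \<Longrightarrow> continuous_on {0..1} (\<lambda>t. p t i)"
    "\<And>t. t \<in> {0..1} \<Longrightarrow> cfg n (p t) = q t"
    using path_lift[OF q] by metis
  have free: "free n (p t)" if "t \<in> {0..1}" for t
  proof -
    have "q t \<in> topspace (conf n torus)"
      using q that unfolding pathin_def by (auto simp: continuous_map_def)
    then show ?thesis using p(2)[OF that] by (simp add: free_iff_card topspace_conf)
  qed
  have "continuous_on {0..1} (\<lambda>t. h (cov (p t i)))" if i: "i \<in> {1..n}" for i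
  proof -
    have "cov (p t i) \<in> D" if "t \<in> {0..1}" for t
      using sub[OF that] i unfolding p(2)[OF that, symmetric] cfg_def by blast
    then have "continuous_map (top_of_set {0..1}) (subtopology torus D) (\<lambda>t. cov (p t i))"
      using continuous_map_compose[OF _ continuous_cov, of "top_of_set {0..1}" "\<lambda>t. p t i"] p(1)[OF i]
      by (auto simp: continuous_map_in_subtopology o_def)
    from continuous_map_compose[OF this h] show ?thesis by (simp add: o_def)
  qed
  then have "continuous_on {0..1} (\<lambda>t. \<Sum>i\<in>{1..n}. h (cov (p t i)))"
    by (intro continuous_on_sum)
  then show ?thesis
  proof (rule continuous_on_eq)
    fix t :: real assume t: "t \<in> {0..1}"
    have "(\<Sum>x\<in>q t. h x) = (\<Sum>i\<in>{1..n}. h (cov (p t i)))"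
      unfolding p(2)[OF t, symmetric] cfg_def
      using free[OF t] by (subst sum.reindex) (auto simp: free_iff_inj o_def)
    then show "(\<Sum>i\<in>{1..n}. h (cov (p t i))) = (\<Sum>x\<in>q t. h x)" by simp
  qed
qed

section \<open>General position\<close>

lemma avoid_lines:
  fixes L :: "(complex \<times> complex) set"
  assumes L: "countable L" "\<And>p d. (p, d) \<in> L \<Longrightarrow> d \<noteq> 0" and U: "open U" "U \<noteq> {}"
  obtains x where "x \<in> U" "\<And>p d s. (p, d) \<in> L \<Longrightarrow> x \<noteq> p + s *\<^sub>R d"
proof -
  define H where "H = (\<lambda>(p, d). {x. (\<i> * d) \<bullet> x = (\<i> * d) \<bullet> p})"
  have "negligible (\<Union>(H ` L))"
  proof (rule negligible_countable_Union)
    fix S assume "S \<in> H ` L"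
    then show "negligible S"
      using L(2) by (auto simp: H_def intro!: negligible_hyperplane)
  qed (use L in simp)
  then have "\<not> U \<subseteq> \<Union>(H ` L)"
    using U open_not_negligible negligible_subset by blast
  then obtain x where x: "x \<in> U" "x \<notin> \<Union>(H ` L)" by blast
  have "x \<noteq> p + s *\<^sub>R d" if "(p, d) \<in> L" for p d s
  proof
    assume "x = p + s *\<^sub>R d"
    then have "(\<i> * d) \<bullet> x = (\<i> * d) \<bullet> p"
      by (simp add: inner_add_right) (simp add: inner_complex_def)
    then show False using x(2) that by (auto simp: H_def)
  qed
  then show ?thesis using that x(1) by blast
qed

lemma lattice_minus_iff: "- z \<in> gauss_lattice \<longleftrightarrow> z \<in> gauss_lattice"
  by (auto simp: gauss_lattice_def)

lemma generic_point:
  fixes Y Z :: "nat \<Rightarrow> complex"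
  assumes "r > 0"
  obtains q where "\<And>i. i \<in> {1..n} \<Longrightarrow> q i \<in> ball (a i) r"
    "\<And>i j u. i \<in> {1..n} \<Longrightarrow> j \<in> {1..n} \<Longrightarrow> i \<noteq> j \<Longrightarrow> Y i - Y j \<notin> gauss_lattice \<Longrightarrow> u \<in> {0..1} \<Longrightarrow>
       (1 - u) *\<^sub>R (Y i - Y j) + u *\<^sub>R (q i - q j) \<notin> gauss_lattice"
    "\<And>i j u. i \<in> {1..n} \<Longrightarrow> j \<in> {1..n} \<Longrightarrow> i \<noteq> j \<Longrightarrow> Z i - Z j \<notin> gauss_lattice \<Longrightarrow> u \<in> {0..1} \<Longrightarrow>
       (1 - u) *\<^sub>R (Z i - Z j) + u *\<^sub>R (q i - q j) \<notin> gauss_lattice"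
proof -
  define G where "G n q \<longleftrightarrow> (\<forall>i\<in>{1..n}. q i \<in> ball (a i) r \<and> (\<forall>j\<in>{1..n}. \<forall>X\<in>{Y, Z}. \<forall>u\<in>{0..1}. i \<noteq> j \<longrightarrow>
     X i - X j \<notin> gauss_lattice \<longrightarrow> (1 - u) *\<^sub>R (X i - X j) + u *\<^sub>R (q i - q j) \<notin> gauss_lattice))"
    for n and q :: "nat \<Rightarrow> complex"
  have "\<exists>q. G n q"
  proof (induction n)
    case 0
    then show ?case by (simp add: G_def)
  next
    case (Suc n)
    then obtain q where q: "G n q" by blast
    define m where "m = Suc n"
    define L where "L = (\<lambda>(j, X, w). (q j + (X m - X j), w - (X m - X j))) `
        {(j, X, w). j \<in> {1..n} \<and> X \<in> {Y, Z} \<and> w \<in> gauss_lattice \<and> X m - X j \<notin> gauss_lattice}"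
    have "{(j, X, w). j \<in> {1..n} \<and> X \<in> {Y, Z} \<and> w \<in> gauss_lattice \<and> X m - X j \<notin> gauss_lattice}
        \<subseteq> {1..n} \<times> {Y, Z} \<times> gauss_lattice" by auto
    moreover have "countable ({1..n} \<times> {Y, Z} \<times> gauss_lattice)"
      using countable_gauss_lattice by (intro countable_SIGMA) (auto simp: countable_finite)
    ultimately have "countable L"
      unfolding L_def using countable_subset by blast
    moreover have "d \<noteq> 0" if "(p, d) \<in> L" for p d
      using that unfolding L_def by auto
    ultimately obtain x where x: "x \<in> ball (a m) r" "\<And>p d s. (p, d) \<in> L \<Longrightarrow> x \<noteq> p + s *\<^sub>R d"
      using avoid_lines[of L "ball (a m) r"] assms by (metis open_ball centre_in_ball empty_iff)
    have new: "(1 - u) *\<^sub>R (X m - X j) + u *\<^sub>R (x - q j) \<notin> gauss_lattice"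
      if j: "j \<in> {1..n}" and X: "X \<in> {Y, Z}" and nl: "X m - X j \<notin> gauss_lattice" for u :: real and j X
    proof
      define w where "w = (1 - u) *\<^sub>R (X m - X j) + u *\<^sub>R (x - q j)"
      assume "(1 - u) *\<^sub>R (X m - X j) + u *\<^sub>R (x - q j) \<in> gauss_lattice"
      then have w: "w \<in> gauss_lattice" by (simp add: w_def)
      have u: "u \<noteq> 0" using w nl by (auto simp: w_def)
      have "w - (X m - X j) = u *\<^sub>R (x - q j - (X m - X j))"
        by (simp add: w_def algebra_simps)
      then have "(1 / u) *\<^sub>R (w - (X m - X j)) = x - q j - (X m - X j)"
        using u by simp
      then have "x = q j + (X m - X j) + (1 / u) *\<^sub>R (w - (X m - X j))"
        by simp
      moreover have "(q j + (X m - X j), w - (X m - X j)) \<in> L"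
        unfolding L_def using j X nl w by (auto simp: image_iff)
      ultimately show False using x(2) by blast
    qed
    have new': "(1 - u) *\<^sub>R (X j - X m) + u *\<^sub>R (q j - x) \<notin> gauss_lattice"
      if j: "j \<in> {1..n}" and X: "X \<in> {Y, Z}" and nl: "X j - X m \<notin> gauss_lattice" for u :: real and j X
    proof -
      have eq: "(1 - u) *\<^sub>R (X j - X m) + u *\<^sub>R (q j - x) = - ((1 - u) *\<^sub>R (X m - X j) + u *\<^sub>R (x - q j))"
        by (simp add: algebra_simps)
      have "X m - X j \<notin> gauss_lattice" using nl lattice_diff_commute by blast
      then show ?thesis
        unfolding eq lattice_minus_iff by (rule new[OF j X])
    qed
    have "G m (q(m := x))"
      unfolding G_def
    proof (intro ballI conjI impI)
      fix i assume i: "i \<in> {1..m}"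
      show "(q(m := x)) i \<in> ball (a i) r"
        using q x(1) i unfolding G_def m_def by auto
      fix j X and u :: real
      assume j: "j \<in> {1..m}" and X: "X \<in> {Y, Z}" and u: "u \<in> {0..1}" and ij: "i \<noteq> j"
        and nl: "X i - X j \<notin> gauss_lattice"
      consider "i = m" "j \<in> {1..n}" | "j = m" "i \<in> {1..n}" | "i \<in> {1..n}" "j \<in> {1..n}"
        using i j ij unfolding m_def by fastforce
      then show "(1 - u) *\<^sub>R (X i - X j) + u *\<^sub>R ((q(m := x)) i - (q(m := x)) j) \<notin> gauss_lattice"
      proof cases
        case 1 then show ?thesis using new[of j X u] X nl by (simp add: m_def)
      next
        case 2 then show ?thesis using new'[of i X u] X nl by (simp add: m_def)
      next
        case 3
        then have "i \<noteq> m" "j \<noteq> m" by (auto simp: m_def)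
        moreover have "(1 - u) *\<^sub>R (X i - X j) + u *\<^sub>R (q i - q j) \<notin> gauss_lattice"
          using q 3 X u ij nl unfolding G_def by blast
        ultimately show ?thesis by simp
      qed
    qed
    then show ?case unfolding m_def by blast
  qed
  then obtain q where "G n q" by blast
  then show ?thesis by (intro that[of q]) (auto simp: G_def)
qed

lemma free_obtain_near:
  assumes "r > 0"
  obtains q where "free n q" "\<And>i. i \<in> {1..n} \<Longrightarrow> q i \<in> ball (a i) r"
proof -
  define Y where "Y i = complex_of_real (real i / (n + 1))" for i :: nat
  have Y: "Y i - Y j \<notin> gauss_lattice" if ij: "i \<in> {1..n}" "j \<in> {1..n}" "i \<noteq> j" for i j
  proof
    assume l: "Y i - Y j \<in> gauss_lattice"
    have "Y i - Y j = complex_of_real ((real i - real j) / (n + 1))"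
      by (simp add: Y_def diff_divide_distrib)
    then have nm: "norm (Y i - Y j) = \<bar>real i - real j\<bar> / (n + 1)"
      by (simp only: norm_of_real) simp
    also have "\<dots> < 1"
    proof -
      have "\<bar>real i - real j\<bar> < real n + 1" using ij by (auto simp: abs_if)
      then show ?thesis by simp
    qed
    finally have "Y i - Y j = 0" using lattice_small[OF l] by blast
    then have "\<bar>real i - real j\<bar> / real (n + 1) = 0" using nm by (simp only: norm_zero)
    then show False using ij by simp
  qed
  obtain q where "\<And>i. i \<in> {1..n} \<Longrightarrow> q i \<in> ball (a i) r"
    "\<And>i j u. i \<in> {1..n} \<Longrightarrow> j \<in> {1..n} \<Longrightarrow> i \<noteq> j \<Longrightarrow> Y i - Y j \<notin> gauss_lattice \<Longrightarrow> u \<in> {0..1} \<Longrightarrow>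
       (1 - u) *\<^sub>R (Y i - Y j) + u *\<^sub>R (q i - q j) \<notin> gauss_lattice"
    using generic_point[OF assms, of n a Y Y] by metis
  note q = this
  have "free n q"
    unfolding free_def
  proof (intro ballI impI)
    fix i j assume "i \<in> {1..n}" "j \<in> {1..n}" "i \<noteq> j"
    then show "q i - q j \<notin> gauss_lattice"
      using q(2)[of i j 1] Y by simp
  qed
  then show ?thesis using that q(1) by blast
qed

definition free_path :: "nat \<Rightarrow> (real \<Rightarrow> nat \<Rightarrow> complex) \<Rightarrow> bool" where
  "free_path n p \<longleftrightarrow> (\<forall>i\<in>{1..n}. continuous_on {0..1} (\<lambda>t. p t i)) \<and> (\<forall>t\<in>{0..1}. free n (p t))"

lemma pathin_cfg: "free_path n p \<Longrightarrow> pathin (conf n torus) (\<lambda>t. cfg n (p t))"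
  unfolding pathin_def free_path_def by (intro continuous_map_cfg) auto

lemma free_path_join:
  assumes "free_path n p" "free_path n q" "\<And>i. i \<in> {1..n} \<Longrightarrow> p 1 i = q 0 i"
  shows "free_path n (loop_join p q)"
  unfolding free_path_def
proof (intro conjI ballI)
  fix i assume i: "i \<in> {1..n}"
  have "pathin euclidean (loop_join (\<lambda>t. p t i) (\<lambda>t. q t i))"
    using assms i by (intro pathin_loop_join) (auto simp: pathin_def free_path_def)
  moreover have "loop_join (\<lambda>t. p t i) (\<lambda>t. q t i) = (\<lambda>t. loop_join p q t i)"
    by (auto simp: loop_join_def)
  ultimately show "continuous_on {0..1} (\<lambda>t. loop_join p q t i)"
    by (simp add: pathin_def)
next
  fix t :: real assume "t \<in> {0..1}"
  then show "free n (loop_join p q t)"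
    using assms unfolding free_path_def loop_join_def by auto
qed

lemma free_path_rev: "free_path n p \<Longrightarrow> free_path n (path_rev p)"
  unfolding free_path_def path_rev_def
  by (auto intro!: continuous_on_compose2[of "{0..1}" _ "{0..1}" "\<lambda>t. 1 - t"] continuous_intros)

lemma cfg_loop_join: "(\<lambda>t. cfg n (loop_join p q t)) = loop_join (\<lambda>t. cfg n (p t)) (\<lambda>t. cfg n (q t))"
  by (rule ext) (simp add: loop_join_def)

lemma cfg_path_rev: "(\<lambda>t. cfg n (path_rev p t)) = path_rev (\<lambda>t. cfg n (p t))"
  by (auto simp: path_rev_def)

lemma free_connect:
  assumes y: "free n y" "\<And>i. i \<in> {1..n} \<Longrightarrow> y i \<in> ball (a i) r"
    and z: "free n z" "\<And>i. i \<in> {1..n} \<Longrightarrow> z i \<in> ball (a i) r"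
  obtains p where "free_path n p" "p 0 = y" "p 1 = z"
    "\<And>t i. t \<in> {0..1} \<Longrightarrow> i \<in> {1..n} \<Longrightarrow> p t i \<in> ball (a i) r"
proof (cases "n = 0")
  case True
  show ?thesis
    by (rule that[of "\<lambda>t. if t = 0 then y else z"]) (auto simp: True free_path_def free_def)
next
  case False
  then have "1 \<in> {1..n}" by simp
  then have r: "r > 0" using y(2)[of 1] by (metis dist_nz zero_le_dist mem_ball order_le_less_trans)
  obtain q where q: "\<And>i. i \<in> {1..n} \<Longrightarrow> q i \<in> ball (a i) r"
    "\<And>i j u. i \<in> {1..n} \<Longrightarrow> j \<in> {1..n} \<Longrightarrow> i \<noteq> j \<Longrightarrow> y i - y j \<notin> gauss_lattice \<Longrightarrow> u \<in> {0..1} \<Longrightarrow>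
       (1 - u) *\<^sub>R (y i - y j) + u *\<^sub>R (q i - q j) \<notin> gauss_lattice"
    "\<And>i j u. i \<in> {1..n} \<Longrightarrow> j \<in> {1..n} \<Longrightarrow> i \<noteq> j \<Longrightarrow> z i - z j \<notin> gauss_lattice \<Longrightarrow> u \<in> {0..1} \<Longrightarrow>
       (1 - u) *\<^sub>R (z i - z j) + u *\<^sub>R (q i - q j) \<notin> gauss_lattice"
    by (rule generic_point[OF r, of n a y z]) (rule that)
  define seg where "seg x t = (\<lambda>i. (1 - t) *\<^sub>R x i + t *\<^sub>R q i)" for x :: "nat \<Rightarrow> complex" and t :: real
  have diff: "seg x t i - seg x t j = (1 - t) *\<^sub>R (x i - x j) + t *\<^sub>R (q i - q j)" for x t i j
    by (simp add: seg_def algebra_simps)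
  have seg: "free_path n (seg y)" "free_path n (seg z)"
    unfolding free_path_def free_def diff
    using q(2,3) freeD[OF y(1)] freeD[OF z(1)] by (auto simp: seg_def intro!: continuous_intros)
  have ball: "seg x t i \<in> ball (a i) r" if "x i \<in> ball (a i) r" "t \<in> {0..1}" "i \<in> {1..n}" for x t i
    unfolding seg_def using that q(1)[of i] by (intro convexD[OF convex_ball]) auto
  let ?p = "loop_join (seg y) (path_rev (seg z))"
  show ?thesis
  proof (rule that[of ?p])
    show "free_path n ?p"
      by (intro free_path_join free_path_rev seg) (simp add: seg_def)
    show "?p 0 = y" "?p 1 = z" by (auto simp: seg_def)
    show "?p t i \<in> ball (a i) r" if "t \<in> {0..1}" "i \<in> {1..n}" for t i
      using that ball y(2) z(2) by (auto simp: loop_join_def path_rev_def)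
  qed
qed

lemma free_connected:
  assumes "free n y" "free n z"
  obtains p where "free_path n p" "p 0 = y" "p 1 = z"
proof -
  define r where "r = 1 + (\<Sum>i\<in>{1..n}. norm (y i) + norm (z i))"
  have b: "norm (y i) + norm (z i) < r" if "i \<in> {1..n}" for i
    using that member_le_sum[of i "{1..n}" "\<lambda>i. norm (y i) + norm (z i)"] by (simp add: r_def)
  have "y i \<in> ball 0 r \<and> z i \<in> ball 0 r" if "i \<in> {1..n}" for i
    using b[OF that] norm_ge_zero[of "y i"] norm_ge_zero[of "z i"] unfolding mem_ball_0 by linarith
  then show ?thesis
    using that free_connect[of n y "\<lambda>_. 0" r z] assms by blast
qed

lemma conf_path_connected:
  assumes "A \<in> topspace (conf n torus)" "B \<in> topspace (conf n torus)"
  obtains p where "pathin (conf n torus) p" "p 0 = A" "p 1 = B"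
proof -
  obtain y where y: "cfg n y = A" "free n y" using assms(1) by (rule conf_obtain_lift)
  obtain z where z: "cfg n z = B" "free n z" using assms(2) by (rule conf_obtain_lift)
  obtain p where "free_path n p" "p 0 = y" "p 1 = z" using free_connected[OF y(2) z(2)] .
  then show ?thesis using that[of "\<lambda>t. cfg n (p t)"] pathin_cfg y z by simp
qed

section \<open>Collisions become harmless\<close>

text \<open>Assumption \<open>disc\<close> says that the invariant kills the braid group of a small round disc.\<close>

locale disc_killing = path_character Q "conf n torus" c
  for Q (structure) and n :: nat and c +
  fixes b :: complex and r :: real
  assumes r: "r > 0"
    and disc: "free_path n p \<Longrightarrow> cfg n (p 0) = cfg n (p 1) \<Longrightarrow>
      (\<And>t i. t \<in> {0..1} \<Longrightarrow> i \<in> {1..n} \<Longrightarrow> \<exists>w\<in>gauss_lattice. p t i - w \<in> ball b r) \<Longrightarrow>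
      c (\<lambda>t. cfg n (p t)) = \<one>"
begin

definition val :: "(real \<Rightarrow> nat \<Rightarrow> complex) \<Rightarrow> 'a" where
  "val p = c (\<lambda>t. cfg n (p t))"

lemma val_closed [simp]: "free_path n p \<Longrightarrow> val p \<in> carrier Q"
  by (simp add: val_def pathin_cfg)

lemma val_join:
  assumes "free_path n p" "free_path n q" "cfg n (p 1) = cfg n (q 0)"
  shows "c (loop_join (\<lambda>t. cfg n (p t)) (\<lambda>t. cfg n (q t))) = val p \<otimes> val q"
  unfolding val_def using assms by (intro c_join) (auto intro: pathin_cfg)

lemma val_loop_join:
  assumes "free_path n p" "free_path n q" "cfg n (p 1) = cfg n (q 0)"
  shows "val (loop_join p q) = val p \<otimes> val q"
  unfolding val_join[OF assms, symmetric] by (simp add: val_def cfg_loop_join)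

lemma val_rev: "free_path n p \<Longrightarrow> val (path_rev p) = inv (val p)"
  unfolding val_def cfg_path_rev by (rule c_rev[OF pathin_cfg])

lemma val_eqI:
  assumes "free_path n p" "\<And>t. t \<in> {0..1} \<Longrightarrow> cfg n (q t) = cfg n (p t)"
  shows "val q = val p"
  unfolding val_def by (rule c_eqI[OF pathin_cfg[OF assms(1)]]) (rule assms(2))

definition good :: "(nat \<Rightarrow> complex) \<Rightarrow> real \<Rightarrow> bool" where
  "good z \<epsilon> \<longleftrightarrow> (\<forall>p. free_path n p \<longrightarrow> cfg n (p 0) = cfg n (p 1) \<longrightarrow>
     (\<forall>t\<in>{0..1}. \<forall>i\<in>{1..n}. p t i \<in> ball (z i) \<epsilon>) \<longrightarrow> val p = \<one>)"

text \<open>Moving the cluster centres of \<open>z\<close> along generic straight lines transports every loop near \<open>z\<close>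
  into the disc.\<close>

lemma good_exists: "\<exists>\<epsilon>>0. good z \<epsilon>"
proof -
  let ?R = "\<lambda>i j. z i - z j \<in> gauss_lattice"
  have Rsym: "?R i j \<longleftrightarrow> ?R j i" for i j by (rule lattice_diff_commute)
  have Rtrans: "?R i k" if "?R i j" "?R j k" for i j k
    using lattice_intros(2)[OF that] by simp
  define rep where "rep i = (SOME k. k \<in> {1..n} \<and> ?R i k)" for i
  have rep: "rep i \<in> {1..n}" "?R i (rep i)" if "i \<in> {1..n}" for i
  proof -
    have "i \<in> {1..n} \<and> ?R i i" using that by simp
    then have "rep i \<in> {1..n} \<and> ?R i (rep i)" unfolding rep_def by (rule someI)
    then show "rep i \<in> {1..n}" "?R i (rep i)" by auto
  qed
  have rep_eq: "rep i = rep j" if "?R i j" for i j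
  proof -
    have "(\<lambda>k. k \<in> {1..n} \<and> ?R i k) = (\<lambda>k. k \<in> {1..n} \<and> ?R j k)"
      using that Rsym Rtrans by (intro ext) metis
    then show ?thesis unfolding rep_def by simp
  qed
  have r2: "r / 2 > 0" using r by simp
  obtain q where q: "\<And>i. i \<in> {1..n} \<Longrightarrow> q i \<in> ball b (r / 2)"
    "\<And>i j u. i \<in> {1..n} \<Longrightarrow> j \<in> {1..n} \<Longrightarrow> i \<noteq> j \<Longrightarrow> z i - z j \<notin> gauss_lattice \<Longrightarrow> u \<in> {0..1} \<Longrightarrow>
       (1 - u) *\<^sub>R (z i - z j) + u *\<^sub>R (q i - q j) \<notin> gauss_lattice"
    by (rule generic_point[OF r2, of n "\<lambda>_. b" z z]) (rule that)
  define z' where "z' i = q (rep i) + (z i - z (rep i))" for i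
  define zz where "zz u i = (1 - u) *\<^sub>R z i + u *\<^sub>R z' i" for u :: real and i
  have zz_diff: "zz u i - zz u j = (1 - u) *\<^sub>R (z (rep i) - z (rep j)) + u *\<^sub>R (q (rep i) - q (rep j))
      + ((z i - z (rep i)) - (z j - z (rep j)))" for u i j
    by (simp add: zz_def z'_def algebra_simps)
  have zz_coincident: "zz u i - zz u j = z i - z j" if "?R i j" for u i j
    unfolding zz_diff rep_eq[OF that] by simp
  have zz_apart: "zz u i - zz u j \<notin> gauss_lattice"
    if ij: "i \<in> {1..n}" "j \<in> {1..n}" "\<not> ?R i j" and u: "u \<in> {0..1}" for u i j
  proof -
    have "\<not> ?R (rep i) (rep j)"
      using rep[OF ij(1)] rep[OF ij(2)] ij(3) Rtrans Rsym by metis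
    moreover from this have "rep i \<noteq> rep j" by auto
    ultimately have "(1 - u) *\<^sub>R (z (rep i) - z (rep j)) + u *\<^sub>R (q (rep i) - q (rep j)) \<notin> gauss_lattice"
      using q(2) rep(1) ij u by blast
    moreover have "(z i - z (rep i)) - (z j - z (rep j)) \<in> gauss_lattice"
      by (rule lattice_intros(3)[OF rep(2)[OF ij(1)] rep(2)[OF ij(2)]])
    ultimately show ?thesis unfolding zz_diff using lattice_add_iff by blast
  qed
  define Pairs where "Pairs = {(i, j) \<in> {1..n} \<times> {1..n}. \<not> ?R i j}"
  define K where "K = (\<Union>(i, j)\<in>Pairs. (\<lambda>u. zz u i - zz u j) ` {0..1})"
  have "finite Pairs" unfolding Pairs_def by (rule finite_subset[of _ "{1..n} \<times> {1..n}"]) auto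
  then have "compact K"
    unfolding K_def zz_def by (intro compact_UN) (auto intro!: compact_continuous_image continuous_intros)
  moreover have "K \<inter> gauss_lattice = {}" unfolding K_def Pairs_def using zz_apart by auto
  ultimately obtain d where d: "d > 0" "\<And>k w. k \<in> K \<Longrightarrow> w \<in> gauss_lattice \<Longrightarrow> d \<le> dist k w"
    using separate_compact_closed[OF _ closed_gauss_lattice] by metis
  have apart: "d \<le> norm (zz u i - zz u j - w)"
    if ij: "i \<in> {1..n}" "j \<in> {1..n}" "\<not> ?R i j" and u: "u \<in> {0..1}" and w: "w \<in> gauss_lattice" for u i j w
  proof -
    have "(i, j) \<in> Pairs" using ij by (simp add: Pairs_def)
    moreover have "zz u i - zz u j \<in> (\<lambda>u. zz u i - zz u j) ` {0..1}" using u by (rule imageI)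
    ultimately have "zz u i - zz u j \<in> K" unfolding K_def by (intro UN_I[of "(i, j)"]) simp_all
    then show ?thesis using d(2)[OF _ w] by (simp add: dist_norm)
  qed
  define \<epsilon> where "\<epsilon> = min (d / 2) (r / 2)"
  have "\<epsilon> > 0" using d(1) r by (simp add: \<epsilon>_def)
  moreover have "good z \<epsilon>"
    unfolding good_def
  proof (intro allI impI)
    fix p assume p: "free_path n p" and closed: "cfg n (p 0) = cfg n (p 1)"
      and near: "\<forall>t\<in>{0..1}. \<forall>i\<in>{1..n}. p t i \<in> ball (z i) \<epsilon>"
    define H where "H u t i = zz u i + (p t i - z i)" for u t i
    have off: "norm (p t i - z i) < d / 2" "norm (p t i - z i) < r / 2" if "t \<in> {0..1}" "i \<in> {1..n}" for t i
      using near that by (auto simp: \<epsilon>_def dist_norm norm_minus_commute)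
    have off2: "norm ((p t i - z i) - (p s j - z j)) < d"
      if "t \<in> {0..1}" "i \<in> {1..n}" "s \<in> {0..1}" "j \<in> {1..n}" for s t i j
      using off(1)[OF that(1,2)] off(1)[OF that(3,4)] norm_triangle_ineq4[of "p t i - z i" "p s j - z j"]
      by linarith
    have Hfree: "free n (H u t)" if u: "u \<in> {0..1}" and t: "t \<in> {0..1}" for u t
      unfolding free_def
    proof (intro ballI impI)
      fix i j assume ij: "i \<in> {1..n}" "j \<in> {1..n}" "i \<noteq> j"
      show "H u t i - H u t j \<notin> gauss_lattice"
      proof (cases "?R i j")
        case True
        have "H u t i - H u t j = (zz u i - zz u j) - (z i - z j) + (p t i - p t j)"
          by (simp add: H_def)
        also have "\<dots> = p t i - p t j" using zz_coincident[OF True] by simp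
        finally show ?thesis using p t ij by (auto simp: free_path_def free_def)
      next
        case False
        show ?thesis
        proof
          assume w: "H u t i - H u t j \<in> gauss_lattice"
          have "zz u i - zz u j - (H u t i - H u t j) = - ((p t i - z i) - (p t j - z j))"
            by (simp add: H_def)
          then have "norm (zz u i - zz u j - (H u t i - H u t j)) = norm ((p t i - z i) - (p t j - z j))"
            by (simp only: norm_minus_cancel)
          then show False
            using apart[OF ij(1,2) False u w] off2[OF t ij(1) t ij(2)] by linarith
        qed
      qed
    qed
    have cont: "continuous_map (top_of_set ({0..1} \<times> {0..1})) (conf n torus) (\<lambda>x. cfg n (H (fst x) (snd x)))"
    proof (rule continuous_map_cfg)
      fix i assume "i \<in> {1..n}"
      then have "continuous_on {0..1} (\<lambda>t. p t i)" using p by (simp add: free_path_def)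
      then have "continuous_on ({0..1} \<times> {0..1}) (\<lambda>x::real \<times> real. p (snd x) i)"
        by (rule continuous_on_compose2) (auto intro!: continuous_intros)
      then show "continuous_on ({0..1} \<times> {0..1}) (\<lambda>x. H (fst x) (snd x) i)"
        unfolding H_def zz_def by (intro continuous_intros)
    qed (auto intro: Hfree)
    have Hclosed: "cfg n (H u 0) = cfg n (H u 1)" if u: "u \<in> {0..1}" for u
    proof -
      have "free n (p 0)" using p by (simp add: free_path_def)
      then obtain \<sigma> where \<sigma>: "bij_betw \<sigma> {1..n} {1..n}" "\<And>i. i \<in> {1..n} \<Longrightarrow> p 0 i - p 1 (\<sigma> i) \<in> gauss_lattice"
        using cfg_eq_obtain[OF closed] by blast
      show ?thesis
      proof (rule cfg_permute)
        show "\<sigma> ` {1..n} = {1..n}" using \<sigma>(1) by (simp add: bij_betw_def)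
        fix i assume i: "i \<in> {1..n}"
        then have si: "\<sigma> i \<in> {1..n}" using \<sigma>(1) bij_betwE by blast
        have R: "?R i (\<sigma> i)"
        proof (rule ccontr)
          assume nR: "\<not> ?R i (\<sigma> i)"
          have "zz 0 i - zz 0 (\<sigma> i) - (p 0 i - p 1 (\<sigma> i)) = - ((p 0 i - z i) - (p 1 (\<sigma> i) - z (\<sigma> i)))"
            by (simp add: zz_def)
          then have "norm (zz 0 i - zz 0 (\<sigma> i) - (p 0 i - p 1 (\<sigma> i))) = norm ((p 0 i - z i) - (p 1 (\<sigma> i) - z (\<sigma> i)))"
            by (simp only: norm_minus_cancel)
          then show False
            using apart[OF i si nR _ \<sigma>(2)[OF i], of 0] off2[OF _ i _ si, of 0 1] by auto
        qed
        have "H u 0 i - H u 1 (\<sigma> i) = (zz u i - zz u (\<sigma> i)) - (z i - z (\<sigma> i)) + (p 0 i - p 1 (\<sigma> i))"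
          by (simp add: H_def)
        also have "\<dots> = p 0 i - p 1 (\<sigma> i)" using zz_coincident[OF R] by simp
        finally show "H u 0 i - H u 1 (\<sigma> i) \<in> gauss_lattice" using \<sigma>(2)[OF i] by simp
      qed
    qed
    have "val (H 1) = \<one>"
      unfolding val_def
    proof (rule disc)
      show "free_path n (H 1)"
        unfolding free_path_def using Hfree[of 1] p
        by (auto simp: H_def free_path_def intro!: continuous_intros)
      show "cfg n (H 1 0) = cfg n (H 1 1)" by (rule Hclosed) simp
      fix t :: real and i assume t: "t \<in> {0..1}" and i: "i \<in> {1..n}"
      have eq: "H 1 t i - (z i - z (rep i)) = q (rep i) + (p t i - z i)"
        by (simp add: H_def zz_def z'_def)
      have "norm (b - (q (rep i) + (p t i - z i))) \<le> norm (b - q (rep i)) + norm (p t i - z i)"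
        using norm_triangle_ineq4[of "b - q (rep i)" "p t i - z i"] by (simp add: algebra_simps)
      moreover have "norm (b - q (rep i)) < r / 2" using q(1)[OF rep(1)[OF i]] by (simp add: dist_norm)
      ultimately have "H 1 t i - (z i - z (rep i)) \<in> ball b r"
        unfolding eq mem_ball dist_norm using off(2)[OF t i] by linarith
      then show "\<exists>w\<in>gauss_lattice. H 1 t i - w \<in> ball b r" using rep(2)[OF i] by blast
    qed
    then have "c (\<lambda>t. cfg n (H 0 t)) = \<one>"
      unfolding val_def
      by (intro c_free_homotopic[where K = "\<lambda>u t. cfg n (H u t)"]) (use cont Hclosed in auto)
    moreover have "H 0 = p" by (auto simp: H_def zz_def fun_eq_iff)
    ultimately show "val p = \<one>" by (simp add: val_def)
  qed
  ultimately show ?thesis by blast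
qed

lemma good_eq:
  assumes "good z \<epsilon>" "free_path n p" "free_path n q"
    and ends: "\<And>i. i \<in> {1..n} \<Longrightarrow> p 0 i = q 0 i" "\<And>i. i \<in> {1..n} \<Longrightarrow> p 1 i = q 1 i"
    and near: "\<And>t i. t \<in> {0..1} \<Longrightarrow> i \<in> {1..n} \<Longrightarrow> p t i \<in> ball (z i) \<epsilon>"
      "\<And>t i. t \<in> {0..1} \<Longrightarrow> i \<in> {1..n} \<Longrightarrow> q t i \<in> ball (z i) \<epsilon>"
  shows "val p = val q"
proof -
  have c1: "cfg n (p 1) = cfg n (q 1)" "cfg n (p 0) = cfg n (q 0)"
    using ends by (auto intro!: cfg_cong)
  let ?l = "loop_join p (path_rev q)"
  have "free_path n ?l"
    using assms(2,3) ends(2) by (intro free_path_join free_path_rev) auto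
  moreover have "cfg n (?l 0) = cfg n (?l 1)" using c1 by simp
  moreover have "?l t i \<in> ball (z i) \<epsilon>" if "t \<in> {0..1}" "i \<in> {1..n}" for t i
    using near that by (auto simp: loop_join_def path_rev_def)
  ultimately have "val ?l = \<one>" using assms(1) unfolding good_def by blast
  moreover have "val ?l = val p \<otimes> inv (val q)"
    using assms(2,3) c1 by (subst val_loop_join) (auto intro: free_path_rev simp: val_rev)
  ultimately have eq: "val p \<otimes> inv (val q) = \<one>" by simp
  show ?thesis
    using inv_equality[OF eq] assms(2,3) by simp
qed

end

lemma uniformly_continuous_family:
  fixes S :: "'m::metric_space set" and f :: "'m \<Rightarrow> 'i \<Rightarrow> 'k::metric_space"
  assumes "compact S" "finite I" "\<And>i. i \<in> I \<Longrightarrow> continuous_on S (\<lambda>x. f x i)" "e > 0"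
  shows "\<exists>d>0. \<forall>x\<in>S. \<forall>y\<in>S. dist x y < d \<longrightarrow> (\<forall>i\<in>I. dist (f x i) (f y i) < e)"
  using assms(2,3)
proof (induction I)
  case empty
  then show ?case by (auto intro: exI[of _ 1])
next
  case (insert i I)
  then obtain d where d: "d > 0" "\<forall>x\<in>S. \<forall>y\<in>S. dist x y < d \<longrightarrow> (\<forall>i\<in>I. dist (f x i) (f y i) < e)"
    by auto
  have "uniformly_continuous_on S (\<lambda>x. f x i)"
    using insert.prems assms(1) by (intro compact_uniformly_continuous) auto
  then obtain d' where "d' > 0" "\<forall>x\<in>S. \<forall>y\<in>S. dist y x < d' \<longrightarrow> dist (f y i) (f x i) < e"
    using \<open>e > 0\<close> unfolding uniformly_continuous_on_def by meson
  then show ?case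
    using d by (intro exI[of _ "min d d'"]) auto
qed

context disc_killing begin

lemma good_mono:
  assumes "good z \<epsilon>" "\<And>i. i \<in> {1..n} \<Longrightarrow> ball (z' i) \<delta> \<subseteq> ball (z i) \<epsilon>"
  shows "good z' \<delta>"
  unfolding good_def
proof (intro allI impI)
  fix p assume "free_path n p" "cfg n (p 0) = cfg n (p 1)" "\<forall>t\<in>{0..1}. \<forall>i\<in>{1..n}. p t i \<in> ball (z' i) \<delta>"
  then show "val p = \<one>" using assms unfolding good_def by blast
qed

lemma good_uniform:
  fixes S :: "'m::metric_space set"
  assumes S: "compact S" and H: "\<And>i. i \<in> {1..n} \<Longrightarrow> continuous_on S (\<lambda>x. H x i)"
  shows "\<exists>\<rho>>0. \<forall>x\<in>S. good (H x) \<rho>"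
proof -
  have "\<exists>\<epsilon>. \<epsilon> > 0 \<and> good (H x) \<epsilon>" for x
    using good_exists by blast
  then obtain \<epsilon> where \<epsilon>: "\<And>x. \<epsilon> x > 0" "\<And>x. good (H x) (\<epsilon> x)"
    by metis
  have "\<exists>U. open U \<and> x \<in> U \<and> (\<forall>y\<in>S \<inter> U. \<forall>i\<in>{1..n}. dist (H y i) (H x i) < \<epsilon> x / 2)" if x: "x \<in> S" for x
  proof -
    have "eventually (\<lambda>y. \<forall>i\<in>{1..n}. dist (H y i) (H x i) < \<epsilon> x / 2) (at x within S)"
    proof (rule eventually_ball_finite, simp, intro ballI)
      fix i assume "i \<in> {1..n}"
      then have "((\<lambda>y. H y i) \<longlongrightarrow> H x i) (at x within S)" using H x by (simp add: continuous_on_def)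
      then show "eventually (\<lambda>y. dist (H y i) (H x i) < \<epsilon> x / 2) (at x within S)"
        by (rule tendstoD) (use \<epsilon> in simp)
    qed
    then obtain U where "open U" "x \<in> U" "\<forall>y\<in>U. y \<noteq> x \<longrightarrow> y \<in> S \<longrightarrow> (\<forall>i\<in>{1..n}. dist (H y i) (H x i) < \<epsilon> x / 2)"
      unfolding eventually_at_topological by blast
    then show ?thesis using \<epsilon>(1)[of x] by (intro exI[of _ U]) (metis IntE dist_self half_gt_zero)
  qed
  then obtain U where U: "\<And>x. x \<in> S \<Longrightarrow> open (U x)" "\<And>x. x \<in> S \<Longrightarrow> x \<in> U x"
    "\<And>x y i. x \<in> S \<Longrightarrow> y \<in> S \<Longrightarrow> y \<in> U x \<Longrightarrow> i \<in> {1..n} \<Longrightarrow> dist (H y i) (H x i) < \<epsilon> x / 2"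
    by (metis IntI)
  have "S \<subseteq> (\<Union>x\<in>S. U x)" using U(2) by blast
  then obtain F where F: "F \<subseteq> S" "finite F" "S \<subseteq> (\<Union>x\<in>F. U x)"
    using compactE_image[OF S, of S U] U(1) by metis
  define \<rho> where "\<rho> = Min (insert 1 ((\<lambda>x. \<epsilon> x / 2) ` F))"
  have "\<rho> > 0" using F(2) \<epsilon>(1) by (simp add: \<rho>_def)
  moreover have "good (H y) \<rho>" if y: "y \<in> S" for y
  proof -
    obtain x where x: "x \<in> F" "y \<in> U x" using F(3) y by blast
    have \<rho>: "\<rho> \<le> \<epsilon> x / 2" unfolding \<rho>_def using F(2) x(1) by (intro Min_le) auto
    show ?thesis
    proof (rule good_mono[OF \<epsilon>(2)[of x]])
      fix i assume i: "i \<in> {1..n}"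
      have d: "dist (H y i) (H x i) < \<epsilon> x / 2" using U(3)[OF _ y x(2) i] x(1) F(1) by blast
      show "ball (H y i) \<rho> \<subseteq> ball (H x i) (\<epsilon> x)"
      proof
        fix w assume "w \<in> ball (H y i) \<rho>"
        then show "w \<in> ball (H x i) (\<epsilon> x)"
          using d \<rho> dist_triangle[of "H x i" w "H y i"] by (simp add: dist_commute)
      qed
    qed
  qed
  ultimately show ?thesis by blast
qed

lemma val_const:
  assumes "free n y" shows "val (\<lambda>_. y) = \<one>"
  unfolding val_def using assms by (intro c_const cfg_in_conf)

text \<open>The cone over the path from its starting point is cut into small squares; the boundary of a
  square whose vertices are pushed off the collisions lies in a good ball.\<close>

lemma val_closed_lift:
  assumes p: "free_path n p" and closed: "\<And>i. i \<in> {1..n} \<Longrightarrow> p 1 i = p 0 i"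
  shows "val p = \<one>"
proof -
  define H where "H s t = (\<lambda>i. (1 - s) *\<^sub>R p 0 i + s *\<^sub>R p t i)" for s t :: real
  let ?S = "{0..1::real} \<times> {0..1::real}"
  have contH: "continuous_on ?S (\<lambda>x. H (fst x) (snd x) i)" if "i \<in> {1..n}" for i
  proof -
    have "continuous_on {0..1} (\<lambda>t. p t i)" using p that by (simp add: free_path_def)
    then have "continuous_on ?S (\<lambda>x. p (snd x) i)"
      by (rule continuous_on_compose2) (auto intro!: continuous_intros)
    then show ?thesis unfolding H_def by (intro continuous_intros)
  qed
  have S: "compact ?S" by (intro compact_Times compact_Icc)
  have "\<exists>\<rho>>0. \<forall>x\<in>?S. good (H (fst x) (snd x)) \<rho>"
    by (rule good_uniform[OF S contH])
  then obtain \<rho> where \<rho>: "\<rho> > 0" "\<And>s t. s \<in> {0..1} \<Longrightarrow> t \<in> {0..1} \<Longrightarrow> good (H s t) \<rho>"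
    by auto
  have "\<exists>d>0. \<forall>x\<in>?S. \<forall>y\<in>?S. dist x y < d \<longrightarrow>
      (\<forall>i\<in>{1..n}. dist (H (fst x) (snd x) i) (H (fst y) (snd y) i) < \<rho> / 8)"
    by (rule uniformly_continuous_family[OF S _ contH]) (use \<rho>(1) in simp_all)
  then obtain \<delta> where \<delta>: "\<delta> > 0" "\<And>x y i. x \<in> ?S \<Longrightarrow> y \<in> ?S \<Longrightarrow> dist x y < \<delta> \<Longrightarrow> i \<in> {1..n} \<Longrightarrow>
      dist (H (fst x) (snd x) i) (H (fst y) (snd y) i) < \<rho> / 8"
    by blast
  obtain m where m: "m > 0" "2 / real m < \<delta>"
  proof -
    obtain k where "2 / \<delta> < real k" using reals_Archimedean2 by blast
    moreover from this have "0 < real k" using \<delta>(1) by (meson divide_pos_pos less_trans zero_less_numeral)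
    ultimately show ?thesis using \<delta>(1) by (intro that[of k]) (auto simp: field_simps)
  qed
  have nearH: "dist (H s t i) (H s' t' i) < \<rho> / 8"
    if "s \<in> {0..1}" "t \<in> {0..1}" "s' \<in> {0..1}" "t' \<in> {0..1}" "\<bar>s - s'\<bar> \<le> 1 / m" "\<bar>t - t'\<bar> \<le> 1 / m" "i \<in> {1..n}"
    for s t s' t' i
  proof -
    have "dist (s, t) (s', t') \<le> \<bar>s - s'\<bar> + \<bar>t - t'\<bar>"
      unfolding dist_Pair_Pair dist_real_def by (rule sqrt_sum_squares_le_sum_abs[THEN order_trans]) simp
    also have "\<dots> \<le> 2 / m" using that by simp
    also have "\<dots> < \<delta>" by (rule m(2))
    finally show ?thesis using \<delta>(2)[of "(s, t)" "(s', t')" i] that by simp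
  qed
  have unit: "real k / real m \<in> {0..1}" if "k \<le> m" for k using that m(1) by simp
  define N where "N j k = H (real j / m) (real k / m)" for j k :: nat
  have nearN: "dist (N j k i) (N j' k' i) < \<rho> / 8"
    if "j \<le> m" "k \<le> m" "j' \<le> m" "k' \<le> m" "j' \<in> {j, Suc j}" "k' \<in> {k, Suc k}" "i \<in> {1..n}" for j k j' k' i
  proof -
    have "\<bar>real j / m - real j' / m\<bar> \<le> 1 / m" "\<bar>real k / m - real k' / m\<bar> \<le> 1 / m"
      using that(5,6) m(1) by (auto simp: divide_right_mono simp flip: diff_divide_distrib)
    then show ?thesis unfolding N_def using that unit by (intro nearH) auto
  qed
  define h where "h j k = (if free n (N j k) then N j k else
      (SOME q. free n q \<and> (\<forall>i\<in>{1..n}. q i \<in> ball (N j k i) (\<rho> / 8))))" for j k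
  have h: "free n (h j k) \<and> (\<forall>i\<in>{1..n}. h j k i \<in> ball (N j k i) (\<rho> / 8))" for j k
  proof (cases "free n (N j k)")
    case True
    then show ?thesis using \<rho>(1) by (simp add: h_def)
  next
    case False
    have ex: "\<exists>q. free n q \<and> (\<forall>i\<in>{1..n}. q i \<in> ball (N j k i) (\<rho> / 8))"
      by (rule free_obtain_near[of "\<rho> / 8" n "N j k"]) (use \<rho>(1) in auto)
    have eq: "h j k = (SOME q. free n q \<and> (\<forall>i\<in>{1..n}. q i \<in> ball (N j k i) (\<rho> / 8)))"
      using False by (simp add: h_def)
    show ?thesis unfolding eq by (rule someI_ex[OF ex])
  qed
  have hN: "h j k = N j k" if "free n (N j k)" for j k using that by (simp add: h_def)
  have h_near: "dist (N j k i) (h j' k' i) < \<rho> / 4"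
    if "j \<le> m" "k \<le> m" "j' \<le> m" "k' \<le> m" "j' \<in> {j, Suc j}" "k' \<in> {k, Suc k}" "i \<in> {1..n}" for j k j' k' i
  proof -
    have "dist (N j' k' i) (h j' k' i) < \<rho> / 8" using h[of j' k'] that(7) by auto
    then show ?thesis using nearN[OF that] dist_triangle[of "N j k i" "h j' k' i" "N j' k' i"] by linarith
  qed
  have goodN: "good (N j k) \<rho>" if "j \<le> m" "k \<le> m" for j k
    unfolding N_def using that unit \<rho>(2) by blast
  define e where "e x y = (SOME P. free_path n P \<and> P 0 = x \<and> P 1 = y \<and>
      (\<forall>t\<in>{0..1}. \<forall>i\<in>{1..n}. P t i \<in> ball (x i) (\<rho> / 2)))" for x y :: "nat \<Rightarrow> complex"
  have e: "free_path n (e x y) \<and> e x y 0 = x \<and> e x y 1 = y \<and>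
      (\<forall>t\<in>{0..1}. \<forall>i\<in>{1..n}. e x y t i \<in> ball (x i) (\<rho> / 2))"
    if "free n x" "free n y" "\<And>i. i \<in> {1..n} \<Longrightarrow> dist (x i) (y i) < \<rho> / 2" for x y
  proof -
    have "\<exists>P. free_path n P \<and> P 0 = x \<and> P 1 = y \<and> (\<forall>t\<in>{0..1}. \<forall>i\<in>{1..n}. P t i \<in> ball (x i) (\<rho> / 2))"
      by (rule free_connect[of n x x "\<rho> / 2" y]) (use that \<rho>(1) in auto)
    then show ?thesis unfolding e_def by (rule someI_ex)
  qed
  define d where "d x y = val (e x y)" for x y
  have near2: "dist (x i) (y i) < \<rho> / 2"
    if "dist (z i) (x i) < \<rho> / 4" "dist (z i) (y i) < \<rho> / 4" for x y z :: "nat \<Rightarrow> complex" and i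
    using that dist_triangle3[of "x i" "y i" "z i"] by linarith
  have e': "free_path n (e x y)" "e x y 0 = x" "e x y 1 = y"
      "\<And>t i. t \<in> {0..1} \<Longrightarrow> i \<in> {1..n} \<Longrightarrow> e x y t i \<in> ball (z i) \<rho>"
    if fr: "free n x" "free n y" and zx: "\<And>i. i \<in> {1..n} \<Longrightarrow> dist (z i) (x i) < \<rho> / 4"
      and zy: "\<And>i. i \<in> {1..n} \<Longrightarrow> dist (z i) (y i) < \<rho> / 4" for x y z
  proof -
    have E: "free_path n (e x y) \<and> e x y 0 = x \<and> e x y 1 = y \<and>
      (\<forall>t\<in>{0..1}. \<forall>i\<in>{1..n}. e x y t i \<in> ball (x i) (\<rho> / 2))"
      by (rule e[OF fr]) (rule near2[OF zx zy])
    then show "free_path n (e x y)" "e x y 0 = x" "e x y 1 = y" by auto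
    fix t :: real and i assume t: "t \<in> {0..1}" and i: "i \<in> {1..n}"
    have "dist (x i) (e x y t i) < \<rho> / 2" using E t i by auto
    then show "e x y t i \<in> ball (z i) \<rho>"
      using zx[OF i] dist_triangle[of "z i" "e x y t i" "x i"] \<rho>(1) by simp
  qed
  have d_path: "val P = d x y"
    if g: "good z \<rho>" and fr: "free n x" "free n y"
      and zx: "\<And>i. i \<in> {1..n} \<Longrightarrow> dist (z i) (x i) < \<rho> / 4"
      and zy: "\<And>i. i \<in> {1..n} \<Longrightarrow> dist (z i) (y i) < \<rho> / 4"
      and P: "free_path n P" "\<And>i. i \<in> {1..n} \<Longrightarrow> P 0 i = x i" "\<And>i. i \<in> {1..n} \<Longrightarrow> P 1 i = y i"
      "\<And>t i. t \<in> {0..1} \<Longrightarrow> i \<in> {1..n} \<Longrightarrow> P t i \<in> ball (z i) \<rho>" for z x y P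
  proof -
    have E: "free_path n (e x y)" "e x y 0 = x" "e x y 1 = y"
      by (rule e'[OF fr, of z]; rule zx zy; assumption)+
    show ?thesis
      unfolding d_def
    proof (rule good_eq[OF g P(1) E(1)])
      show "P 0 i = e x y 0 i" "P 1 i = e x y 1 i" if "i \<in> {1..n}" for i
        using P(2,3) that by (simp_all add: E)
      show "P t i \<in> ball (z i) \<rho>" if "t \<in> {0..1}" "i \<in> {1..n}" for t i
        using that by (rule P(4))
      show "e x y t i \<in> ball (z i) \<rho>" if "t \<in> {0..1}" "i \<in> {1..n}" for t i
        by (rule e'(4)[OF fr, of z]; (rule zx zy; assumption | rule that))
    qed
  qed
  have d_in: "d x y \<in> carrier Q"
    if "free n x" "free n y" "\<And>i. i \<in> {1..n} \<Longrightarrow> dist (z i) (x i) < \<rho> / 4"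
      "\<And>i. i \<in> {1..n} \<Longrightarrow> dist (z i) (y i) < \<rho> / 4" for z x y
    unfolding d_def by (rule val_closed, rule e'(1)[of x y z]; rule that; assumption)
  have tri: "d x y \<otimes> d y w = d x w"
    if g: "good z \<rho>" and fr: "free n x" "free n y" "free n w"
      and zx: "\<And>i. i \<in> {1..n} \<Longrightarrow> dist (z i) (x i) < \<rho> / 4"
      and zy: "\<And>i. i \<in> {1..n} \<Longrightarrow> dist (z i) (y i) < \<rho> / 4"
      and zw: "\<And>i. i \<in> {1..n} \<Longrightarrow> dist (z i) (w i) < \<rho> / 4" for z x y w
  proof -
    have E1: "free_path n (e x y)" "e x y 0 = x" "e x y 1 = y"
      by (rule e'[OF fr(1,2), of z]; rule zx zy; assumption)+
    have E2: "free_path n (e y w)" "e y w 0 = y" "e y w 1 = w"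
      by (rule e'[OF fr(2,3), of z]; rule zy zw; assumption)+
    have E1b: "e x y t i \<in> ball (z i) \<rho>" if "t \<in> {0..1}" "i \<in> {1..n}" for t i
      by (rule e'(4)[OF fr(1,2), of z]; (rule zx zy; assumption | rule that))
    have E2b: "e y w t i \<in> ball (z i) \<rho>" if "t \<in> {0..1}" "i \<in> {1..n}" for t i
      by (rule e'(4)[OF fr(2,3), of z]; (rule zy zw; assumption | rule that))
    have "val (loop_join (e x y) (e y w)) = d x w"
    proof (rule d_path[OF g fr(1,3)])
      show "free_path n (loop_join (e x y) (e y w))"
        by (rule free_path_join[OF E1(1) E2(1)]) (simp add: E1(3) E2(2))
      show "loop_join (e x y) (e y w) t i \<in> ball (z i) \<rho>" if "t \<in> {0..1}" "i \<in> {1..n}" for t i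
        unfolding loop_join_def using that E1b[of "2 * t" i] E2b[of "2 * t - 1" i] by auto
    qed (use zx zw in \<open>simp_all add: E1(2) E2(3)\<close>)
    moreover have "val (loop_join (e x y) (e y w)) = d x y \<otimes> d y w"
      unfolding d_def by (rule val_loop_join[OF E1(1) E2(1)]) (simp add: E1(3) E2(2))
    ultimately show ?thesis by simp
  qed
  have d_same: "d x y = \<one>" if g: "good x \<rho>" and fr: "free n x" "free n y" and xy: "\<And>i. i \<in> {1..n} \<Longrightarrow> y i = x i" for x y
  proof -
    have "val (\<lambda>_. x) = d x y"
      using \<rho>(1) fr by (intro d_path[OF g fr]) (auto simp: free_path_def xy)
    then show ?thesis using val_const[OF fr(1)] by simp
  qed
  define R where "R j k = rec_nat \<one> (\<lambda>k a. a \<otimes> d (h j k) (h j (Suc k))) k" for j k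
  have R0: "R j 0 = \<one>" and RS: "R j (Suc k) = R j k \<otimes> d (h j k) (h j (Suc k))" for j k
    by (simp_all add: R_def)
  have d_h: "d (h j' k') (h j'' k'') \<in> carrier Q"
    if "j \<le> m" "k \<le> m" "j' \<le> m" "k' \<le> m" "j' \<in> {j, Suc j}" "k' \<in> {k, Suc k}"
      "j'' \<le> m" "k'' \<le> m" "j'' \<in> {j, Suc j}" "k'' \<in> {k, Suc k}" for j k j' k' j'' k''
    using h that by (intro d_in[where z = "N j k"] h_near) auto
  have R_in: "R j k \<in> carrier Q" if "j \<le> m" "k \<le> m" for j k
    using that(2)
  proof (induction k)
    case (Suc k)
    then show ?case using that(1) d_h[of j k j k j "Suc k"] by (simp add: RS)
  qed (simp add: R0)
  have tri_h: "d (h j k) (h a b) \<otimes> d (h a b) (h (Suc j) (Suc k)) = d (h j k) (h (Suc j) (Suc k))"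
    if "Suc j \<le> m" "Suc k \<le> m" "a \<in> {j, Suc j}" "b \<in> {k, Suc k}" for j k a b
    using that h by (intro tri[OF goodN[of j k]] h_near) auto
  have free_p: "free n (p t)" if "t \<in> {0..1}" for t using p that by (simp add: free_path_def)
  have N0: "N j 0 = p 0" for j by (simp add: N_def H_def fun_eq_iff algebra_simps flip: scaleR_add_left)
  have N0k: "N 0 k = p 0" for k by (simp add: N_def H_def fun_eq_iff)
  have Nm: "N m k = p (k / m)" for k using m(1) by (simp add: N_def H_def fun_eq_iff)
  have Njm: "N j m i = p 0 i" if "i \<in> {1..n}" for j i
    using m(1) closed[OF that] by (simp add: N_def H_def algebra_simps flip: scaleR_add_left)
  have free_Njm: "free n (N j m)" for j
    using free_p[of 0] Njm[of _ j] unfolding free_def by simp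
  have row: "R j k \<otimes> d (h j k) (h (Suc j) k) = R (Suc j) k" if j: "Suc j \<le> m" and k: "k \<le> m" for j k
    using k
  proof (induction k)
    case 0
    have "d (h j 0) (h (Suc j) 0) = \<one>"
      using free_p[of 0] goodN[of j 0] j by (intro d_same) (simp_all add: hN N0)
    then show ?case by (simp add: R0)
  next
    case (Suc k)
    have in1: "R j k \<in> carrier Q" "R (Suc j) k \<in> carrier Q" using R_in j Suc.prems by auto
    have in2: "d (h j k) (h j (Suc k)) \<in> carrier Q" "d (h j (Suc k)) (h (Suc j) (Suc k)) \<in> carrier Q"
      "d (h j k) (h (Suc j) k) \<in> carrier Q" "d (h (Suc j) k) (h (Suc j) (Suc k)) \<in> carrier Q"
      using j Suc.prems by (auto intro!: d_h[of j k])
    have "R j (Suc k) \<otimes> d (h j (Suc k)) (h (Suc j) (Suc k))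
        = R j k \<otimes> (d (h j k) (h j (Suc k)) \<otimes> d (h j (Suc k)) (h (Suc j) (Suc k)))"
      using in1 in2 by (simp add: RS m_assoc)
    also have "\<dots> = R j k \<otimes> (d (h j k) (h (Suc j) k) \<otimes> d (h (Suc j) k) (h (Suc j) (Suc k)))"
      using j Suc.prems by (simp add: tri_h)
    also have "\<dots> = (R j k \<otimes> d (h j k) (h (Suc j) k)) \<otimes> d (h (Suc j) k) (h (Suc j) (Suc k))"
      using in1 in2 by (simp add: m_assoc)
    also have "\<dots> = R (Suc j) (Suc k)" using Suc by (simp add: RS)
    finally show ?case .
  qed
  have "R j m = \<one>" if "j \<le> m" for j
    using that
  proof (induction j)
    case 0
    have "R 0 k = \<one>" if "k \<le> m" for k
      using that
    proof (induction k)
      case (Suc k)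
      have "d (h 0 k) (h 0 (Suc k)) = \<one>"
        using free_p[of 0] goodN[of 0 k] Suc.prems by (intro d_same) (simp_all add: hN N0k)
      then show ?case using Suc by (simp add: RS)
    qed (simp add: R0)
    then show ?case by simp
  next
    case (Suc j)
    have "d (h j m) (h (Suc j) m) = \<one>"
      using free_Njm goodN[of j m] Suc.prems by (intro d_same) (simp_all add: hN Njm)
    then show ?case using row[OF Suc.prems, of m] Suc by simp
  qed
  then have Rm: "R m m = \<one>" by simp
  have "val (\<lambda>t. p (k / m * t)) = R m k" if "k \<le> m" for k
    using that
  proof (induction k)
    case 0
    then show ?case using val_const[OF free_p[of 0]] by (simp add: R0)
  next
    case (Suc k)
    let ?a = "real k / m" and ?b = "real (Suc k) / m"
    let ?P = "\<lambda>t. p (?a + (?b - ?a) * t)"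
    have ab: "0 \<le> ?a" "?a \<le> ?b" "?b \<le> 1" using Suc.prems m(1) by (auto simp: divide_right_mono)
    have ba: "?b - ?a = 1 / m" by (simp add: diff_divide_distrib[symmetric])
    have inI: "?a + (?b - ?a) * t \<in> {0..1}" and small: "\<bar>?a - (?a + (?b - ?a) * t)\<bar> \<le> 1 / m"
      if t: "t \<in> {0..1}" for t
    proof -
      have "0 \<le> (?b - ?a) * t" "(?b - ?a) * t \<le> (?b - ?a) * 1"
        using t ab by (intro mult_nonneg_nonneg mult_left_mono; simp)+
      then show "?a + (?b - ?a) * t \<in> {0..1}" "\<bar>?a - (?a + (?b - ?a) * t)\<bar> \<le> 1 / m"
        using ab ba by auto
    qed
    have fP: "free_path n ?P"
      unfolding free_path_def
    proof (intro conjI ballI)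
      fix i assume "i \<in> {1..n}"
      then have "continuous_on {0..1} (\<lambda>t. p t i)" using p by (simp add: free_path_def)
      then show "continuous_on {0..1} (\<lambda>t. ?P t i)"
        by (rule continuous_on_compose2) (use inI in \<open>auto intro!: continuous_intros\<close>)
    qed (use inI free_p in blast)
    have "val ?P = d (h m k) (h m (Suc k))"
    proof (rule d_path[OF goodN[of m k]])
      show "?P t i \<in> ball (N m k i) \<rho>" if t: "t \<in> {0..1}" and i: "i \<in> {1..n}" for t i
        using nearH[of 1 ?a 1 "?a + (?b - ?a) * t" i] inI[OF t] small[OF t] ab i \<rho>(1) unfolding Nm
        by (simp add: H_def)
      show "dist (N m k i) (h m k i) < \<rho> / 4" "dist (N m k i) (h m (Suc k) i) < \<rho> / 4" if "i \<in> {1..n}" for i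
        using Suc.prems that by (intro h_near; simp)+
    qed (use Suc.prems h fP free_p unit in \<open>auto simp: hN Nm\<close>)
    moreover have "val (\<lambda>t. p (?b * t)) = val (\<lambda>t. p (?a * t)) \<otimes> val ?P"
      unfolding val_def by (rule c_subdivide[OF pathin_cfg[OF p] ab])
    ultimately show ?case using Suc by (simp add: RS)
  qed
  from this[of m] show ?thesis using m(1) Rm by simp
qed

end

text \<open>The deck transformation exchanging the \<open>i\<close>-th and the \<open>j\<close>-th point up to a translation; it fixes
  the collisions \<open>y i = y j + w\<close>.\<close>

definition reflect :: "nat \<Rightarrow> nat \<Rightarrow> complex \<Rightarrow> (nat \<Rightarrow> complex) \<Rightarrow> nat \<Rightarrow> complex" where
  "reflect i j w y = (\<lambda>k. if k = i then y j + w else if k = j then y i - w else y k)"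

lemma cfg_reflect:
  assumes "i \<in> {1..n}" "j \<in> {1..n}" "w \<in> gauss_lattice"
  shows "cfg n (reflect i j w y) = cfg n y"
proof (rule cfg_permute)
  let ?\<sigma> = "\<lambda>k. if k = i then j else if k = j then i else k"
  show "?\<sigma> ` {1..n} = {1..n}"
  proof
    show "{1..n} \<subseteq> ?\<sigma> ` {1..n}"
    proof
      fix k assume k: "k \<in> {1..n}"
      have "k = ?\<sigma> (?\<sigma> k)" by auto
      moreover have "?\<sigma> k \<in> {1..n}" using assms k by auto
      ultimately show "k \<in> ?\<sigma> ` {1..n}" by (rule image_eqI)
    qed
  qed (use assms in auto)
  show "reflect i j w y k - y (?\<sigma> k) \<in> gauss_lattice" for k
    using assms(3) by (auto simp: reflect_def)
qed

lemma free_reflect: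
  assumes "i \<in> {1..n}" "j \<in> {1..n}" "w \<in> gauss_lattice"
  shows "free n (reflect i j w y) \<longleftrightarrow> free n y"
  by (simp add: free_iff_card cfg_reflect[OF assms])

lemma sum_reflect:
  assumes ij: "i \<in> {1..n}" "j \<in> {1..n}" "i \<noteq> j"
  shows "(\<Sum>k\<in>{1..n}. reflect i j w y k) = (\<Sum>k\<in>{1..n}. y k)"
proof -
  have "reflect i j w y k = y k + (if k = i then y j + w - y i else 0) - (if k = j then y j + w - y i else 0)" for k
    using ij(3) by (auto simp: reflect_def)
  then show ?thesis using ij by (simp add: sum.distrib sum_subtractf)
qed

context disc_killing begin

lemma val_endpoints:
  assumes "free_path n p" "free_path n q"
    and ends: "\<And>i. i \<in> {1..n} \<Longrightarrow> p 0 i = q 0 i" "\<And>i. i \<in> {1..n} \<Longrightarrow> p 1 i = q 1 i"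
  shows "val p = val q"
proof -
  have c1: "cfg n (p 1) = cfg n (q 1)" using ends by (auto intro!: cfg_cong)
  have "val (loop_join p (path_rev q)) = \<one>"
    using assms by (intro val_closed_lift free_path_join free_path_rev) auto
  moreover have "val (loop_join p (path_rev q)) = val p \<otimes> inv (val q)"
    using assms(1,2) c1 by (subst val_loop_join) (auto intro: free_path_rev simp: val_rev)
  ultimately have eq: "val p \<otimes> inv (val q) = \<one>" by simp
  show ?thesis
    using inv_equality[OF eq] assms(1,2) by simp
qed

definition trivially_joined :: "(nat \<Rightarrow> complex) \<Rightarrow> (nat \<Rightarrow> complex) \<Rightarrow> bool" where
  "trivially_joined y z \<longleftrightarrow> (\<exists>p. free_path n p \<and> p 0 = y \<and> p 1 = z \<and> val p = \<one>)"

lemma trivially_joinedD: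
  assumes "trivially_joined y z" "free_path n p"
    "\<And>i. i \<in> {1..n} \<Longrightarrow> p 0 i = y i" "\<And>i. i \<in> {1..n} \<Longrightarrow> p 1 i = z i"
  shows "val p = \<one>"
proof -
  obtain q where "free_path n q" "q 0 = y" "q 1 = z" "val q = \<one>"
    using assms(1) unfolding trivially_joined_def by blast
  then show ?thesis using val_endpoints[of p q] assms(2-4) by simp
qed

lemma trivially_joined_trans:
  assumes "trivially_joined x y" "trivially_joined y z"
  shows "trivially_joined x z"
proof -
  obtain p q where p: "free_path n p" "p 0 = x" "p 1 = y" "val p = \<one>"
    and q: "free_path n q" "q 0 = y" "q 1 = z" "val q = \<one>"
    using assms unfolding trivially_joined_def by blast
  have "free_path n (loop_join p q)" using p q by (intro free_path_join) auto
  moreover have "val (loop_join p q) = \<one>" using p q by (subst val_loop_join) auto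
  ultimately show ?thesis
    unfolding trivially_joined_def using p q by (intro exI[of _ "loop_join p q"]) auto
qed

lemma trivially_joined_eq:
  assumes "free n y" "free n z" "\<And>i. i \<in> {1..n} \<Longrightarrow> y i = z i"
  shows "trivially_joined y z"
proof -
  obtain p where p: "free_path n p" "p 0 = y" "p 1 = z" using free_connected[OF assms(1,2)] .
  then have "val p = \<one>" using assms(3) by (intro val_closed_lift) auto
  then show ?thesis using p unfolding trivially_joined_def by blast
qed

lemma trivially_joined_reflect:
  assumes ij: "i \<in> {1..n}" "j \<in> {1..n}" "i \<noteq> j" and w: "w \<in> gauss_lattice" and y: "free n y"
  shows "trivially_joined y (reflect i j w y)"
proof -
  define z where "z = (\<lambda>_. 0 :: complex)(i := w)"
  obtain \<epsilon> where \<epsilon>: "\<epsilon> > 0" "good z \<epsilon>" using good_exists by blast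
  obtain x where x: "free n x" "\<And>k. k \<in> {1..n} \<Longrightarrow> x k \<in> ball (z k) \<epsilon>"
    using free_obtain_near[OF \<epsilon>(1)] by blast
  let ?R = "reflect i j w"
  have Rx: "?R x k \<in> ball (z k) \<epsilon>" if "k \<in> {1..n}" for k
    using x(2)[OF that] x(2)[OF ij(1)] x(2)[OF ij(2)] ij(3)
    by (auto simp: reflect_def z_def dist_norm norm_minus_commute)
  have fR: "free n (?R u) \<longleftrightarrow> free n u" and cR: "cfg n (?R u) = cfg n u" for u
    using free_reflect cfg_reflect ij w by blast+
  obtain q where q: "free_path n q" "q 0 = x" "q 1 = ?R x"
    "\<And>t k. t \<in> {0..1} \<Longrightarrow> k \<in> {1..n} \<Longrightarrow> q t k \<in> ball (z k) \<epsilon>"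
    by (rule free_connect[OF x(1,2) _ Rx]) (use x(1) fR in auto)
  have "val q = \<one>"
    using \<epsilon>(2) q cR unfolding good_def by simp
  obtain p where p: "free_path n p" "p 0 = y" "p 1 = x" using free_connected[OF y x(1)] .
  let ?p = "\<lambda>t. ?R (p t)"
  have Rp: "free_path n ?p"
    unfolding free_path_def
  proof (intro conjI ballI)
    fix k assume k: "k \<in> {1..n}"
    have "continuous_on {0..1} (\<lambda>t. p t i)" "continuous_on {0..1} (\<lambda>t. p t j)" "continuous_on {0..1} (\<lambda>t. p t k)"
      using p(1) ij k by (auto simp: free_path_def)
    then show "continuous_on {0..1} (\<lambda>t. ?p t k)"
      by (cases "k = i"; cases "k = j") (auto simp: reflect_def intro!: continuous_intros)
  qed (use p(1) fR in \<open>auto simp: free_path_def\<close>)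
  have vRp: "val ?p = val p" by (rule val_eqI[OF p(1)]) (rule cR)
  let ?l = "loop_join p (loop_join q (path_rev ?p))"
  have l1: "free_path n (loop_join q (path_rev ?p))"
    using q p Rp by (intro free_path_join free_path_rev) auto
  have "val (loop_join q (path_rev ?p)) = val q \<otimes> inv (val p)"
    using q p Rp by (subst val_loop_join) (auto intro: free_path_rev simp: val_rev vRp)
  then have v1: "val (loop_join q (path_rev ?p)) = inv (val p)"
    using \<open>val q = \<one>\<close> p(1) by simp
  have "free_path n ?l" by (rule free_path_join[OF p(1) l1]) (simp add: p q)
  moreover have "val ?l = \<one>"
    using p q l1 v1 by (subst val_loop_join) auto
  ultimately show ?thesis
    unfolding trivially_joined_def using p q by (intro exI[of _ ?l]) auto
qed

lemma trivially_joined_if_sum_eq: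
  assumes z: "free n z" and "free n y" "cfg n y = cfg n z"
    and "(\<Sum>i\<in>{1..n}. y i) = (\<Sum>i\<in>{1..n}. z i)"
    and "m \<le> n" "\<And>i. i \<in> {1..n} \<Longrightarrow> m < i \<Longrightarrow> y i = z i"
  shows "trivially_joined y z"
  using assms(2-)
proof (induction m arbitrary: y)
  case 0
  then show ?case using z by (intro trivially_joined_eq) auto
next
  case (Suc m)
  show ?case
  proof (cases "m = 0")
    case True
    have n: "1 \<in> {1..n}" using Suc.prems by auto
    have rest: "(\<Sum>i\<in>{1..n} - {1}. y i) = (\<Sum>i\<in>{1..n} - {1}. z i)"
      by (intro sum.cong refl Suc.prems(5)) (auto simp: True)
    have "y 1 = z 1"
      using Suc.prems(3) rest sum.remove[OF _ n, of y] sum.remove[OF _ n, of z] by simp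
    then have "y i = z i" if "i \<in> {1..n}" for i
      using Suc.prems(5)[of i] that True by (cases "i = 1") auto
    then show ?thesis by (rule trivially_joined_eq[OF Suc.prems(1) z])
  next
    case False
    define s where "s = Suc m"
    have s: "s \<in> {1..n}" using Suc.prems by (simp add: s_def)
    have swap: "trivially_joined x z"
      if x: "free n x" "cfg n x = cfg n z" "(\<Sum>i\<in>{1..n}. x i) = (\<Sum>i\<in>{1..n}. z i)"
        "\<And>i. i \<in> {1..n} \<Longrightarrow> s < i \<Longrightarrow> x i = z i"
        and l: "l \<in> {1..n}" "l < s" "z s - x l \<in> gauss_lattice" for x l
    proof -
      let ?x = "reflect s l (z s - x l) x"
      have "trivially_joined x ?x"
        using l s x(1) by (intro trivially_joined_reflect) auto
      moreover have "trivially_joined ?x z"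
      proof (rule Suc.IH)
        show "free n ?x" "cfg n ?x = cfg n z" "(\<Sum>i\<in>{1..n}. ?x i) = (\<Sum>i\<in>{1..n}. z i)"
          using l s x sum_reflect[of s n l "z s - x l" x] by (simp_all add: free_reflect cfg_reflect)
        show "?x i = z i" if "i \<in> {1..n}" "m < i" for i
          using that l x(4)[of i] by (auto simp: reflect_def s_def)
      qed (use Suc.prems in simp)
      ultimately show ?thesis by (rule trivially_joined_trans)
    qed
    obtain l where l: "l \<in> {1..n}" "z s - y l \<in> gauss_lattice"
    proof -
      have "cov (z s) \<in> cfg n y" unfolding Suc.prems(2) using s by (auto simp: cfg_def)
      then show ?thesis using that by (auto simp: cfg_def cov_eq_iff)
    qed
    have "l \<le> s"
    proof (rule ccontr)
      assume "\<not> l \<le> s"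
      then have "z s - z l \<in> gauss_lattice" using l Suc.prems(5)[of l] by (simp add: s_def)
      then show False using freeD[OF z s l(1)] \<open>\<not> l \<le> s\<close> by auto
    qed
    show ?thesis
    proof (cases "l = s")
      case False
      then show ?thesis
        using swap[of y l] Suc.prems l \<open>l \<le> s\<close> by (simp add: s_def)
    next
      case True
      have 1: "1 \<in> {1..n}" "s \<noteq> 1" using s \<open>m \<noteq> 0\<close> by (auto simp: s_def)
      let ?x = "reflect s 1 0 y"
      have "trivially_joined y ?x"
        using s 1 Suc.prems by (intro trivially_joined_reflect) auto
      moreover have "trivially_joined ?x z"
      proof (rule swap[of _ 1])
        show "free n ?x" "cfg n ?x = cfg n z" "(\<Sum>i\<in>{1..n}. ?x i) = (\<Sum>i\<in>{1..n}. z i)"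
          using s 1 Suc.prems sum_reflect[of s n 1 0 y] by (simp_all add: free_reflect cfg_reflect)
        show "?x i = z i" if "i \<in> {1..n}" "s < i" for i
          using that Suc.prems(5)[of i] 1 s by (auto simp: reflect_def s_def)
        show "z s - ?x 1 \<in> gauss_lattice" using l True 1 by (simp add: reflect_def)
      qed (use 1 s in auto)
      ultimately show ?thesis by (rule trivially_joined_trans)
    qed
  qed
qed

lemma val_sum_preserving:
  assumes p: "free_path n p" and "cfg n (p 0) = cfg n (p 1)"
    and "(\<Sum>i\<in>{1..n}. p 0 i) = (\<Sum>i\<in>{1..n}. p 1 i)"
  shows "val p = \<one>"
proof (rule trivially_joinedD[OF _ p])
  show "trivially_joined (p 0) (p 1)"
    using assms by (intro trivially_joined_if_sum_eq[of _ _ n]) (auto simp: free_path_def)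
qed auto

end

section \<open>The displacement of a loop\<close>

text \<open>The lift to the plane of the path of products of the points, from which the class of that path in
  the fundamental group of the torus is read off.\<close>

definition displacement :: "(real \<Rightarrow> (complex \<times> complex) set) \<Rightarrow> complex \<Rightarrow> bool" where
  "displacement q d \<longleftrightarrow> (\<exists>f. continuous_on {0..1} f \<and>
     (\<forall>t\<in>{0..1}. cov (f t) = finprod torus_group (\<lambda>x. x) (q t)) \<and> f 1 - f 0 = d)"

lemma displacement_unique: "displacement q d \<Longrightarrow> displacement q d' \<Longrightarrow> d = d'"
proof -
  assume "displacement q d" "displacement q d'"
  then obtain f g where f: "continuous_on {0..1} f" "\<And>t. t \<in> {0..1} \<Longrightarrow> cov (f t) = finprod torus_group (\<lambda>x. x) (q t)"
      "f 1 - f 0 = d"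
    and g: "continuous_on {0..1} g" "\<And>t. t \<in> {0..1} \<Longrightarrow> cov (g t) = finprod torus_group (\<lambda>x. x) (q t)"
      "g 1 - g 0 = d'"
    unfolding displacement_def by blast
  have "f 1 - f 0 = g 1 - g 0"
    by (rule lift_unique[OF f(1) g(1)]) (simp_all add: f(2) g(2))
  then show ?thesis using f(3) g(3) by simp
qed

lemma finprod_cfg: "free n y \<Longrightarrow> finprod torus_group (\<lambda>x. x) (cfg n y) = cov (\<Sum>i\<in>{1..n}. y i)"
  unfolding cfg_def free_iff_inj by (rule finprod_cov)

lemma displacement_lift:
  assumes p: "free_path n p" and q: "\<And>t. t \<in> {0..1} \<Longrightarrow> cfg n (p t) = q t"
  shows "displacement q ((\<Sum>i\<in>{1..n}. p 1 i) - (\<Sum>i\<in>{1..n}. p 0 i))"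
  unfolding displacement_def
proof (intro exI[of _ "\<lambda>t. \<Sum>i\<in>{1..n}. p t i"] conjI ballI)
  show "continuous_on {0..1} (\<lambda>t. \<Sum>i\<in>{1..n}. p t i)"
    using p by (intro continuous_on_sum) (auto simp: free_path_def)
  show "cov (\<Sum>i\<in>{1..n}. p t i) = finprod torus_group (\<lambda>x. x) (q t)" if "t \<in> {0..1}" for t
    using finprod_cfg[of n "p t"] p that q by (simp add: free_path_def)
qed simp

lemma displacement_join:
  assumes "displacement p d" "displacement q d'" and pq: "p 1 = q 0"
  shows "displacement (loop_join p q) (d + d')"
proof -
  obtain f g where f: "continuous_on {0..1} f" "\<And>t. t \<in> {0..1} \<Longrightarrow> cov (f t) = finprod torus_group (\<lambda>x. x) (p t)"
      "f 1 - f 0 = d"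
    and g: "continuous_on {0..1} g" "\<And>t. t \<in> {0..1} \<Longrightarrow> cov (g t) = finprod torus_group (\<lambda>x. x) (q t)"
      "g 1 - g 0 = d'"
    using assms(1,2) unfolding displacement_def by blast
  define g' where "g' t = g t + (f 1 - g 0)" for t
  have "cov (f 1) = cov (g 0)" using f(2)[of 1] g(2)[of 0] pq by simp
  then have "f 1 - g 0 \<in> gauss_lattice" by (simp add: cov_eq_iff)
  then have "cov (g' t) = cov (g t)" for t by (simp add: cov_eq_iff g'_def)
  moreover have "pathin euclidean (loop_join f g')"
    using f(1) g(1) by (intro pathin_loop_join) (auto simp: pathin_def g'_def intro!: continuous_intros)
  ultimately show ?thesis
    unfolding displacement_def using f g
    by (intro exI[of _ "loop_join f g'"]) (auto simp: pathin_def loop_join_def g'_def)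
qed

lemma displacement_rev:
  assumes "displacement p d" shows "displacement (path_rev p) (- d)"
proof -
  obtain f where f: "continuous_on {0..1} f" "\<And>t. t \<in> {0..1} \<Longrightarrow> cov (f t) = finprod torus_group (\<lambda>x. x) (p t)"
      "f 1 - f 0 = d"
    using assms unfolding displacement_def by blast
  have "pathin euclidean (path_rev f)" using f(1) by (intro pathin_path_rev) (simp add: pathin_def)
  then show ?thesis
    unfolding displacement_def using f
    by (intro exI[of _ "path_rev f"]) (auto simp: pathin_def path_rev_def)
qed

lemma obtain_free_path_lift:
  assumes q: "pathin (conf n torus) q"
  obtains p where "free_path n p" "\<And>t. t \<in> {0..1} \<Longrightarrow> cfg n (p t) = q t"
proof -
  have qt: "q t \<in> topspace (conf n torus)" if "t \<in> {0..1}" for t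
    using q that unfolding pathin_def by (auto simp: continuous_map_def)
  obtain y where y: "cfg n y = q 0" using conf_obtain_lift[OF qt[of 0]] by auto
  obtain p where p: "\<And>i. i \<in> {1..n} \<Longrightarrow> continuous_on {0..1} (\<lambda>t. p t i)"
    "\<And>t. t \<in> {0..1} \<Longrightarrow> cfg n (p t) = q t"
    by (rule path_lift[OF q y]) blast
  have "free n (p t)" if "t \<in> {0..1}" for t
    using qt[OF that] p(2)[OF that] by (simp add: free_iff_card topspace_conf)
  then show ?thesis using that[of p] p by (simp add: free_path_def)
qed

text \<open>Subtracting from each point an equal share of the displacement deforms the loop into \<open>conf_e\<close>.\<close>

lemma displacement_0_imp_conf_e:
  assumes n: "n \<ge> 1" and q: "q \<in> loops (conf n torus) a" and d: "displacement q 0"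
    and a: "finprod torus_group (\<lambda>x. x) a = \<one>\<^bsub>torus_group\<^esub>"
  obtains q' where "q' \<in> loops (conf_e n) a" "path_homotopic (conf n torus) q q'"
proof -
  have qp: "pathin (conf n torus) q" "q 0 = a" "q 1 = a" using q by (auto simp: loops_iff)
  obtain p where p: "free_path n p" "\<And>t. t \<in> {0..1} \<Longrightarrow> cfg n (p t) = q t"
    by (rule obtain_free_path_lift[OF qp(1)]) blast
  define S where "S t = (\<Sum>i\<in>{1..n}. p t i)" for t
  have S01: "S 1 = S 0"
    using displacement_unique[OF displacement_lift[OF p] d] by (simp add: S_def)
  have covS: "cov (S 0) = \<one>\<^bsub>torus_group\<^esub>"
    using finprod_cfg[of n "p 0"] p a qp(2) by (simp add: S_def free_path_def)
  define P where "P s t i = p t i - (s / n) *\<^sub>R (S t - S 0)" for s t i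
  have free: "free n (P s t)" if "t \<in> {0..1}" for s t
    using p(1) that unfolding free_path_def free_def P_def by simp
  have contp: "continuous_on {0..1} (\<lambda>t. p t i)" if "i \<in> {1..n}" for i
    using p(1) that by (simp add: free_path_def)
  have contS: "continuous_on {0..1} S"
    unfolding S_def by (intro continuous_on_sum contp)
  have cont: "continuous_map (top_of_set ({0..1} \<times> {0..1})) (conf n torus) (\<lambda>x. cfg n (P (fst x) (snd x)))"
  proof (rule continuous_map_cfg)
    fix i assume i: "i \<in> {1..n}"
    have "continuous_on ({0..1} \<times> {0..1}) (\<lambda>x::real \<times> real. p (snd x) i)"
      using contp[OF i] by (rule continuous_on_compose2) (auto intro!: continuous_intros)
    moreover have "continuous_on ({0..1} \<times> {0..1}) (\<lambda>x::real \<times> real. S (snd x))"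
      using contS by (rule continuous_on_compose2) (auto intro!: continuous_intros)
    ultimately show "continuous_on ({0..1} \<times> {0..1}) (\<lambda>x::real \<times> real. P (fst x) (snd x) i)"
      unfolding P_def using n by (intro continuous_intros) auto
  qed (auto intro: free)
  let ?q = "\<lambda>t. cfg n (P 1 t)"
  have "pathin (conf n torus) ?q"
    unfolding pathin_def
    by (rule continuous_map_cfg) (use contp contS free in \<open>auto simp: P_def intro!: continuous_intros\<close>)
  moreover have "finprod torus_group (\<lambda>x. x) (?q t) = \<one>\<^bsub>torus_group\<^esub>" if t: "t \<in> {0..1}" for t
  proof -
    have "(\<Sum>i\<in>{1..n}. P 1 t i) = S t - n *\<^sub>R ((1 / n) *\<^sub>R (S t - S 0))"
      by (simp add: P_def sum_subtractf S_def scaleR_conv_of_real)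
    also have "\<dots> = S 0" using n by simp
    finally show ?thesis using finprod_cfg[OF free[OF t, of 1]] covS by simp
  qed
  ultimately have "pathin (conf_e n) ?q"
    unfolding conf_e_def pathin_def by (auto simp: continuous_map_in_subtopology)
  moreover have ends: "P s 0 = p 0" "P s 1 = p 1" for s by (auto simp: P_def S01)
  ultimately have "?q \<in> loops (conf_e n) a" using p(2) qp by (simp add: loops_iff)
  moreover have "path_homotopic (conf n torus) q ?q"
    unfolding path_homotopic_iff
  proof (intro exI[of _ "\<lambda>x. cfg n (P (fst x) (snd x))"] conjI cont ballI)
    show "cfg n (P (fst (0, t)) (snd (0, t))) = q t" if "t \<in> {0..1}" for t
    proof -
      have "P 0 t = p t" by (simp add: P_def fun_eq_iff)
      then show ?thesis using p(2)[OF that] by simp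
    qed
  qed (use ends p(2) qp in auto)
  ultimately show ?thesis by (rule that)
qed

section \<open>Loops in a disc\<close>

lemma disc_section:
  assumes "D \<subseteq> topspace torus"
    and "subtopology torus D homeomorphic_space top_of_set (cball (0::complex) 1)"
  obtains h where "continuous_map (subtopology torus D) euclidean h" "\<And>x. x \<in> D \<Longrightarrow> cov (h x) = x"
proof -
  obtain f g where fg: "homeomorphic_maps (subtopology torus D) (top_of_set (cball (0::complex) 1)) f g"
    using assms(2) unfolding homeomorphic_space_def by blast
  have f: "continuous_map (subtopology torus D) (top_of_set (cball 0 1)) f"
    and g: "continuous_map (top_of_set (cball 0 1)) (subtopology torus D) g"
    and gf: "\<And>x. x \<in> D \<Longrightarrow> g (f x) = x"
    using fg assms(1) by (auto simp: homeomorphic_maps_def)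
  have g': "continuous_on (cball 0 1) g" "\<And>u. u \<in> cball 0 1 \<Longrightarrow> g u \<in> sphere 0 1 \<times> sphere 0 1"
    using g by (auto simp: continuous_map_in_subtopology torus_eq Pi_iff)
  have norm1: "norm (fst (g u)) = 1" "norm (snd (g u)) = 1" if "u \<in> cball 0 1" for u
    using g'(2)[OF that] by auto
  obtain k where k: "continuous_on (cball 0 1) k" "\<And>u. u \<in> cball 0 1 \<Longrightarrow> fst (g u) = exp (k u)"
    by (rule continuous_logarithm_on_cball[of 0 1 "\<lambda>u. fst (g u)"])
       (use g'(1) norm1 in \<open>force intro!: continuous_intros\<close>)+
  obtain l where l: "continuous_on (cball 0 1) l" "\<And>u. u \<in> cball 0 1 \<Longrightarrow> snd (g u) = exp (l u)"
    by (rule continuous_logarithm_on_cball[of 0 1 "\<lambda>u. snd (g u)"])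
       (use g'(1) norm1 in \<open>force intro!: continuous_intros\<close>)+
  have cis: "exp w = cis (Im w)" if "norm (exp w) = 1" for w :: complex
  proof -
    have "exp (Re w) = 1" using that by (simp only: norm_exp_eq_Re)
    then show ?thesis by (simp add: exp_eq_polar)
  qed
  define h where "h u = Complex (Im (k u) / (2 * pi)) (Im (l u) / (2 * pi))" for u
  have "continuous_on (cball 0 1) h"
    unfolding h_def Complex_eq using k(1) l(1) by (intro continuous_intros) auto
  then have "continuous_map (subtopology torus D) euclidean (h \<circ> f)"
    by (intro continuous_map_compose[OF f]) simp
  moreover have "cov ((h \<circ> f) x) = x" if "x \<in> D" for x
  proof -
    have u: "f x \<in> cball 0 1"
      using f that assms(1) by (auto simp: continuous_map_def)
    have "fst (g (f x)) = cis (Im (k (f x)))" "snd (g (f x)) = cis (Im (l (f x)))"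
      using norm1[OF u] k(2)[OF u] l(2)[OF u] cis by auto
    then show ?thesis using gf[OF that] by (simp add: cov_def h_def prod_eq_iff)
  qed
  ultimately show ?thesis by (rule that)
qed

lemma displacement_disc:
  assumes D: "D \<subseteq> topspace torus"
    and disc: "subtopology torus D homeomorphic_space top_of_set (cball (0::complex) 1)"
    and q: "pathin (conf n (subtopology torus D)) q" "q 0 = q 1"
  shows "displacement q 0"
proof -
  obtain h where h: "continuous_map (subtopology torus D) euclidean h" "\<And>x. x \<in> D \<Longrightarrow> cov (h x) = x"
    using disc_section[OF D disc] by blast
  have qD: "q t \<subseteq> D" if "t \<in> {0..1}" for t
    using q(1) that unfolding pathin_def by (auto simp: continuous_map_def topspace_conf)
  have qX: "pathin (conf n torus) q"
    using continuous_map_compose[OF q(1)[unfolded pathin_def] continuous_map_conf_subtopology]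
    by (simp add: pathin_def o_def)
  show ?thesis
    unfolding displacement_def
  proof (intro exI[of _ "\<lambda>t. \<Sum>x\<in>q t. h x"] conjI ballI)
    show "continuous_on {0..1} (\<lambda>t. \<Sum>x\<in>q t. h x)"
      by (rule continuous_map_conf_section[OF qX qD h(1)])
    fix t :: real assume t: "t \<in> {0..1}"
    have "cov (h x) = x" if "x \<in> q t" for x using h(2) qD[OF t] that by blast
    then have "inj_on (\<lambda>x. cov (h x)) (q t)" "(\<lambda>x. cov (h x)) ` q t = q t"
      by (auto simp: inj_on_def image_iff)
    then show "cov (\<Sum>x\<in>q t. h x) = finprod torus_group (\<lambda>x. x) (q t)"
      using finprod_cov[of h "q t"] by simp
  qed (use q(2) in simp)
qed

lemma pathin_cfg_subtopology:
  assumes "free_path n p" "\<And>t i. t \<in> {0..1} \<Longrightarrow> i \<in> {1..n} \<Longrightarrow> cov (p t i) \<in> D"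
  shows "pathin (conf n (subtopology torus D)) (\<lambda>t. cfg n (p t))"
  unfolding pathin_def cfg_def
proof (rule continuous_map_conf)
  fix i assume i: "i \<in> {1..n}"
  have "continuous_map (top_of_set {0..1}) torus (cov \<circ> (\<lambda>t. p t i))"
    using assms(1) i by (intro continuous_map_compose[OF _ continuous_cov]) (simp add: free_path_def)
  then show "continuous_map (top_of_set {0..1}) (subtopology torus D) (\<lambda>t. cov (p t i))"
    using assms(2) i by (auto simp: continuous_map_in_subtopology o_def)
qed (use assms(1) in \<open>auto simp: free_path_def free_iff_inj\<close>)

text \<open>In the coordinates of the disc, shrinking towards one of the points moves the configuration into
  the given neighbourhood of that point.\<close>

lemma shrink_in_disc:
  assumes D: "D \<subseteq> topspace torus"
    and disc: "subtopology torus D homeomorphic_space top_of_set (cball (0::complex) 1)"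
    and A: "A \<subseteq> D" "finite A" "card A = n" and x: "x \<in> A" and W: "openin torus W" "x \<in> W"
  obtains p where "pathin (conf n (subtopology torus D)) p" "p 0 = A" "p 1 \<subseteq> W"
proof -
  obtain f g where fg: "homeomorphic_maps (subtopology torus D) (top_of_set (cball (0::complex) 1)) f g"
    using disc unfolding homeomorphic_space_def by blast
  have f: "continuous_map (subtopology torus D) (top_of_set (cball 0 1)) f"
    and g: "continuous_map (top_of_set (cball 0 1)) (subtopology torus D) g"
    and gf: "\<And>x. x \<in> D \<Longrightarrow> g (f x) = x" and fg': "\<And>u. u \<in> cball 0 1 \<Longrightarrow> f (g u) = u"
    using fg D by (auto simp: homeomorphic_maps_def)
  have fD: "f y \<in> cball 0 1" if "y \<in> D" for y
    using f that D by (auto simp: continuous_map_def)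
  have xD: "x \<in> D" using x A by blast
  define F where "F s y = g ((1 - s) *\<^sub>R f y + s *\<^sub>R f x)" for s :: real and y
  have in_ball: "(1 - s) *\<^sub>R f y + s *\<^sub>R f x \<in> cball 0 1" if "s \<in> {0..1}" "y \<in> D" for s y
    using fD[OF that(2)] fD[OF xD] that(1) by (intro convexD[OF convex_cball]) auto
  have contF: "continuous_map (top_of_set {0..1}) (subtopology torus D) (\<lambda>s. F s y)" if "y \<in> D" for y
  proof -
    have "continuous_map (top_of_set {0..1}) (top_of_set (cball 0 1)) (\<lambda>s. (1 - s) *\<^sub>R f y + s *\<^sub>R f x)"
      using in_ball[OF _ that] by (auto simp: continuous_map_in_subtopology image_subset_iff intro!: continuous_intros)
    from continuous_map_compose[OF this g] show ?thesis by (simp add: F_def o_def)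
  qed
  have "\<exists>U. open U \<and> 1 \<in> U \<and> (\<forall>s\<in>{0..1} \<inter> U. F s y \<in> W)" if y: "y \<in> A" for y
  proof -
    have "continuous_map (top_of_set {0..1}) torus (\<lambda>s. F s y)"
      using contF y A(1) continuous_map_into_fulltopology by blast
    from openin_continuous_map_preimage[OF this W(1)]
    obtain U where "open U" "{s \<in> {0..1}. F s y \<in> W} = {0..1} \<inter> U"
      by (auto simp: openin_open)
    moreover have "1 \<in> {s \<in> {0..1}. F s y \<in> W}" using W(2) gf[OF xD] by (simp add: F_def)
    ultimately show ?thesis by blast
  qed
  then obtain U where U: "\<And>y. y \<in> A \<Longrightarrow> open (U y)" "\<And>y. y \<in> A \<Longrightarrow> 1 \<in> U y"
    "\<And>y s. y \<in> A \<Longrightarrow> s \<in> {0..1} \<Longrightarrow> s \<in> U y \<Longrightarrow> F s y \<in> W"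
    by (metis IntI)
  have "open (\<Inter>y\<in>A. U y)" "1 \<in> (\<Inter>y\<in>A. U y)" using U A(2) by (auto intro: open_INT)
  then obtain \<delta> where \<delta>: "\<delta> > 0" "ball 1 \<delta> \<subseteq> (\<Inter>y\<in>A. U y)"
    by (meson open_contains_ball)
  define s0 where "s0 = max 0 (1 - \<delta> / 2)"
  have s0: "0 \<le> s0" "s0 < 1" "s0 \<in> ball 1 \<delta>" using \<delta>(1) by (auto simp: s0_def dist_real_def max_def)
  obtain h where h: "bij_betw h {1..n} A"
    using ex_bij_betw_nat_finite_1[OF A(2)] A(3) by auto
  have hA: "h i \<in> A" if "i \<in> {1..n}" for i using h that bij_betwE by blast
  let ?p = "\<lambda>t. (\<lambda>i. F (s0 * t) (h i)) ` {1..n}"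
  have st: "s0 * t \<in> {0..1}" "s0 * t < 1" if "t \<in> {0..1}" for t
    using s0 that mult_left_le[of t s0] by auto
  have "pathin (conf n (subtopology torus D)) ?p"
    unfolding pathin_def
  proof (rule continuous_map_conf)
    fix i assume "i \<in> {1..n}"
    then have hD: "h i \<in> D" using hA A(1) by blast
    have "continuous_map (top_of_set {0..1}) (top_of_set {0..1}) (\<lambda>t. s0 * t)"
      using st by (auto simp: continuous_map_in_subtopology intro!: continuous_intros)
    from continuous_map_compose[OF this contF[OF hD]]
    show "continuous_map (top_of_set {0..1}) (subtopology torus D) (\<lambda>t. F (s0 * t) (h i))"
      by (simp add: o_def)
  next
    fix t :: real assume "t \<in> topspace (top_of_set {0..1})"
    then have t: "t \<in> {0..1}" by simp
    show "inj_on (\<lambda>i. F (s0 * t) (h i)) {1..n}"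
    proof (rule inj_onI)
      fix i j assume ij: "i \<in> {1..n}" "j \<in> {1..n}" and eq: "F (s0 * t) (h i) = F (s0 * t) (h j)"
      have D': "h i \<in> D" "h j \<in> D" using ij hA A(1) by auto
      have "(1 - s0 * t) *\<^sub>R f (h i) + (s0 * t) *\<^sub>R f x = (1 - s0 * t) *\<^sub>R f (h j) + (s0 * t) *\<^sub>R f x"
        using eq fg'[OF in_ball[OF st(1)[OF t] D'(1)]] fg'[OF in_ball[OF st(1)[OF t] D'(2)]]
        unfolding F_def by metis
      then have "f (h i) = f (h j)" using st(2)[OF t] by simp
      then have "h i = h j" using gf[OF D'(1)] gf[OF D'(2)] by metis
      then show "i = j" using inj_onD[OF bij_betw_imp_inj_on[OF h] _ ij] by blast
    qed
  qed
  moreover have "?p 0 = A"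
  proof -
    have "F 0 (h i) = h i" if "i \<in> {1..n}" for i
      using gf[of "h i"] hA[OF that] A(1) by (auto simp: F_def)
    then have "?p 0 = h ` {1..n}" by (intro image_cong) simp_all
    then show ?thesis using h by (simp add: bij_betw_def)
  qed
  moreover have "?p 1 \<subseteq> W"
  proof
    fix w assume "w \<in> ?p 1"
    then obtain i where i: "i \<in> {1..n}" "w = F s0 (h i)" by auto
    have "s0 \<in> U (h i)" using \<delta>(2) s0(3) hA[OF i(1)] by blast
    then show "w \<in> W" using U(3)[OF hA[OF i(1)], of s0] i(2) s0 by simp
  qed
  ultimately show ?thesis by (rule that)
qed

section \<open>The normal closure of the braid group of the disc\<close>

lemma inclusion_image_conf_e:
  assumes n: "n \<ge> 1" and a: "finprod torus_group (\<lambda>x. x) a = \<one>\<^bsub>torus_group\<^esub>"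
  shows "inclusion_image (conf_e n) (conf n torus) a =
    loop_class (conf n torus) a ` {q \<in> loops (conf n torus) a. displacement q 0}"
proof -
  let ?X = "conf n torus"
  have "continuous_map (conf_e n) ?X (\<lambda>x. x)"
    unfolding conf_e_def by (rule continuous_map_from_subtopology) simp
  then have "inclusion_image (conf_e n) ?X a = loop_class ?X a ` loops (conf_e n) a"
    by (rule inclusion_image_eq)
  also have "\<dots> = loop_class ?X a ` {q \<in> loops ?X a. displacement q 0}"
  proof (intro equalityI image_subsetI)
    fix q assume q: "q \<in> loops (conf_e n) a"
    then have "q \<in> loops ?X a"
      by (auto simp: loops_iff conf_e_def pathin_subtopology)
    moreover have "finprod torus_group (\<lambda>x. x) (q t) = \<one>\<^bsub>torus_group\<^esub>" if "t \<in> {0..1}" for t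
      using q that unfolding loops_iff conf_e_def pathin_subtopology by blast
    then have "displacement q 0"
      unfolding displacement_def by (intro exI[of _ "\<lambda>_. 0"]) (auto simp: cov_0)
    ultimately show "loop_class ?X a q \<in> loop_class ?X a ` {q \<in> loops ?X a. displacement q 0}"
      by blast
  next
    fix q assume "q \<in> {q \<in> loops ?X a. displacement q 0}"
    then have q: "q \<in> loops ?X a" and d: "displacement q 0" by auto
    obtain q' where q': "q' \<in> loops (conf_e n) a" "path_homotopic ?X q q'"
      using displacement_0_imp_conf_e[OF n q d a] by blast
    then have "q' \<in> loops ?X a"
      using path_homotopic_imp[OF q'(2)] q by (auto simp: loops_iff)
    then have "loop_class ?X a q = loop_class ?X a q'"
      using loop_class_eq_iff[OF q] q'(2) by (simp only:)
    then show "loop_class ?X a q \<in> loop_class ?X a ` loops (conf_e n) a"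
      using q'(1) by (simp only: imageI)
  qed
  finally show ?thesis .
qed

lemma normal_displacement_0:
  fixes n a
  defines "X \<equiv> conf n torus"
  assumes a: "a \<in> topspace X"
  shows "loop_class X a ` {q \<in> loops X a. displacement q 0} \<lhd> fundamental_group X a"
proof -
  let ?G = "fundamental_group X a"
  let ?K = "loop_class X a ` {q \<in> loops X a. displacement q 0}"
  interpret group ?G by (rule group_fundamental_group[OF a])
  have ends: "p 0 = a" "p 1 = a" if "p \<in> loops X a" for p using that by (auto simp: loops_iff)
  have rev: "path_rev p \<in> loops X a" if "p \<in> loops X a" for p
    using that by (simp add: loops_iff pathin_path_rev)
  have disp: "\<exists>d. displacement p d" if "p \<in> loops X a" for p
  proof -
    have "pathin (conf n torus) p" using that by (simp add: X_def loops_iff)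
    then obtain p' where "free_path n p'" "\<And>t. t \<in> {0..1} \<Longrightarrow> cfg n (p' t) = p t"
      using obtain_free_path_lift by blast
    then show ?thesis using displacement_lift by blast
  qed
  show ?thesis
  proof (rule normal_invI)
    show "subgroup ?K ?G"
    proof (rule subgroupI)
      show "?K \<subseteq> carrier ?G" by (auto simp: carrier_fundamental_group)
      have "(\<lambda>_. a) \<in> loops X a" using a by (simp add: loops_def)
      moreover from this obtain d where "displacement (\<lambda>_. a) d" using disp by blast
      then have "displacement (\<lambda>_. a) 0"
        using displacement_join[of "\<lambda>_. a" d "\<lambda>_. a" "-d"] displacement_rev[of "\<lambda>_. a" d]
        by (simp add: path_rev_def loop_join_def)
      ultimately show "?K \<noteq> {}" by blast
    next
      fix x assume "x \<in> ?K"
      then obtain p where p: "p \<in> loops X a" "displacement p 0" "x = loop_class X a p" by blast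
      have "displacement (path_rev p) 0" using displacement_rev[OF p(2)] by simp
      then show "inv\<^bsub>?G\<^esub> x \<in> ?K"
        using p rev[OF p(1)] by (simp add: inv_fundamental_group)
    next
      fix x y assume "x \<in> ?K" "y \<in> ?K"
      then obtain p q where p: "p \<in> loops X a" "displacement p 0" "x = loop_class X a p"
        and q: "q \<in> loops X a" "displacement q 0" "y = loop_class X a q" by blast
      have "displacement (loop_join p q) 0"
        using displacement_join[OF p(2) q(2)] ends[OF p(1)] ends[OF q(1)] by simp
      then show "x \<otimes>\<^bsub>?G\<^esub> y \<in> ?K"
        using p q by (simp add: mult_fundamental_group loop_join_loops)
    qed
  next
    fix x y assume "x \<in> carrier ?G" "y \<in> ?K"
    then obtain p q where p: "p \<in> loops X a" "x = loop_class X a p"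
      and q: "q \<in> loops X a" "displacement q 0" "y = loop_class X a q"
      unfolding carrier_fundamental_group by blast
    obtain d where d: "displacement p d" using disp[OF p(1)] by blast
    have l: "loop_join p q \<in> loops X a" "path_rev p \<in> loops X a"
      using p(1) q(1) by (simp_all add: loop_join_loops rev)
    have "displacement (loop_join p q) d"
      using displacement_join[OF d q(2)] ends[OF p(1)] ends[OF q(1)] by simp
    from displacement_join[OF this displacement_rev[OF d]]
    have "displacement (loop_join (loop_join p q) (path_rev p)) 0"
      using ends[OF p(1)] ends[OF q(1)] by simp
    then have "loop_class X a (loop_join (loop_join p q) (path_rev p)) \<in> ?K"
      using loop_join_loops[OF l] by simp
    then show "x \<otimes>\<^bsub>?G\<^esub> y \<otimes>\<^bsub>?G\<^esub> inv\<^bsub>?G\<^esub> x \<in> ?K"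
      using p q l by (simp add: inv_fundamental_group mult_fundamental_group)
  qed
qed

lemma displacement_0_in_normal:
  fixes n D a
  defines "X \<equiv> conf n torus" and "Y \<equiv> conf n (subtopology torus D)"
  assumes n: "n \<ge> 1" and D: "D \<subseteq> topspace torus"
    and disc: "subtopology torus D homeomorphic_space top_of_set (cball (0::complex) 1)"
    and a: "a \<subseteq> torus interior_of D" "finite a" "card a = n"
    and N: "N \<lhd> fundamental_group X a" "loop_class X a ` loops Y a \<subseteq> N"
    and q: "q \<in> loops X a" "displacement q 0"
  shows "loop_class X a q \<in> N"
proof -
  have intD: "torus interior_of D \<subseteq> D" by (rule interior_of_subset)
  have aX: "a \<in> topspace X"
    using a intD D by (auto simp: X_def topspace_conf)
  have YX: "pathin X p" if "pathin Y p" for p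
    using continuous_map_compose[OF _ continuous_map_conf_subtopology, of _ n torus D p] that
    by (simp add: X_def Y_def pathin_def o_def)
  obtain c where c: "path_character (fundamental_group X a Mod N) X c"
    and cN: "\<And>p. p \<in> loops X a \<Longrightarrow> c p = \<one>\<^bsub>fundamental_group X a Mod N\<^esub> \<longleftrightarrow> loop_class X a p \<in> N"
    using path_character_exists[OF N(1) aX] conf_path_connected aX unfolding X_def by metis
  interpret C: path_character "fundamental_group X a Mod N" X c by (rule c)
  have "a \<noteq> {}" using a(3) n by auto
  then obtain x where x: "x \<in> a" by blast
  then have "x \<in> topspace torus" using a(1) intD D by blast
  then obtain b where b: "cov b = x" by (rule cov_surj)
  have "open (cov -` (torus interior_of D))"
    using openin_continuous_map_preimage[OF continuous_cov openin_interior_of[of torus D]]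
    by (simp add: vimage_def)
  moreover have "b \<in> cov -` (torus interior_of D)" using x a(1) b by auto
  ultimately obtain r where r: "r > 0" "ball b r \<subseteq> cov -` (torus interior_of D)"
    using open_contains_ball by blast
  have ballD: "cov z \<in> D" if "z \<in> ball b r" for z using r(2) that intD by blast
  have "openin torus (cov ` ball b r)" "x \<in> cov ` ball b r"
    using r(1) b by (auto intro: open_cov)
  then obtain p0 where p0: "pathin Y p0" "p0 0 = a" "p0 1 \<subseteq> cov ` ball b r"
    using shrink_in_disc[OF D disc _ a(2,3) x] a(1) intD unfolding Y_def by (metis order.trans)
  have "p0 1 \<in> topspace X" using path_finish_in_topspace[OF YX[OF p0(1)]] .
  then obtain y' where y': "cfg n y' = p0 1" "free n y'" unfolding X_def by (rule conf_obtain_lift)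
  have "\<exists>z\<in>ball b r. cov z = cov (y' i)" if "i \<in> {1..n}" for i
  proof -
    have "cov (y' i) \<in> p0 1" using that by (auto simp: cfg_def simp flip: y'(1))
    then have "cov (y' i) \<in> cov ` ball b r" using p0(3) by blast
    then show ?thesis by (auto intro: sym)
  qed
  then obtain y where y: "\<And>i. i \<in> {1..n} \<Longrightarrow> y i \<in> ball b r \<and> cov (y i) = cov (y' i)" by metis
  have cy: "cfg n y = p0 1" unfolding y'(1)[symmetric] using y by (intro cfg_cong) (simp add: cov_eq_iff[symmetric])
  then have fy: "free n y" using y' by (simp add: free_iff_card)
  interpret K: disc_killing "fundamental_group X a Mod N" n c b r
  proof (intro disc_killing.intro disc_killing_axioms.intro)
    show "path_character (fundamental_group X a Mod N) (conf n torus) c" using c by (simp add: X_def)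
    show "r > 0" by (rule r(1))
    fix p assume p: "free_path n p" and closed: "cfg n (p 0) = cfg n (p 1)"
      and near: "\<And>t i. t \<in> {0..1} \<Longrightarrow> i \<in> {1..n} \<Longrightarrow> \<exists>w\<in>gauss_lattice. p t i - w \<in> ball b r"
    let ?l = "\<lambda>t. cfg n (p t)"
    have "cov (p t i) \<in> D" if ti: "t \<in> {0..1}" "i \<in> {1..n}" for t i
    proof -
      obtain w where w: "w \<in> gauss_lattice" "p t i - w \<in> ball b r" using near[OF ti] by blast
      have "cov (p t i) = cov (p t i - w)" using w(1) by (simp add: cov_eq_iff)
      then show ?thesis using ballD[OF w(2)] by simp
    qed
    then have lY: "pathin Y ?l" unfolding Y_def by (rule pathin_cfg_subtopology[OF p])
    have "\<exists>z. z \<in> ball b r \<and> p 0 i - z \<in> gauss_lattice" if i: "i \<in> {1..n}" for i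
    proof -
      obtain w where "w \<in> gauss_lattice" "p 0 i - w \<in> ball b r" using near[of 0 i] i by auto
      then show ?thesis by (intro exI[of _ "p 0 i - w"]) simp
    qed
    then obtain z where z: "\<And>i. i \<in> {1..n} \<Longrightarrow> z i \<in> ball b r \<and> p 0 i - z i \<in> gauss_lattice" by metis
    have cz: "cfg n (p 0) = cfg n z" using z by (intro cfg_cong) blast
    have "free n (p 0)" using p by (simp add: free_path_def)
    then have fz: "free n z" by (simp add: free_iff_card cz)
    obtain p1 where p1: "free_path n p1" "p1 0 = y" "p1 1 = z"
      "\<And>t i. t \<in> {0..1} \<Longrightarrow> i \<in> {1..n} \<Longrightarrow> p1 t i \<in> ball b r"
      using free_connect[OF fy _ fz, of "\<lambda>_. b" r] y z by blast
    have p1Y: "pathin Y (\<lambda>t. cfg n (p1 t))"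
      unfolding Y_def using p1 ballD by (intro pathin_cfg_subtopology) auto
    define g where "g = loop_join p0 (\<lambda>t. cfg n (p1 t))"
    have g: "pathin Y g" "g 0 = a" "g 1 = cfg n (p 0)"
      unfolding g_def using p0 p1Y p1 cy cz by (auto intro!: pathin_loop_join)
    let ?m = "loop_join ?l (path_rev g)"
    have mY: "pathin Y ?m" using lY g closed by (intro pathin_loop_join pathin_path_rev) auto
    have gX: "pathin X g" "pathin X ?l" using YX g(1) lY by auto
    have gm: "loop_join g ?m \<in> loops Y a"
      using pathin_loop_join[OF g(1) mY] g by (simp add: loops_iff)
    then have "loop_join g ?m \<in> loops X a" using YX unfolding loops_iff by blast
    then have triv: "c (loop_join g ?m) = \<one>\<^bsub>fundamental_group X a Mod N\<^esub>"
      using cN gm N(2) by blast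
    show "c ?l = \<one>\<^bsub>fundamental_group X a Mod N\<^esub>"
      by (rule C.c_conjugate_trivial[OF gX _ _ triv]) (use g closed in auto)
  qed
  have qX: "pathin (conf n torus) q" using q(1) by (simp add: X_def loops_iff)
  obtain p where p: "free_path n p" "\<And>t. t \<in> {0..1} \<Longrightarrow> cfg n (p t) = q t"
    by (rule obtain_free_path_lift[OF qX]) blast
  have "(\<Sum>i\<in>{1..n}. p 1 i) - (\<Sum>i\<in>{1..n}. p 0 i) = 0"
    by (rule displacement_unique[OF displacement_lift[OF p] q(2)])
  then have "(\<Sum>i\<in>{1..n}. p 0 i) = (\<Sum>i\<in>{1..n}. p 1 i)" by simp
  moreover have "cfg n (p 0) = cfg n (p 1)" using p(2) q(1) by (simp add: loops_iff)
  ultimately have "K.val p = \<one>\<^bsub>fundamental_group X a Mod N\<^esub>" using K.val_sum_preserving[OF p(1)] by blast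
  moreover have "K.val p = c q"
  proof -
    have "pathin X q" using q(1) by (simp add: loops_iff)
    then show ?thesis unfolding K.val_def by (rule C.c_eqI) (rule p(2))
  qed
  ultimately show ?thesis using cN[OF q(1)] by simp
qed

theorem theorem1:
  fixes n :: nat and D :: "(complex \<times> complex) set" and x0 :: "(complex \<times> complex) set"
  assumes "n \<ge> 1"
    and "D \<subseteq> topspace torus"
    and "subtopology torus D homeomorphic_space top_of_set (cball (0::complex) 1)"
    and "x0 \<subseteq> torus interior_of D"
    and "finite x0" and "card x0 = n"
    and "finprod torus_group (\<lambda>x. x) x0 = \<one>\<^bsub>torus_group\<^esub>"
  shows "inclusion_image (conf_e n) (conf n torus) x0
       = normal_closure (fundamental_group (conf n torus) x0)
           (inclusion_image (conf n (subtopology torus D)) (conf n torus) x0)"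
proof -
  let ?X = "conf n torus" and ?Y = "conf n (subtopology torus D)"
  let ?G = "fundamental_group ?X x0"
  let ?K = "loop_class ?X x0 ` {q \<in> loops ?X x0. displacement q 0}"
  have K: "inclusion_image (conf_e n) ?X x0 = ?K"
    by (rule inclusion_image_conf_e[OF assms(1,7)])
  have B: "inclusion_image ?Y ?X x0 = loop_class ?X x0 ` loops ?Y x0"
    by (rule inclusion_image_eq[OF continuous_map_conf_subtopology])
  have "x0 \<in> topspace ?X"
    using assms(2,4-6) interior_of_subset[of torus D] by (auto simp: topspace_conf)
  then have "?K \<lhd> ?G" by (rule normal_displacement_0)
  moreover have "loop_class ?X x0 ` loops ?Y x0 \<subseteq> ?K"
  proof (rule image_subsetI)
    fix q assume q: "q \<in> loops ?Y x0"
    then have "pathin ?X q"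
      using continuous_map_compose[OF _ continuous_map_conf_subtopology, of _ n torus D q]
      by (simp add: loops_iff pathin_def o_def)
    moreover have "displacement q 0"
      using q by (intro displacement_disc[OF assms(2,3)]) (auto simp: loops_iff)
    ultimately show "loop_class ?X x0 q \<in> ?K" using q by (simp add: loops_iff)
  qed
  moreover have "?K \<subseteq> N" if "N \<lhd> ?G" "loop_class ?X x0 ` loops ?Y x0 \<subseteq> N" for N
    using displacement_0_in_normal[OF assms(1-6) that] by blast
  ultimately show ?thesis
    unfolding K B normal_closure_def by blast
qed

end
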